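(* Let $\Omega\subset\mathbb{R}^n$ be a bounded John domain, $1<p<\infty$, $0<s<1$, and let $0<\tau_1<\frac{1}{36\sqrt n}$ and $\frac35\le\tau_2<1$. Then there exists a constant $C$ such that $$\inf_{{\bf r}\in RM}|{\bf u}-{\bf r}|_{W^{s,p}_{\tau_1}(\Omega)^n}\le C\,|{\bf u}|_{X^{s,p}_{\tau_2}(\Omega)^n}$$ for every vector field ${\bf u}\in W^{s,p}_{\tau_2}(\Omega)^n$.
   Context: A bounded domain $D\subset\mathbb{R}^n$ is a John domain if there are $C\ge1$ and $x_0\in D$ such that every $x\in D$ can be joined to $x_0$ by a rectifiable curve $\gamma:[0,\ell]\to D$ parametrized by arc length with $\gamma(0)=x$, $\gamma(\ell)=x_0$ and $d(\gamma(t),\partial D)\ge t/C$ for all $t\in[0,\ell]$. $RM=\{{\bf r}(x)=Ax+b: A\in\mathbb{R}^{n\times n}\text{ skew-symmetric}, b\in\mathbb{R}^n\}$. With $\delta(x)=\mathrm{dist}(x,\partial\Omega)$ and $\tau\in(0,1)$: $|{\bf u}|_{W^{s,p}_\tau(\Omega)^n}=\left(\int_\Omega\int_{B(x,\tau\delta(x))}\frac{|{\bf u}(y)-{\bf u}(x)|^p}{|y-x|^{n+sp}}dy\,dx\right)^{1/p}$ and $|{\bf u}|_{X^{s,p}_\tau(\Omega)^n}=\left(\int_\Omega\int_{B(x,\tau\delta(x))}\frac{|({\bf u}(y)-{\bf u}(x))\cdot(y-x)|^p}{|y-x|^{n+sp+p}}dy\,dx\right)^{1/p}$. $W^{s,p}_\tau(\Omega)^n$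 is the space of ${\bf u}\in L^p(\Omega)^n$ with $|{\bf u}|_{W^{s,p}_\tau(\Omega)^n}<\infty$. *)

theory Defs
  imports "HOL-Analysis.Analysis"
begin

definition curve_length :: "(real \<Rightarrow> 'a::real_normed_vector) \<Rightarrow> real \<Rightarrow> real \<Rightarrow> ennreal" where
  "curve_length \<gamma> a b =
     (SUP (k, t) \<in> {(k::nat, t::nat \<Rightarrow> real). t 0 = a \<and> t k = b \<and> (\<forall>i<k. t i \<le> t (Suc i))}.
        ennreal (\<Sum>i<k. norm (\<gamma> (t (Suc i)) - \<gamma> (t i))))"

definition john_domain :: "(real^'n) set \<Rightarrow> bool" where
  "john_domain D \<longleftrightarrow> open D \<and> connected D \<and> D \<noteq> {} \<and> bounded D \<and>
     (\<exists>C::real. C \<ge> 1 \<and> (\<exists>x0\<in>D. \<forall>x\<in>D. \<exists>(\<gamma>::real \<Rightarrow> real^'n) (l::real).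
        l \<ge> 0 \<and> continuous_on {0..l} \<gamma> \<and> \<gamma> ` {0..l} \<subseteq> D \<and>
        \<gamma> 0 = x \<and> \<gamma> l = x0 \<and>
        curve_length \<gamma> 0 l < \<infinity> \<and>
        (\<forall>t\<in>{0..l}. curve_length \<gamma> 0 t = ennreal t) \<and>
        (\<forall>t\<in>{0..l}. infdist (\<gamma> t) (frontier D) \<ge> t / C)))"

definition RM :: "(real^'n \<Rightarrow> real^'n) set" where
  "RM = {(\<lambda>x. A *v x + b) | (A::real^'n^'n) b. transpose A = - A}"

definition enn_root :: "real \<Rightarrow> ennreal \<Rightarrow> ennreal" where
  "enn_root p I = (if I = \<infinity> then \<infinity> else ennreal (enn2real I powr (1 / p)))"

definition bdist :: "(real^'n) set \<Rightarrow> real^'n \<Rightarrow> real" where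
  "bdist \<Omega> x = infdist x (frontier \<Omega>)"

definition W_semi :: "(real^'n) set \<Rightarrow> real \<Rightarrow> real \<Rightarrow> real \<Rightarrow> (real^'n \<Rightarrow> real^'n) \<Rightarrow> ennreal" where
  "W_semi \<Omega> s p \<tau> u = enn_root p
     (\<integral>\<^sup>+ x \<in> \<Omega>. (\<integral>\<^sup>+ y \<in> ball x (\<tau> * bdist \<Omega> x).
        ennreal (norm (u y - u x) powr p / norm (y - x) powr (real CARD('n) + s * p)) \<partial>lebesgue) \<partial>lebesgue)"

definition X_semi :: "(real^'n) set \<Rightarrow> real \<Rightarrow> real \<Rightarrow> real \<Rightarrow> (real^'n \<Rightarrow> real^'n) \<Rightarrow> ennreal" where
  "X_semi \<Omega> s p \<tau> u = enn_root p
     (\<integral>\<^sup>+ x \<in> \<Omega>. (\<integral>\<^sup>+ y \<in> ball x (\<tau> * bdist \<Omega> x).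
        ennreal (\<bar>(u y - u x) \<bullet> (y - x)\<bar> powr p / norm (y - x) powr (real CARD('n) + s * p + p)) \<partial>lebesgue) \<partial>lebesgue)"

definition Lp_vec :: "(real^'n) set \<Rightarrow> real \<Rightarrow> (real^'n \<Rightarrow> real^'n) \<Rightarrow> bool" where
  "Lp_vec \<Omega> p u \<longleftrightarrow> u \<in> borel_measurable (lebesgue_on \<Omega>) \<and>
     (\<integral>\<^sup>+ x \<in> \<Omega>. ennreal (norm (u x) powr p) \<partial>lebesgue) < \<infinity>"

definition W_space :: "(real^'n) set \<Rightarrow> real \<Rightarrow> real \<Rightarrow> real \<Rightarrow> (real^'n \<Rightarrow> real^'n) set" where
  "W_space \<Omega> s p \<tau> = {u. Lp_vec \<Omega> p u \<and> W_semi \<Omega> s p \<tau> u < \<infinity>}"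

end

theory Submission
  imports Defs
begin

text \<open>
  If \<open>(u a - u b) \<bullet> (a - b)\<close> vanishes at the pairs from a nondegenerate configuration of
  \<open>n + 1\<close> points, then \<open>u\<close> agrees there with a rigid motion; quantitatively, on a ball of radius
  \<open>\<rho>\<close> the distance of \<open>u\<close> from some rigid motion is controlled by the strain of pairs in the
  concentric ball of radius \<open>2\<rho>\<close>, the configuration being selected by Markov's inequality.
  A pair \<open>x, y\<close> at distance \<open>h\<close> is then linked to a fixed ball around the John centre by
  balls whose radii grow geometrically from about \<open>h\<close>: first concentric at \<open>x\<close>, then along the
  John curve. Since \<open>s < 1\<close>, the power of \<open>h\<close> remaining after comparing the
  skew matrices of consecutive balls is integrable with room to spare. So the sum over the chain
  can be dominated by a kernel in \<open>h\<close>, \<open>dist a b\<close>, \<open>dist a x\<close> (with \<open>a, b\<close> ranging over the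
  pairs of the right-hand side), and Tonelli's theorem concludes.
\<close>

section \<open>Rigid motions from point configurations\<close>

text \<open>The constants fit together as follows. A ball of radius \<open>\<rho>\<close> yields a
  rigid motion that is controlled within radius \<open>\<rho> / (2 * sqrt n)\<close>; a pair at
  distance \<open>h\<close> needs \<open>2 * h\<close> there, hence
  \<open>\<rho> = 4 * sqrt n * h\<close>. If a chain ball of radius \<open>r\<close> has boundary
  distance at least \<open>9 * r\<close>, then two points of its double ball are less than
  \<open>4 * r\<close> apart and have boundary distance at least \<open>7 * r\<close>; as
  \<open>4 / 7 < 3 / 5\<close>, the right-hand side sees this pair. The product of 9 and
  \<open>4 * sqrt n\<close> is \<open>36 * sqrt n\<close>. One skew matrix must serve all pairs
  \<open>x, y\<close>. It is the matrix of the last ball, whose centre and radius are the same for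
  every chain; translations cancel in \<open>u y - u x\<close>. The obstacle is that chains have
  unbounded length and are chosen without any measurability in \<open>x\<close>. Each link is
  therefore bounded by a kernel that does not mention the chain. The sum over the links costs a
  factor \<open>h powr (- \<alpha>)\<close>, and \<open>\<alpha> = (1 - s) * p / 2\<close> is half
  of what \<open>s < 1\<close> leaves over.\<close>

text \<open>With \<open>M\<close> the largest quotient \<open>a i / w i\<close>, every
  \<open>a i\<close> is at most \<open>w i * M\<close>, and \<open>M powr p\<close> is one of the
  summands on the right. This replaces Hoelder's inequality and holds for every
  \<open>p > 0\<close>.\<close>

lemma sum_powr_le_weighted:
  fixes a w :: "'a \<Rightarrow> real"
  assumes "finite S" and "0 < p" and a: "\<And>i. i \<in> S \<Longrightarrow> 0 \<le> a i" and w: "\<And>i. i \<in> S \<Longrightarrow> 0 < w i"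
  shows "(\<Sum>i\<in>S. a i) powr p \<le> (\<Sum>i\<in>S. w i) powr p * (\<Sum>i\<in>S. (a i / w i) powr p)"
proof (cases "S = {}")
  case False
  define M where "M = Max ((\<lambda>i. a i / w i) ` S)"
  have "M \<in> (\<lambda>i. a i / w i) ` S"
    unfolding M_def using assms False by (intro Max_in) auto
  then obtain j where j: "j \<in> S" "M = a j / w j" by auto
  have "M \<ge> 0" using j a w by (auto simp: less_imp_le)
  have "a i \<le> w i * M" if "i \<in> S" for i
  proof -
    have "a i / w i \<le> M" unfolding M_def using assms that by (intro Max_ge) auto
    then show ?thesis using w[OF that] by (simp add: field_simps)
  qed
  then have "(\<Sum>i\<in>S. a i) \<le> (\<Sum>i\<in>S. w i) * M"
    by (simp add: sum_distrib_right sum_mono)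
  then have "(\<Sum>i\<in>S. a i) powr p \<le> ((\<Sum>i\<in>S. w i) * M) powr p"
    using assms by (intro powr_mono2) (auto intro: sum_nonneg)
  also have "\<dots> = (\<Sum>i\<in>S. w i) powr p * M powr p"
    using \<open>M \<ge> 0\<close> w by (intro powr_mult)
  also have "M powr p \<le> (\<Sum>i\<in>S. (a i / w i) powr p)"
    unfolding j(2) using assms(1) j(1) by (intro member_le_sum) auto
  finally show ?thesis by (simp add: mult_left_mono)
qed (use assms in auto)

lemma sum_powr_le:
  fixes a :: "'a \<Rightarrow> real"
  assumes "finite S" and "0 < p" and "\<And>i. i \<in> S \<Longrightarrow> 0 \<le> a i"
  shows "(\<Sum>i\<in>S. a i) powr p \<le> real (card S) powr p * (\<Sum>i\<in>S. a i powr p)"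
  using sum_powr_le_weighted[of S p a "\<lambda>_. 1"] assms by simp

lemma add_powr_le:
  fixes a b :: real
  assumes "0 < p" "0 \<le> a" "0 \<le> b"
  shows "(a + b) powr p \<le> 2 powr p * (a powr p + b powr p)"
  using sum_powr_le[of "UNIV :: bool set" p "\<lambda>c. if c then a else b"] assms
  by (simp add: UNIV_bool add.commute)

text \<open>The components of \<open>v\<close> along the \<open>d i\<close> differ from its
  coordinates by a vector of Euclidean norm at most \<open>\<theta> * norm v\<close>, because the
  tolerance carries the divisor \<open>sqrt (real CARD('n))\<close>. This error is absorbed on the
  left, so nearly orthonormal directions determine \<open>v\<close>.\<close>

lemma norm_le_sum_abs_inner:
  fixes d :: "'n::finite \<Rightarrow> real^'n"
  assumes d: "\<And>i. norm (d i - axis i 1) \<le> \<theta> / sqrt (real CARD('n))" and "0 \<le> \<theta>"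
  shows "(1 - \<theta>) * norm v \<le> (\<Sum>i\<in>UNIV. \<bar>v \<bullet> d i\<bar>)"
proof -
  have eq: "v $ i = v \<bullet> d i + v \<bullet> (axis i 1 - d i)" for i
    by (simp add: inner_axis inner_diff_right)
  have "norm v = L2_set (\<lambda>i. v \<bullet> d i + v \<bullet> (axis i 1 - d i)) UNIV"
    unfolding norm_vec_def L2_set_def using eq by (intro arg_cong[where f = sqrt] sum.cong) auto
  also have "\<dots> \<le> L2_set (\<lambda>i. v \<bullet> d i) UNIV + L2_set (\<lambda>i. v \<bullet> (axis i 1 - d i)) UNIV"
    by (rule L2_set_triangle_ineq)
  also have "L2_set (\<lambda>i. v \<bullet> d i) UNIV \<le> (\<Sum>i\<in>UNIV. \<bar>v \<bullet> d i\<bar>)"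
    by (rule L2_set_le_sum_abs)
  also have "L2_set (\<lambda>i. v \<bullet> (axis i 1 - d i)) UNIV \<le> sqrt (\<Sum>i\<in>(UNIV::'n set). (norm v * (\<theta> / sqrt (real CARD('n))))\<^sup>2)"
    unfolding L2_set_def
  proof (intro real_sqrt_le_mono sum_mono)
    fix i :: 'n
    have "\<bar>v \<bullet> (axis i 1 - d i)\<bar> \<le> norm v * norm (axis i 1 - d i)"
      by (rule Cauchy_Schwarz_ineq2)
    also have "\<dots> \<le> norm v * (\<theta> / sqrt (real CARD('n)))"
      using d[of i] by (intro mult_left_mono) (auto simp: norm_minus_commute)
    finally show "(v \<bullet> (axis i 1 - d i))\<^sup>2 \<le> (norm v * (\<theta> / sqrt (real CARD('n))))\<^sup>2"
      by (metis abs_ge_zero power2_abs power_mono)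
  qed
  also have "\<dots> = norm v * \<theta>"
    using \<open>0 \<le> \<theta>\<close> by (simp add: power_mult_distrib power_divide real_sqrt_mult)
  finally show ?thesis by (simp add: algebra_simps)
qed

text \<open>Against the basis \<open>q\<close>, the symmetric part of the interpolating matrix has
  the entries \<open>(w i \<bullet> q j + w j \<bullet> q i) / 2\<close>, which is exactly what the
  hypothesis on \<open>t\<close> bounds. That the \<open>q i\<close> form a basis, and that small
  entries give a small vector, both come from \<open>B\<close>.\<close>

lemma skew_approx:
  fixes q w :: "'n::finite \<Rightarrow> real^'n"
  assumes q: "\<And>i. norm (q i - axis i 1) \<le> (1/2) / sqrt (real CARD('n))"
    and t: "\<And>i j. \<bar>w i \<bullet> q j + w j \<bullet> q i\<bar> \<le> t"
  shows "\<exists>A::real^'n^'n. transpose A = - A \<and> (\<forall>i. norm (w i - A *v q i) \<le> real CARD('n) * t)"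
proof -
  define Q :: "real^'n^'n" where "Q = (\<chi> i. q i)"
  have Qv: "(Q *v v) $ i = v \<bullet> q i" for v i
    by (simp add: Q_def matrix_vector_mult_def inner_vec_def mult.commute)
  have B: "norm v \<le> 2 * (\<Sum>i\<in>UNIV. \<bar>v \<bullet> q i\<bar>)" for v
    using norm_le_sum_abs_inner[of q "1/2" v] q by simp
  have "\<forall>x. Q *v x = 0 \<longrightarrow> x = 0"
  proof (intro allI impI)
    fix x assume "Q *v x = 0"
    then have "x \<bullet> q i = 0" for i using Qv[of x i] by simp
    then show "x = 0" using B[of x] by simp
  qed
  then obtain R where R: "R ** Q = mat 1"
    using matrix_left_invertible_ker by blast
  define W :: "real^'n^'n" where "W = (\<chi> i. w i)"
  define M where "M = transpose W ** transpose R"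
  have RQ: "Q ** R = mat 1" using R matrix_left_right_inverse by blast
  have "transpose Q *v axis i 1 = q i" for i
    by (auto simp: vec_eq_iff Q_def transpose_def matrix_vector_mult_def axis_def if_distrib cong: if_cong)
  moreover have "transpose W *v axis i 1 = w i" for i
    by (auto simp: vec_eq_iff W_def transpose_def matrix_vector_mult_def axis_def if_distrib cong: if_cong)
  moreover have "transpose R ** transpose Q = mat 1"
    by (metis RQ matrix_transpose_mul transpose_mat)
  ultimately have Mq: "M *v q i = w i" for i
    unfolding M_def by (metis matrix_vector_mul_assoc matrix_vector_mul_lid)
  define A where "A = (1/2) *\<^sub>R (M - transpose M)"
  \<comment> \<open>\<open>M\<close> interpolates the data exactly; its symmetric part \<open>S\<close> is small on the basis \<open>q\<close>\<close>
  define S where "S = (1/2) *\<^sub>R (M + transpose M)"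
  have "transpose A = - A"
    by (simp add: A_def transpose_def vec_eq_iff field_simps)
  moreover have "norm (w i - A *v q i) \<le> real CARD('n) * t" for i
  proof -
    have "M = A + S" by (simp add: A_def S_def vec_eq_iff field_simps)
    then have S: "w i - A *v q i = S *v q i"
      by (metis Mq add_diff_cancel_left' matrix_vector_mult_add_rdistrib)
    have "\<bar>(S *v q i) \<bullet> q j\<bar> \<le> t / 2" for j
    proof -
      have "(transpose M *v q i) \<bullet> q j = q i \<bullet> (M *v q j)"
        by (simp add: dot_lmul_matrix flip: vector_transpose_matrix) 
      then have "(S *v q i) \<bullet> q j = (w i \<bullet> q j + w j \<bullet> q i) / 2"
        by (simp add: S_def matrix_vector_mult_add_rdistrib scaleR_matrix_vector_assoc[symmetric] inner_left_distrib inner_right_distrib Mq inner_commute)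
      then show ?thesis using t[of i j] by simp
    qed
    then have "(\<Sum>j\<in>UNIV. \<bar>(S *v q i) \<bullet> q j\<bar>) \<le> (\<Sum>j\<in>(UNIV::'n set). t / 2)"
      by (intro sum_mono) auto
    then show ?thesis using B[of "S *v q i"] unfolding S by simp
  qed
  ultimately show ?thesis by blast
qed

lemma skew_inner_self:
  fixes A :: "real^'n^'n"
  assumes "transpose A = - A"
  shows "(A *v x) \<bullet> x = 0"
proof -
  have "(A *v x) \<bullet> x = x \<bullet> (transpose A *v x)"
    by (metis dot_lmul_matrix inner_commute transpose_matrix_vector)
  moreover have "- A *v x = - (A *v x)"
    by (simp add: vec_eq_iff matrix_vector_mult_def sum_negf)
  ultimately show ?thesis using assms by (simp add: inner_commute)
qed

lemma norm_matrix_vector_mult_le: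
  fixes A :: "real^'m^'n"
  shows "norm (A *v x) \<le> norm A * norm x"
proof -
  have "norm (A *v x) \<le> L2_set (\<lambda>i. norm (A $ i) * norm x) UNIV"
    unfolding norm_vec_def[of "A *v x"]
    by (intro L2_set_mono) (auto simp: matrix_vector_mul_component Cauchy_Schwarz_ineq2)
  also have "\<dots> = norm A * norm x"
    by (subst L2_set_left_distrib[symmetric]) (auto simp: norm_vec_def[of A])
  finally show ?thesis .
qed

text \<open>Each row of \<open>A\<close> is a vector tested against the nearly orthonormal
  directions \<open>q i\<close>, its products being coordinates of \<open>A *v q i\<close>.\<close>

lemma norm_matrix_le_basis:
  fixes A :: "real^'n^'m" and q :: "'n \<Rightarrow> real^'n"
  assumes q: "\<And>i. norm (q i - axis i 1) \<le> (1/2) / sqrt (real CARD('n))"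
    and t: "\<And>i. norm (A *v q i) \<le> t"
  shows "norm A \<le> 2 * real CARD('n) * real CARD('m) * t"
proof -
  have "norm (A $ k) \<le> 2 * real CARD('n) * t" for k
  proof -
    have "\<bar>A $ k \<bullet> q i\<bar> \<le> t" for i
      using t[of i] component_le_norm_cart[of "A *v q i" k] by (simp add: matrix_vector_mul_component)
    then have "(\<Sum>i\<in>UNIV. \<bar>A $ k \<bullet> q i\<bar>) \<le> (\<Sum>i\<in>(UNIV::'n set). t)"
      by (intro sum_mono) auto
    then show ?thesis using norm_le_sum_abs_inner[of q "1/2" "A $ k"] q by simp
  qed
  then have "(\<Sum>k\<in>UNIV. norm (A $ k)) \<le> (\<Sum>k\<in>(UNIV::'m set). 2 * real CARD('n) * t)"
    by (intro sum_mono) auto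
  moreover have "norm A \<le> (\<Sum>k\<in>UNIV. norm (A $ k))"
    unfolding norm_vec_def by (rule L2_set_le_sum) auto
  ultimately show ?thesis by (simp add: ac_simps)
qed

section \<open>Selecting good points by Markov's inequality\<close>

text \<open>By Markov's inequality each \<open>bad i\<close> fills at most the fraction
  \<open>1 / m\<close> of \<open>B\<close>, so fewer than \<open>m\<close> such sets cannot cover
  \<open>B\<close>.\<close>

lemma nn_Markov_choice:
  fixes f :: "'i \<Rightarrow> 'a \<Rightarrow> ennreal"
  assumes B: "B \<in> sets M" "emeasure M B \<noteq> 0" "emeasure M B \<noteq> \<infinity>"
    and "finite I" and f: "\<And>i. i \<in> I \<Longrightarrow> f i \<in> borel_measurable M"
    and m: "card I < m"
  shows "\<exists>z\<in>B. \<forall>i\<in>I. emeasure M B * f i z \<le> of_nat m * (\<integral>\<^sup>+x\<in>B. f i x \<partial>M)"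
proof (rule ccontr)
  define bad where "bad i = {z\<in>B. \<not> emeasure M B * f i z \<le> of_nat m * (\<integral>\<^sup>+x\<in>B. f i x \<partial>M)}" for i
  assume "\<not> ?thesis"
  then have sub: "B \<subseteq> (\<Union>i\<in>I. bad i)" by (auto simp: bad_def)
  define V where "V = enn2real (emeasure M B)"
  have V: "emeasure M B = ennreal V" "V > 0"
    using B by (auto simp: V_def less_top enn2real_positive_iff zero_less_iff_neq_zero top.not_eq_extremum)
  have bad_sets: "bad i \<in> sets M" if "i \<in> I" for i
  proof -
    have "B \<inter> {z\<in>space M. \<not> emeasure M B * f i z \<le> of_nat m * (\<integral>\<^sup>+x\<in>B. f i x \<partial>M)} \<in> sets M"
      using f[OF that] B(1) by measurable
    moreover have "B \<subseteq> space M" using B(1) sets.sets_into_space by blast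
    ultimately show ?thesis by (auto simp: bad_def Int_def conj_commute cong: conj_cong elim!: back_subst[where P="\<lambda>S. S \<in> sets M"])
  qed
  have bad_le: "of_nat m * emeasure M (bad i) \<le> emeasure M B" if i: "i \<in> I" for i
  proof -
    let ?c = "\<integral>\<^sup>+x\<in>B. f i x \<partial>M"
    have le: "of_nat m * ?c * emeasure M (bad i) \<le> emeasure M B * ?c"
    proof -
      have "of_nat m * ?c * emeasure M (bad i) = (\<integral>\<^sup>+x. (of_nat m * ?c) * indicator (bad i) x \<partial>M)"
        using bad_sets[OF i] by (simp add: nn_integral_cmult_indicator)
      also have "\<dots> \<le> (\<integral>\<^sup>+x. emeasure M B * (f i x * indicator B x) \<partial>M)"
        by (intro nn_integral_mono) (auto simp: bad_def indicator_def mult.assoc)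
      also have "\<dots> = emeasure M B * ?c"
        using f[OF i] B(1) by (intro nn_integral_cmult) auto
      finally show ?thesis .
    qed
    \<comment> \<open>The integral can be cancelled from \<open>le\<close> only when it is positive
      and finite. If it is infinite no point is bad; if it vanishes the bad set is null.\<close>
    consider "?c = \<infinity>" | "?c = 0" | c where "?c = ennreal c" "c > 0"
      by (cases ?c) (auto simp: less_le)
    then show ?thesis
    proof cases
      case 1
      then have "bad i = {}" using m by (auto simp: bad_def ennreal_mult_top)
      then show ?thesis by simp
    next
      case 2
      then have "AE x in M. f i x * indicator B x = 0"
        using f[OF i] B(1) by (subst (asm) nn_integral_0_iff_AE) auto
      then have "AE x in M. x \<notin> bad i"
        by eventually_elim (use 2 V in \<open>auto simp: bad_def indicator_def split: if_splits\<close>)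
      then have "emeasure M (bad i) = 0"
        using bad_sets[OF i] by (subst AE_iff_measurable[symmetric, where P="\<lambda>x. x \<notin> bad i"])
          (use sets.sets_into_space[OF bad_sets[OF i]] in auto)
      then show ?thesis by simp
    next
      case (3 c)
      have "ennreal c * (of_nat m * emeasure M (bad i)) \<le> ennreal c * emeasure M B"
        using le 3 by (simp add: ac_simps)
      then show ?thesis using 3 by (subst (asm) ennreal_mult_le_mult_iff) auto
    qed
  qed
  have "of_nat m * emeasure M B \<le> of_nat m * (\<Sum>i\<in>I. emeasure M (bad i))"
    using sub bad_sets \<open>finite I\<close>
    by (intro mult_left_mono order_trans[OF emeasure_mono[of B] emeasure_subadditive_finite]) auto
  also have "\<dots> \<le> (\<Sum>i\<in>I. emeasure M B)"
    unfolding sum_distrib_left by (intro sum_mono bad_le)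
  finally have "ennreal (real m * V) \<le> ennreal (real (card I) * V)"
    using V by (simp add: ennreal_mult ennreal_of_nat_eq_real_of_nat)
  then show False using m V by simp
qed

text \<open>The numerator in the integrand of \<open>X_semi\<close>. Without division by the
  distance, its signed version obeys an exact identity on triangles, on which
  \<open>skew_from_configuration\<close> rests.\<close>

definition strain :: "(real^'n \<Rightarrow> real^'n) \<Rightarrow> real^'n \<Rightarrow> real^'n \<Rightarrow> real" where
  "strain u a b = \<bar>(u a - u b) \<bullet> (a - b)\<bar>"

lemma strain_commute: "strain u a b = strain u b a"
  unfolding strain_def by (metis inner_minus_left inner_minus_right minus_diff_eq minus_minus)

lemma strain_self [simp]: "strain u a a = 0"
  by (simp add: strain_def)

lemma strain_nonneg [simp]: "0 \<le> strain u a b"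
  by (simp add: strain_def)

lemma strain_measurable [measurable]:
  assumes [measurable]: "u \<in> borel_measurable borel" "f \<in> borel_measurable M" "g \<in> borel_measurable M"
  shows "(\<lambda>x. strain u (f x) (g x)) \<in> borel_measurable M"
  unfolding strain_def by measurable

lemma pred_mem_ball [measurable]:
  fixes f g :: "'a \<Rightarrow> 'b::{second_countable_topology, metric_space}"
  assumes [measurable]: "f \<in> borel_measurable M" "g \<in> borel_measurable M" "r \<in> borel_measurable M"
  shows "Measurable.pred M (\<lambda>x. g x \<in> ball (f x) (r x))"
  unfolding mem_ball by measurable

text \<open>The doubled radius makes room for configuration points at distance about
  \<open>\<rho>\<close> from \<open>x\<close>. No power of the distance appears: the weights are
  supplied by the scale of the ball.\<close>

definition energy :: "real \<Rightarrow> (real^'n \<Rightarrow> real^'n) \<Rightarrow> real^'n \<Rightarrow> real \<Rightarrow> ennreal" where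
  "energy p u x \<rho> = (\<integral>\<^sup>+a\<in>ball x (2 * \<rho>). (\<integral>\<^sup>+b\<in>ball x (2 * \<rho>). ennreal (strain u a b powr p) \<partial>lborel) \<partial>lborel)"

lemma emeasure_ball_cart:
  "0 \<le> r \<Longrightarrow> emeasure lborel (ball (x::real^'n) r) = ennreal (unit_ball_vol (real CARD('n)) * r ^ CARD('n))"
  by (simp add: emeasure_ball)

lemma ball_choice:
  fixes f :: "'i \<Rightarrow> real^'n \<Rightarrow> ennreal"
  assumes "0 < r" and "finite I" and "\<And>i. i \<in> I \<Longrightarrow> f i \<in> borel_measurable borel" and "card I < m"
  shows "\<exists>z\<in>ball c r. \<forall>i\<in>I. f i z \<le> ennreal (real m / (unit_ball_vol (real CARD('n)) * r ^ CARD('n))) * (\<integral>\<^sup>+x\<in>ball c r. f i x \<partial>lborel)"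
proof -
  define V where "V = unit_ball_vol (real CARD('n)) * r ^ CARD('n)"
  have V: "V > 0" "emeasure lborel (ball c r) = ennreal V"
    using \<open>0 < r\<close> by (auto simp: V_def emeasure_ball_cart)
  obtain z where z: "z \<in> ball c r"
      "\<And>i. i \<in> I \<Longrightarrow> ennreal V * f i z \<le> of_nat m * (\<integral>\<^sup>+x\<in>ball c r. f i x \<partial>lborel)"
    using nn_Markov_choice[of "ball c r" lborel I f m] assms V by auto
  have "f i z \<le> ennreal (real m / V) * (\<integral>\<^sup>+x\<in>ball c r. f i x \<partial>lborel)" if "i \<in> I" for i
  proof -
    have "ennreal (1 / V) * (ennreal V * f i z) \<le> ennreal (1 / V) * (of_nat m * (\<integral>\<^sup>+x\<in>ball c r. f i x \<partial>lborel))"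
      using z(2)[OF that] by (intro mult_left_mono) auto
    then show ?thesis
      using V by (simp add: mult.assoc[symmetric] ennreal_mult[symmetric] ennreal_of_nat_eq_real_of_nat)
  qed
  then show ?thesis using z(1) unfolding V_def by blast
qed

lemma borel_measurable_pair_compose:
  assumes "case_prod g \<in> borel_measurable (borel \<Otimes>\<^sub>M borel)" "f \<in> borel_measurable M" "h \<in> borel_measurable M"
  shows "(\<lambda>x. g (f x) (h x)) \<in> borel_measurable M"
  using measurable_compose[OF measurable_Pair[OF assms(2,3)] assms(1)] by simp

text \<open>The points are picked one at a time. A new point has to see each earlier
  \<open>z l\<close> with small \<open>g\<close>, and the average of \<open>g x (z l)\<close> over
  \<open>x\<close> is governed by the marginal integral at \<open>z l\<close>; this is why the
  marginal bound is part of the claim. Averaging twice produces \<open>k * k\<close>.\<close>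

lemma config_choice:
  fixes g :: "real^'n \<Rightarrow> real^'n \<Rightarrow> ennreal"
  assumes "0 < r" and [measurable]: "B \<in> sets borel" "case_prod g \<in> borel_measurable (borel \<Otimes>\<^sub>M borel)"
    and sym: "\<And>a b. g a b = g b a" and diag: "\<And>a. g a a = 0"
    and k: "k = ennreal (real m / (unit_ball_vol (real CARD('n)) * r ^ CARD('n)))"
    and "finite S" and "card S < m" and "\<And>i. i \<in> S \<Longrightarrow> ball (c i) r \<subseteq> B"
  shows "\<exists>z. (\<forall>i\<in>S. z i \<in> ball (c i) r \<and>
           (\<integral>\<^sup>+b\<in>B. g (z i) b \<partial>lborel) \<le> k * (\<integral>\<^sup>+a\<in>B. (\<integral>\<^sup>+b\<in>B. g a b \<partial>lborel) \<partial>lborel) \<and>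
           (\<forall>j\<in>S. g (z i) (z j) \<le> k * (k * (\<integral>\<^sup>+a\<in>B. (\<integral>\<^sup>+b\<in>B. g a b \<partial>lborel) \<partial>lborel))))"
  using \<open>finite S\<close> assms(8-)
proof (induction S)
  case (insert i S)
  define F where "F a = (\<integral>\<^sup>+b\<in>B. g a b \<partial>lborel)" for a
  note gm = borel_measurable_pair_compose[OF assms(3)]
  have [measurable]: "F \<in> borel_measurable borel"
    unfolding F_def
  proof (rule lborel.borel_measurable_nn_integral)
    have "(\<lambda>x. g (fst x) (snd x) * indicator B (snd x)) \<in> borel_measurable (borel \<Otimes>\<^sub>M lborel)"
      by (intro borel_measurable_times_ennreal gm) measurable
    then show "(\<lambda>(a, b). g a b * indicator B b) \<in> borel_measurable (borel \<Otimes>\<^sub>M lborel)"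
      by (simp add: split_beta')
  qed
  obtain z where z: "\<And>j. j \<in> S \<Longrightarrow> z j \<in> ball (c j) r"
      "\<And>j. j \<in> S \<Longrightarrow> F (z j) \<le> k * (\<integral>\<^sup>+a\<in>B. F a \<partial>lborel)"
      "\<And>j l. j \<in> S \<Longrightarrow> l \<in> S \<Longrightarrow> g (z j) (z l) \<le> k * (k * (\<integral>\<^sup>+a\<in>B. F a \<partial>lborel))"
    using insert.IH insert.prems insert.hyps unfolding F_def by fastforce
  \<comment> \<open>One requirement for the marginal (\<open>None\<close>) and one for each earlier
    point: together as many as the enlarged index set has elements, so its cardinality bound by
    \<open>m\<close> is just what the selection needs.\<close>
  define f where "f j = (case j of None \<Rightarrow> F | Some l \<Rightarrow> (\<lambda>a. g a (z l)))" for j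
  have "\<exists>y\<in>ball (c i) r. \<forall>j\<in>insert None (Some ` S). f j y \<le> k * (\<integral>\<^sup>+x\<in>ball (c i) r. f j x \<partial>lborel)"
    unfolding k using insert.prems insert.hyps \<open>0 < r\<close>
    by (intro ball_choice) (auto simp: f_def card_image gm)
  then obtain y where y: "y \<in> ball (c i) r"
      "F y \<le> k * (\<integral>\<^sup>+x\<in>ball (c i) r. F x \<partial>lborel)"
      "\<And>l. l \<in> S \<Longrightarrow> g y (z l) \<le> k * (\<integral>\<^sup>+x\<in>ball (c i) r. g x (z l) \<partial>lborel)"
    unfolding f_def by fastforce
  have sub: "(\<integral>\<^sup>+x\<in>ball (c i) r. h x \<partial>lborel) \<le> (\<integral>\<^sup>+x\<in>B. h x \<partial>lborel)" for h :: "real^'n \<Rightarrow> ennreal"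
    using insert.prems(2)[of i] by (intro nn_integral_mono) (auto simp: indicator_def)
  have F: "F y \<le> k * (\<integral>\<^sup>+a\<in>B. F a \<partial>lborel)"
    using y(2) sub[of F] by (meson mult_left_mono order_trans zero_le)
  have G: "g y (z l) \<le> k * (k * (\<integral>\<^sup>+a\<in>B. F a \<partial>lborel))" if "l \<in> S" for l
  proof -
    have "g y (z l) \<le> k * F (z l)"
      using y(3)[OF that] sub[of "\<lambda>x. g x (z l)"] unfolding F_def sym[of "z l"]
      by (meson mult_left_mono order_trans zero_le)
    also have "\<dots> \<le> k * (k * (\<integral>\<^sup>+a\<in>B. F a \<partial>lborel))"
      using z(2)[OF that] by (intro mult_left_mono) auto
    finally show ?thesis .
  qed
  then have G': "g (z l) y \<le> k * (k * (\<integral>\<^sup>+a\<in>B. F a \<partial>lborel))" if "l \<in> S" for l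
    using that sym[of "z l" y] by simp
  have "\<forall>j\<in>insert i S. (z(i := y)) j \<in> ball (c j) r \<and> F ((z(i := y)) j) \<le> k * (\<integral>\<^sup>+a\<in>B. F a \<partial>lborel) \<and>
      (\<forall>l\<in>insert i S. g ((z(i := y)) j) ((z(i := y)) l) \<le> k * (k * (\<integral>\<^sup>+a\<in>B. F a \<partial>lborel)))"
    using z y(1) F G G' diag insert.hyps by auto
  then show ?case unfolding F_def by (intro exI)
qed auto

section \<open>From strains to rigid motions on a ball\<close>

text \<open>Polarisation: the signed strains along the three edges of the triangle
  \<open>z None\<close>, \<open>z (Some i)\<close>, \<open>z (Some j)\<close> combine to the
  symmetrised products that \<open>skew_approx\<close> requires, whence the factor 3.
  \<open>None\<close> is the base point, and dividing by \<open>\<rho>\<close> brings the edges from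
  it close to the standard basis.\<close>

lemma skew_from_configuration:
  fixes u :: "real^'n \<Rightarrow> real^'n" and z :: "'n option \<Rightarrow> real^'n"
  assumes "0 < \<rho>"
    and z: "\<And>i. norm (z (Some i) - z None - \<rho> *\<^sub>R axis i 1) \<le> \<rho> * ((1/2) / sqrt (real CARD('n)))"
    and t: "\<And>a b. strain u (z a) (z b) \<le> t"
  shows "\<exists>A::real^'n^'n. transpose A = - A \<and>
    (\<forall>i. norm (u (z i) - u (z None) - A *v (z i - z None)) \<le> 3 * real CARD('n) * t / \<rho>)"
proof -
  define q where "q i = (1/\<rho>) *\<^sub>R (z (Some i) - z None)" for i
  define w where "w i = u (z (Some i)) - u (z None)" for i
  have q: "norm (q i - axis i 1) \<le> (1/2) / sqrt (real CARD('n))" for i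
  proof -
    have "q i - axis i 1 = (1/\<rho>) *\<^sub>R (z (Some i) - z None - \<rho> *\<^sub>R axis i 1)"
      using \<open>0 < \<rho>\<close> by (simp add: q_def scaleR_diff_right)
    then have "norm (q i - axis i 1) = norm (z (Some i) - z None - \<rho> *\<^sub>R axis i 1) / \<rho>"
      using \<open>0 < \<rho>\<close> by simp
    also have "\<dots> \<le> (1/2) / sqrt (real CARD('n))"
      using z[of i] \<open>0 < \<rho>\<close> by (simp add: divide_le_eq mult.commute)
    finally show ?thesis .
  qed
  have w: "\<bar>w i \<bullet> q j + w j \<bullet> q i\<bar> \<le> 3 * t / \<rho>" for i j
  proof -
    let ?e = "\<lambda>a b. (u (z a) - u (z b)) \<bullet> (z a - z b)"
    have "w i \<bullet> (z (Some j) - z None) + w j \<bullet> (z (Some i) - z None) = ?e (Some i) None + ?e (Some j) None - ?e (Some i) (Some j)"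
      by (simp add: w_def inner_diff_left inner_diff_right)
    then have "w i \<bullet> q j + w j \<bullet> q i = (?e (Some i) None + ?e (Some j) None - ?e (Some i) (Some j)) / \<rho>"
      by (simp add: q_def flip: add_divide_distrib)
    also have "\<bar>\<dots>\<bar> \<le> (3 * t) / \<rho>"
      unfolding abs_divide using t[of "Some i" None] t[of "Some j" None] t[of "Some i" "Some j"] \<open>0 < \<rho>\<close>
      unfolding strain_def by (intro frac_le) auto
    finally show ?thesis by simp
  qed
  obtain A0 :: "real^'n^'n" where A0: "transpose A0 = - A0"
      "\<And>i. norm (w i - A0 *v q i) \<le> real CARD('n) * (3 * t / \<rho>)"
    using skew_approx[OF q w] by blast
  define A where "A = (1/\<rho>) *\<^sub>R A0"
  have "transpose A = (1/\<rho>) *\<^sub>R transpose A0"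
    by (simp add: A_def transpose_def vec_eq_iff)
  then have "transpose A = - A" by (simp add: A0(1) A_def)
  moreover have "norm (u (z i) - u (z None) - A *v (z i - z None)) \<le> 3 * real CARD('n) * t / \<rho>" for i
  proof (cases i)
    case None
    have "0 \<le> t" using t[of None None] by simp
    then show ?thesis using None \<open>0 < \<rho>\<close> by simp
  next
    case (Some j)
    have "A *v (z i - z None) = A0 *v q j"
      by (simp add: A_def q_def Some scaleR_matrix_vector_assoc[symmetric] matrix_vector_mult_scaleR)
    then show ?thesis using A0(2)[of j] Some by (simp add: w_def ac_simps)
  qed
  ultimately show ?thesis by blast
qed

text \<open>A rigid motion does not contribute to the strain, so the components of
  \<open>u - r\<close> at \<open>y\<close> along the directions \<open>y - z i\<close> are controlled by the values of
  \<open>u - r\<close> at \<open>z i\<close>.\<close>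

lemma rigid_pointwise:
  fixes u :: "real^'n \<Rightarrow> real^'n" and z :: "'n \<Rightarrow> real^'n" and A :: "real^'n^'n"
  assumes "0 < p" "0 < \<rho>" and A: "transpose A = - A"
    and z: "\<And>i. norm (z i - y - \<rho> *\<^sub>R axis i 1) \<le> \<rho> * ((3/4) / sqrt (real CARD('n)))"
    and t: "\<And>i. norm (u (z i) - (A *v z i + b)) \<le> t"
  shows "norm (u y - (A *v y + b)) powr p \<le>
    (16 * real CARD('n)) powr p * (\<rho> powr (-p) * (\<Sum>i\<in>UNIV. strain u y (z i) powr p) + real CARD('n) * t powr p)"
proof -
  define v where "v = u y - (A *v y + b)"
  define d where "d i = (1/\<rho>) *\<^sub>R (z i - y)" for i
  have t0: "0 \<le> t" using t norm_ge_zero order_trans by blast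
  have n1: "1 \<le> sqrt (real CARD('n))" by (simp add: Suc_leI)
  have de: "norm (d i - axis i 1) \<le> (3/4) / sqrt (real CARD('n))" for i
  proof -
    have "d i - axis i 1 = (1/\<rho>) *\<^sub>R (z i - y - \<rho> *\<^sub>R axis i 1)"
      using \<open>0 < \<rho>\<close> by (simp add: d_def scaleR_diff_right)
    then have "norm (d i - axis i 1) = norm (z i - y - \<rho> *\<^sub>R axis i 1) / \<rho>"
      using \<open>0 < \<rho>\<close> by simp
    also have "\<dots> \<le> (3/4) / sqrt (real CARD('n))"
      using z[of i] \<open>0 < \<rho>\<close> by (simp add: divide_le_eq mult.commute)
    finally show ?thesis .
  qed
  have d2: "norm (d i) \<le> 2" for i
  proof -
    have "norm (d i) \<le> norm (d i - axis i 1) + norm (axis i 1 :: real^'n)"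
      by (metis diff_add_cancel norm_triangle_ineq)
    moreover have "(3/4) / sqrt (real CARD('n)) \<le> 3/4"
      using n1 by (simp add: divide_le_eq)
    ultimately show ?thesis using de[of i] by simp
  qed
  have vd: "\<bar>v \<bullet> d i\<bar> \<le> strain u y (z i) / \<rho> + 2 * t" for i
  proof -
    define e where "e = u (z i) - (A *v z i + b)"
    have "v = (u y - u (z i)) + e - A *v (y - z i)"
      by (simp add: v_def e_def matrix_vector_mult_diff_distrib)
    then have "v \<bullet> (y - z i) = (u y - u (z i)) \<bullet> (y - z i) + e \<bullet> (y - z i)"
      using skew_inner_self[OF A, of "y - z i"] by (simp add: inner_diff_left inner_left_distrib)
    moreover have "v \<bullet> d i = - ((v \<bullet> (y - z i)) / \<rho>)" "e \<bullet> d i = - ((e \<bullet> (y - z i)) / \<rho>)"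
      by (simp_all add: d_def inner_diff_right diff_divide_distrib)
    ultimately have "v \<bullet> d i = e \<bullet> d i - ((u y - u (z i)) \<bullet> (y - z i)) / \<rho>"
      by (simp add: add_divide_distrib)
    then have "\<bar>v \<bullet> d i\<bar> \<le> \<bar>((u y - u (z i)) \<bullet> (y - z i)) / \<rho>\<bar> + \<bar>e \<bullet> d i\<bar>"
      by (metis abs_triangle_ineq4 add.commute)
    also have "\<bar>e \<bullet> d i\<bar> \<le> t * 2"
      using t[of i] d2[of i] t0 unfolding e_def[symmetric]
      by (meson Cauchy_Schwarz_ineq2 mult_mono norm_ge_zero order_trans)
    finally show ?thesis using \<open>0 < \<rho>\<close> by (simp add: strain_def)
  qed
  \<comment> \<open>Origin of the constant \<open>16 * real CARD('n)\<close>: a factor 4 from the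
    tolerance \<open>3/4\<close>, the number of directions from the power of a sum, and another 4
    from separating strain and deviation.\<close>
  have "(1 - 3/4) * norm v \<le> (\<Sum>i\<in>UNIV. \<bar>v \<bullet> d i\<bar>)"
    by (rule norm_le_sum_abs_inner) (use de in auto)
  also have "\<dots> \<le> (\<Sum>i\<in>UNIV. strain u y (z i) / \<rho> + 2 * t)"
    by (intro sum_mono vd)
  finally have "norm v \<le> 4 * (\<Sum>i\<in>UNIV. strain u y (z i) / \<rho> + 2 * t)" by simp
  then have "norm v powr p \<le> (4 * (\<Sum>i\<in>UNIV. strain u y (z i) / \<rho> + 2 * t)) powr p"
    using \<open>0 < p\<close> by (intro powr_mono2) auto
  also have "\<dots> = 4 powr p * (\<Sum>i\<in>UNIV. strain u y (z i) / \<rho> + 2 * t) powr p"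
    using t0 \<open>0 < \<rho>\<close> by (intro powr_mult)
  also have "(\<Sum>i\<in>UNIV. strain u y (z i) / \<rho> + 2 * t) powr p
      \<le> real CARD('n) powr p * (\<Sum>i\<in>UNIV. (strain u y (z i) / \<rho> + 2 * t) powr p)"
    using assms(1,2) t0 by (intro sum_powr_le) auto
  also have "(\<Sum>i\<in>UNIV. (strain u y (z i) / \<rho> + 2 * t) powr p)
      \<le> (\<Sum>i\<in>UNIV. 4 powr p * (\<rho> powr (-p) * strain u y (z i) powr p + t powr p))"
  proof (intro sum_mono)
    fix i :: 'n
    have "(strain u y (z i) / \<rho> + 2 * t) powr p \<le> 2 powr p * ((strain u y (z i) / \<rho>) powr p + (2 * t) powr p)"
      using assms(1,2) t0 by (intro add_powr_le) auto
    also have "(strain u y (z i) / \<rho>) powr p = \<rho> powr (-p) * strain u y (z i) powr p"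
      using \<open>0 < \<rho>\<close> by (simp add: powr_divide powr_minus_divide)
    also have "(2 * t) powr p = 2 powr p * t powr p" by (simp add: powr_mult)
    also have "2 powr p * (\<rho> powr (-p) * strain u y (z i) powr p + 2 powr p * t powr p)
        \<le> 2 powr p * (2 powr p * (\<rho> powr (-p) * strain u y (z i) powr p) + 2 powr p * t powr p)"
      using mult_right_mono[OF ge_one_powr_ge_zero[of 2 p], of "\<rho> powr (-p) * strain u y (z i) powr p"] \<open>0 < p\<close>
      by (intro mult_left_mono add_right_mono) auto
    also have "\<dots> = (2 powr p * 2 powr p) * (\<rho> powr (-p) * strain u y (z i) powr p + t powr p)"
      by (simp add: algebra_simps)
    also have "2 powr p * 2 powr p = (4::real) powr p"
      by (simp flip: powr_mult)
    finally show "(strain u y (z i) / \<rho> + 2 * t) powr p \<le> 4 powr p * (\<rho> powr (-p) * strain u y (z i) powr p + t powr p)" .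
  qed
  finally have "norm v powr p \<le> 4 powr p * (real CARD('n) powr p * (\<Sum>i\<in>(UNIV::'n set). 4 powr p * (\<rho> powr (-p) * strain u y (z i) powr p + t powr p)))"
    by (simp add: mult_left_mono)
  also have "\<dots> = (4 powr p * real CARD('n) powr p * 4 powr p) * (\<rho> powr (-p) * (\<Sum>i\<in>UNIV. strain u y (z i) powr p) + real CARD('n) * t powr p)"
    by (simp add: sum.distrib flip: sum_distrib_left)
  also have "4 powr p * real CARD('n) powr p * 4 powr p = (16 * real CARD('n)) powr p"
    by (simp flip: powr_mult)
  finally show ?thesis unfolding v_def .
qed

lemma matrix_vector_mult_measurable [measurable]:
  fixes A :: "real^'m^'n"
  assumes "f \<in> borel_measurable M"
  shows "(\<lambda>x. A *v f x) \<in> borel_measurable M"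
proof -
  have "continuous_on UNIV ((*v) A)"
    by (intro linear_continuous_on linear_conv_bounded_linear[THEN iffD1] matrix_vector_mul_linear)
  then have "(*v) A \<in> borel_measurable borel"
    by (rule borel_measurable_continuous_onI)
  then show ?thesis using assms by (rule measurable_compose[rotated])
qed

lemma le_powr_inverse:
  fixes a b p :: real
  assumes "0 < p" "0 \<le> a" "a powr p \<le> b"
  shows "a \<le> b powr (1 / p)"
proof -
  have "(a powr p) powr (1 / p) \<le> b powr (1 / p)"
    using assms by (intro powr_mono2) auto
  then show ?thesis using assms by (simp add: powr_powr)
qed

text \<open>The skew matrix comes from the pairwise strains of a selected configuration;
  \<open>rigid_pointwise\<close> is then integrated over \<open>y\<close>. Besides the pairwise
  strains this uses the strains between \<open>z i\<close> and a variable \<open>y\<close>, whose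
  integrals were controlled in the same selection. On the small ball, \<open>y\<close> can replace
  the base point without spoiling the directions towards the \<open>z i\<close>.\<close>

lemma local_rigid_approx:
  assumes "0 < p"
  shows "\<exists>C>0. \<forall>u\<in>borel_measurable borel. \<forall>x::real^'n. \<forall>\<rho>>0. \<exists>A b. transpose A = - A \<and>
    (\<integral>\<^sup>+y\<in>ball x (\<rho> / (2 * sqrt (real CARD('n)))). ennreal (norm (u y - (A *v y + b)) powr p) \<partial>lborel)
      \<le> ennreal (C * \<rho> powr (- p - real CARD('n))) * energy p u x \<rho>"
proof -
  define n where "n = real CARD('n)"
  define v0 where "v0 = unit_ball_vol n"
  \<comment> \<open>In units of \<open>\<rho> / sqrt n\<close>: two selected points err by
    \<open>1/8 + 1/8\<close>, below the tolerance \<open>1/2\<close> of the configuration, and a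
    selected point against \<open>y\<close> in the small ball errs by \<open>1/8 + 1/2\<close>,
    below the tolerance \<open>3/4\<close> of \<open>rigid_pointwise\<close>.\<close>
  define \<epsilon> where "\<epsilon> = 1 / (8 * sqrt n)"
  \<comment> \<open>The configuration has \<open>n + 1\<close> points, and the selection asks for a
    strictly larger multiplier.\<close>
  define \<kappa>0 where "\<kappa>0 = (n + 2) / (v0 * \<epsilon> ^ CARD('n))"
  define K where "K = (16 * n) powr p"
  define C where "C = K * (n * \<kappa>0 + n * (3 * n) powr p * \<kappa>0\<^sup>2 * v0)"
  have n1: "n \<ge> 1" "sqrt n \<ge> 1" by (auto simp: n_def Suc_leI)
  have v0: "v0 > 0" by (simp add: v0_def n_def)
  have "1 < sqrt n * 8" using n1(2) by linarith
  then have \<epsilon>: "0 < \<epsilon>" "\<epsilon> < 1" using n1(1) by (auto simp: \<epsilon>_def field_simps)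
  have \<kappa>0: "\<kappa>0 > 0" using v0 \<epsilon> n1 by (simp add: \<kappa>0_def)
  have "K > 0" using n1 by (simp add: K_def)
  then have "C > 0" using n1 \<kappa>0 v0 by (auto simp: C_def intro!: mult_pos_pos add_pos_pos)
  have "\<exists>A b. transpose A = - A \<and>
    (\<integral>\<^sup>+y\<in>ball x (\<rho> / (2 * sqrt n)). ennreal (norm (u y - (A *v y + b)) powr p) \<partial>lborel)
      \<le> ennreal (C * \<rho> powr (- p - n)) * energy p u x \<rho>"
    if u[measurable]: "u \<in> borel_measurable borel" and "0 < \<rho>" for u :: "real^'n \<Rightarrow> real^'n" and x \<rho>
  proof (cases "energy p u x \<rho>")
    case top
    moreover have "transpose (0::real^'n^'n) = - 0" by (simp add: transpose_def vec_eq_iff)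
    ultimately show ?thesis using \<open>C > 0\<close> \<open>0 < \<rho>\<close>
      by (intro exI[of _ 0]) (auto simp: ennreal_mult_top)
  next
    case (real g)
    define P where "P = \<rho> powr (-p)"
    define N where "N = \<rho> powr (-n)"
    have PN: "\<rho> powr (- p - n) = P * N" "N * \<rho> ^ CARD('n) = 1" "0 < P" "0 < N"
      using \<open>0 < \<rho>\<close> by (auto simp: P_def N_def n_def powr_minus powr_realpow powr_diff divide_inverse)
    have rN: "1 / \<rho> ^ CARD('n) = N" using PN(2) \<open>0 < \<rho>\<close> by (simp add: field_simps)
    define \<kappa> where "\<kappa> = \<kappa>0 * N"
    define c :: "'n option \<Rightarrow> real^'n" where
      "c a = (case a of None \<Rightarrow> x | Some i \<Rightarrow> x + \<rho> *\<^sub>R axis i 1)" for a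
    have k: "ennreal \<kappa> = ennreal (real (CARD('n) + 2) / (unit_ball_vol (real CARD('n)) * (\<epsilon> * \<rho>) ^ CARD('n)))"
      unfolding \<kappa>_def \<kappa>0_def v0_def n_def rN[symmetric] by (simp add: power_mult_distrib mult.assoc add.commute)
    have sub: "ball (c a) (\<epsilon> * \<rho>) \<subseteq> ball x (2 * \<rho>)" for a
    proof
      fix y assume "y \<in> ball (c a) (\<epsilon> * \<rho>)"
      then have "dist (c a) y < \<epsilon> * \<rho>" by simp
      also have "\<dots> < \<rho>" using \<epsilon> \<open>0 < \<rho>\<close> by simp
      moreover have "dist x (c a) \<le> \<rho>"
        using \<open>0 < \<rho>\<close> by (auto simp: c_def dist_norm split: option.split)
      ultimately show "y \<in> ball x (2 * \<rho>)" using dist_triangle[of x y "c a"] by simp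
    qed
    obtain z where z: "\<And>a. z a \<in> ball (c a) (\<epsilon> * \<rho>)"
      and F: "\<And>a. (\<integral>\<^sup>+b\<in>ball x (2 * \<rho>). ennreal (strain u (z a) b powr p) \<partial>lborel) \<le> ennreal \<kappa> * ennreal g"
      and e: "\<And>a b. ennreal (strain u (z a) (z b) powr p) \<le> ennreal \<kappa> * (ennreal \<kappa> * ennreal g)"
    proof -
      have meas: "(\<lambda>(a, b). ennreal (strain u a b powr p)) \<in> borel_measurable (borel \<Otimes>\<^sub>M borel)"
        by measurable
      have "\<exists>z. \<forall>i\<in>UNIV. z i \<in> ball (c i) (\<epsilon> * \<rho>) \<and>
           (\<integral>\<^sup>+b\<in>ball x (2 * \<rho>). ennreal (strain u (z i) b powr p) \<partial>lborel) \<le> ennreal \<kappa> * energy p u x \<rho> \<and>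
           (\<forall>j\<in>UNIV. ennreal (strain u (z i) (z j) powr p) \<le> ennreal \<kappa> * (ennreal \<kappa> * energy p u x \<rho>))"
        unfolding energy_def
        by (rule config_choice[OF _ _ meas _ _ k]) (use sub \<epsilon> \<open>0 < \<rho>\<close> in \<open>auto simp: strain_commute\<close>)
      then show ?thesis unfolding real(2) using that by blast
    qed
    have "g \<ge> 0" "\<kappa> \<ge> 0" using real \<kappa>0 PN by (auto simp: \<kappa>_def)
    define t where "t = (\<kappa> * (\<kappa> * g)) powr (1 / p)"
    have tp: "t powr p = \<kappa> * (\<kappa> * g)"
      using \<open>0 < p\<close> \<open>g \<ge> 0\<close> \<open>\<kappa> \<ge> 0\<close> by (simp add: t_def powr_powr)
    have st: "strain u (z a) (z b) \<le> t" for a b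
      unfolding t_def using e[of a b] \<open>0 < p\<close> \<open>g \<ge> 0\<close> \<open>\<kappa> \<ge> 0\<close>
      by (intro le_powr_inverse) (auto simp flip: ennreal_mult)
    have sn: "\<rho> / sqrt n > 0" using \<open>0 < \<rho>\<close> n1(1) by simp
    have scale: "\<rho> * (1 / (8 * sqrt n)) = (\<rho> / sqrt n) / 8" "\<rho> / (2 * sqrt n) = (\<rho> / sqrt n) / 2"
        "\<rho> * ((1/2) / sqrt n) = (\<rho> / sqrt n) / 2" "\<rho> * ((3/4) / sqrt n) = 3/4 * (\<rho> / sqrt n)"
      by simp_all
    have zc: "norm (z a - c a) \<le> \<rho> * (1 / (8 * sqrt n))" for a
      using z[of a] by (auto simp: dist_norm norm_minus_commute \<epsilon>_def less_imp_le mult.commute)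
    have zz: "norm (z (Some i) - z None - \<rho> *\<^sub>R axis i 1) \<le> \<rho> * ((1/2) / sqrt (real CARD('n)))" for i
    proof -
      have eq: "z (Some i) - z None - \<rho> *\<^sub>R axis i 1 = (z (Some i) - c (Some i)) - (z None - c None)"
        by (simp add: c_def)
      have "norm (z (Some i) - z None - \<rho> *\<^sub>R axis i 1) \<le> \<rho> * (1 / (8 * sqrt n)) + \<rho> * (1 / (8 * sqrt n))"
        unfolding eq by (rule norm_triangle_le_diff[OF add_mono[OF zc[of "Some i"] zc[of None]]])
      also have "\<dots> \<le> \<rho> * ((1/2) / sqrt n)"
        unfolding scale using sn by simp
      finally show ?thesis by (simp add: n_def)
    qed
    obtain A :: "real^'n^'n" where A: "transpose A = - A"
      "\<And>i. norm (u (z i) - u (z None) - A *v (z i - z None)) \<le> 3 * real CARD('n) * t / \<rho>"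
      using skew_from_configuration[where z = z, OF \<open>0 < \<rho>\<close> zz st] by blast
    \<comment> \<open>The affine map interpolates \<open>u\<close> at the base point, so its
      deviation at \<open>z i\<close> is the defect of the differences bounded in
      \<open>A\<close>.\<close>
    define b where "b = u (z None) - A *v z None"
    define t' where "t' = 3 * n * t / \<rho>"
    have t': "norm (u (z i) - (A *v z i + b)) \<le> t'" for i
      using A(2)[of i] by (simp add: b_def t'_def n_def matrix_vector_mult_diff_distrib algebra_simps)
    have t'p: "t' powr p = (3 * n) powr p * (\<kappa> * (\<kappa> * g)) * P"
      using n1 \<open>0 < \<rho>\<close> unfolding tp[symmetric] t'_def P_def
      by (simp add: powr_divide powr_mult powr_minus_divide t_def)
    have pw: "norm (u y - (A *v y + b)) powr p \<le> K * (P * (\<Sum>i\<in>UNIV. strain u y (z (Some i)) powr p) + n * t' powr p)"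
      if y: "y \<in> ball x (\<rho> / (2 * sqrt n))" for y
      unfolding K_def P_def n_def
    proof (rule rigid_pointwise)
      show "norm (z (Some i) - y - \<rho> *\<^sub>R axis i 1) \<le> \<rho> * ((3/4) / sqrt (real CARD('n)))" for i
      proof -
        have eq: "z (Some i) - y - \<rho> *\<^sub>R axis i 1 = (z (Some i) - c (Some i)) + (x - y)"
          by (simp add: c_def)
        have "norm (x - y) \<le> \<rho> / (2 * sqrt n)" using y by (simp add: dist_norm)
        then have "norm (z (Some i) - y - \<rho> *\<^sub>R axis i 1) \<le> \<rho> * (1 / (8 * sqrt n)) + \<rho> / (2 * sqrt n)"
          unfolding eq using norm_triangle_mono[OF zc[of "Some i"]] by blast
        also have "\<dots> \<le> \<rho> * ((3/4) / sqrt n)"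
          unfolding scale using sn by simp
        finally show ?thesis by (simp add: n_def)
      qed
    qed (use assms \<open>0 < \<rho>\<close> A t' in auto)
    have Bs: "ball x (\<rho> / (2 * sqrt n)) \<subseteq> ball x (2 * \<rho>)" "\<rho> / (2 * sqrt n) \<le> \<rho>"
    proof -
      have "1 \<le> 2 * sqrt n" using n1(2) by linarith
      then show "\<rho> / (2 * sqrt n) \<le> \<rho>" using \<open>0 < \<rho>\<close> n1(1) by (simp add: divide_le_eq)
      then show "ball x (\<rho> / (2 * sqrt n)) \<subseteq> ball x (2 * \<rho>)" using \<open>0 < \<rho>\<close> by auto
    qed
    let ?B = "ball x (\<rho> / (2 * sqrt n))"
    have "(\<integral>\<^sup>+y\<in>?B. ennreal (norm (u y - (A *v y + b)) powr p) \<partial>lborel)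
       \<le> (\<integral>\<^sup>+y. ennreal K * (ennreal P * (\<Sum>i\<in>UNIV. ennreal (strain u y (z (Some i)) powr p) * indicator ?B y) + ennreal (n * t' powr p) * indicator ?B y) \<partial>lborel)"
    proof (intro nn_integral_mono)
      fix y :: "real^'n"
      show "ennreal (norm (u y - (A *v y + b)) powr p) * indicator ?B y \<le> ennreal K * (ennreal P * (\<Sum>i\<in>UNIV. ennreal (strain u y (z (Some i)) powr p) * indicator ?B y) + ennreal (n * t' powr p) * indicator ?B y)"
      proof (cases "y \<in> ?B")
        case True
        have "ennreal (norm (u y - (A *v y + b)) powr p) \<le> ennreal (K * (P * (\<Sum>i\<in>UNIV. strain u y (z (Some i)) powr p) + n * t' powr p))"
          using pw[OF True] by (rule ennreal_leI)
        also have "\<dots> = ennreal K * (ennreal P * (\<Sum>i\<in>UNIV. ennreal (strain u y (z (Some i)) powr p)) + ennreal (n * t' powr p))"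
          using \<open>K > 0\<close> PN n1 by (simp add: ennreal_mult ennreal_plus sum_nonneg)
        finally show ?thesis using True by simp
      qed auto
    qed
    also have "\<dots> = ennreal K * (ennreal P * (\<Sum>i\<in>UNIV. \<integral>\<^sup>+y\<in>?B. ennreal (strain u y (z (Some i)) powr p) \<partial>lborel) + ennreal (n * t' powr p) * emeasure lborel ?B)"
    proof -
      define h where "h i y = ennreal (strain u y (z (Some i)) powr p) * indicator ?B y" for i y
      have "h i \<in> borel_measurable lborel" for i
        unfolding h_def by measurable
      then show ?thesis
        unfolding h_def[symmetric] by (simp add: nn_integral_cmult nn_integral_add nn_integral_sum nn_integral_cmult_indicator)
    qed
    also have "\<dots> \<le> ennreal K * (ennreal P * (\<Sum>i\<in>(UNIV::'n set). ennreal (\<kappa> * g)) + ennreal (n * t' powr p) * ennreal (v0 * \<rho> ^ CARD('n)))"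
    proof (intro mult_left_mono add_mono sum_mono)
      fix i :: 'n
      have "(\<integral>\<^sup>+y\<in>?B. ennreal (strain u y (z (Some i)) powr p) \<partial>lborel) \<le> (\<integral>\<^sup>+b\<in>ball x (2 * \<rho>). ennreal (strain u (z (Some i)) b powr p) \<partial>lborel)"
        using Bs(1) by (intro nn_integral_mono) (auto simp: indicator_def strain_commute)
      also have "\<dots> \<le> ennreal (\<kappa> * g)" using F[of "Some i"] \<open>g \<ge> 0\<close> \<open>\<kappa> \<ge> 0\<close> by (simp add: ennreal_mult)
      finally show "(\<integral>\<^sup>+y\<in>?B. ennreal (strain u y (z (Some i)) powr p) \<partial>lborel) \<le> ennreal (\<kappa> * g)" .
      have "emeasure lborel ?B \<le> emeasure lborel (ball x \<rho>)"
        using Bs(2) by (intro emeasure_mono) auto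
      then show "emeasure lborel ?B \<le> ennreal (v0 * \<rho> ^ CARD('n))"
        using \<open>0 < \<rho>\<close> by (simp add: emeasure_ball_cart v0_def n_def)
    qed auto
    also have "\<dots> = ennreal (K * (P * (n * (\<kappa> * g)) + n * t' powr p * (v0 * \<rho> ^ CARD('n))))"
      using \<open>K > 0\<close> PN n1 \<open>g \<ge> 0\<close> \<open>\<kappa> \<ge> 0\<close> v0 \<open>0 < \<rho>\<close>
      by (simp add: ennreal_mult ennreal_plus n_def ennreal_of_nat_eq_real_of_nat)
    also have "K * (P * (n * (\<kappa> * g)) + n * t' powr p * (v0 * \<rho> ^ CARD('n))) = C * (P * N) * g"
    proof -
      have "n * t' powr p * (v0 * \<rho> ^ CARD('n)) = n * (3 * n) powr p * \<kappa>0\<^sup>2 * v0 * P * N * g * (N * \<rho> ^ CARD('n))"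
        unfolding t'p \<kappa>_def by (simp add: power2_eq_square)
      then show ?thesis unfolding PN(2) C_def \<kappa>_def by (simp add: algebra_simps)
    qed
    also have "ennreal (C * (P * N) * g) = ennreal (C * \<rho> powr (- p - n)) * energy p u x \<rho>"
      using \<open>C > 0\<close> PN \<open>g \<ge> 0\<close> by (simp add: real(2) ennreal_mult)
    finally show ?thesis using A(1) by blast
  qed
  then show ?thesis using \<open>C > 0\<close> unfolding n_def by blast
qed

text \<open>Upgrades an averaged deviation from a given rigid motion to a deviation at the single
  point \<open>y\<close>, at the price of the strain between \<open>y\<close> and its neighbours.
  For each direction one point near \<open>y + \<rho> e_i\<close> is selected where both the strain
  with \<open>y\<close> and the deviation are close to average; the selections are independent of
  one another.\<close>

lemma rigid_pointwise_integral:
  assumes "0 < p"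
  shows "\<exists>C>0. \<forall>u\<in>borel_measurable borel. \<forall>A b. \<forall>y::real^'n. \<forall>\<rho>>0. transpose A = - A \<longrightarrow>
    ennreal (norm (u y - (A *v y + b)) powr p) \<le>
      ennreal (C * \<rho> powr (- p - real CARD('n))) * (\<integral>\<^sup>+z\<in>ball y (2 * \<rho>). ennreal (strain u y z powr p) \<partial>lborel)
      + ennreal (C * \<rho> powr (- real CARD('n))) * (\<integral>\<^sup>+z\<in>ball y (2 * \<rho>). ennreal (norm (u z - (A *v z + b)) powr p) \<partial>lborel)"
proof -
  define n where "n = real CARD('n)"
  define v0 where "v0 = unit_ball_vol n"
  define \<epsilon> where "\<epsilon> = 1 / (8 * sqrt n)"
  \<comment> \<open>Two functions are to be kept small at each selected point, so the multiplier is
    3.\<close>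
  define \<kappa>0 where "\<kappa>0 = 3 / (v0 * \<epsilon> ^ CARD('n))"
  define K where "K = (16 * n) powr p"
  define C where "C = K * n * \<kappa>0"
  have n1: "n \<ge> 1" "sqrt n \<ge> 1" by (auto simp: n_def Suc_leI)
  have v0: "v0 > 0" by (simp add: v0_def n_def)
  have "1 < sqrt n * 8" using n1(2) by linarith
  then have \<epsilon>: "0 < \<epsilon>" "\<epsilon> < 1" using n1(1) by (auto simp: \<epsilon>_def field_simps)
  have \<kappa>0: "\<kappa>0 > 0" using v0 \<epsilon> n1 by (simp add: \<kappa>0_def)
  have "K > 0" using n1 by (simp add: K_def)
  then have "C > 0" using n1 \<kappa>0 v0 by (auto simp: C_def intro!: mult_pos_pos add_pos_pos)
  have "ennreal (norm (u y - (A *v y + b)) powr p) \<le>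
      ennreal (C * \<rho> powr (- p - n)) * (\<integral>\<^sup>+z\<in>ball y (2 * \<rho>). ennreal (strain u y z powr p) \<partial>lborel)
      + ennreal (C * \<rho> powr (- n)) * (\<integral>\<^sup>+z\<in>ball y (2 * \<rho>). ennreal (norm (u z - (A *v z + b)) powr p) \<partial>lborel)"
    (is "_ \<le> _ * ?I + _ * ?J")
    if u[measurable]: "u \<in> borel_measurable borel" and "0 < \<rho>" and A: "transpose A = - A"
    for u :: "real^'n \<Rightarrow> real^'n" and A b y \<rho>
  proof (cases "?I = \<infinity> \<or> ?J = \<infinity>")
    case True
    have "0 < C * \<rho> powr (- p - n)" "0 < C * \<rho> powr (- n)" using \<open>C > 0\<close> \<open>0 < \<rho>\<close> by auto
    then show ?thesis using True by (auto simp: ennreal_mult_top)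
  next
    case False
    then obtain I J where IJ: "?I = ennreal I" "0 \<le> I" "?J = ennreal J" "0 \<le> J"
      by (cases ?I; cases ?J) auto
    define N where "N = \<rho> powr (-n)"
    have PN: "\<rho> powr (- p - n) = \<rho> powr (-p) * N" "N * \<rho> ^ CARD('n) = 1" "0 < N"
      using \<open>0 < \<rho>\<close> by (auto simp: N_def n_def powr_minus powr_realpow powr_diff divide_inverse)
    have rN: "1 / \<rho> ^ CARD('n) = N" using PN(2) \<open>0 < \<rho>\<close> by (simp add: field_simps)
    define \<kappa> where "\<kappa> = \<kappa>0 * N"
    have k: "ennreal \<kappa> = ennreal (real 3 / (unit_ball_vol (real CARD('n)) * (\<epsilon> * \<rho>) ^ CARD('n)))"
      unfolding \<kappa>_def \<kappa>0_def v0_def n_def rN[symmetric] by (simp add: power_mult_distrib mult.assoc add.commute)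
    have "\<kappa> \<ge> 0" using \<kappa>0 PN by (simp add: \<kappa>_def)
    have "\<exists>z. z \<in> ball (y + \<rho> *\<^sub>R axis i 1) (\<epsilon> * \<rho>) \<and> strain u y z powr p \<le> \<kappa> * I \<and> norm (u z - (A *v z + b)) powr p \<le> \<kappa> * J" for i
    proof -
      let ?B = "ball (y + \<rho> *\<^sub>R axis i 1) (\<epsilon> * \<rho>)"
      let ?f = "\<lambda>(c::bool) z. if c then ennreal (strain u y z powr p) else ennreal (norm (u z - (A *v z + b)) powr p)"
      have sub: "?B \<subseteq> ball y (2 * \<rho>)"
      proof
        fix w assume "w \<in> ?B"
        then have "dist (y + \<rho> *\<^sub>R axis i 1) w < \<epsilon> * \<rho>" by simp
        also have "\<dots> < \<rho>" using \<epsilon> \<open>0 < \<rho>\<close> by simp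
        moreover have "dist y (y + \<rho> *\<^sub>R axis i 1) \<le> \<rho>"
          using \<open>0 < \<rho>\<close> by (auto simp: dist_norm)
        ultimately show "w \<in> ball y (2 * \<rho>)" using dist_triangle[of y w "y + \<rho> *\<^sub>R axis i 1"] by simp
      qed
      have m: "?f c \<in> borel_measurable borel" for c
        by (cases c) (simp_all, measurable)
      have "\<exists>z\<in>?B. \<forall>c\<in>UNIV. ?f c z \<le> ennreal \<kappa> * (\<integral>\<^sup>+z\<in>?B. ?f c z \<partial>lborel)"
        unfolding k using \<epsilon> \<open>0 < \<rho>\<close> m by (intro ball_choice) (auto simp: card_UNIV_bool)
      then obtain z where z: "z \<in> ?B" "\<And>c. ?f c z \<le> ennreal \<kappa> * (\<integral>\<^sup>+z\<in>?B. ?f c z \<partial>lborel)" by auto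
      have mono: "(\<integral>\<^sup>+z\<in>?B. ?f c z \<partial>lborel) \<le> (\<integral>\<^sup>+z\<in>ball y (2 * \<rho>). ?f c z \<partial>lborel)" for c
        using sub by (intro nn_integral_mono) (auto simp: indicator_def)
      have "?f c z \<le> ennreal \<kappa> * (\<integral>\<^sup>+z\<in>ball y (2 * \<rho>). ?f c z \<partial>lborel)" for c
        using order_trans[OF z(2) mult_left_mono[OF mono]] by simp
      from this[of True] this[of False]
      show ?thesis using z(1) IJ \<open>\<kappa> \<ge> 0\<close> by (auto simp flip: ennreal_mult)
    qed
    then obtain z where z: "\<And>i. z i \<in> ball (y + \<rho> *\<^sub>R axis i 1) (\<epsilon> * \<rho>)"
        "\<And>i. strain u y (z i) powr p \<le> \<kappa> * I" "\<And>i. norm (u (z i) - (A *v z i + b)) powr p \<le> \<kappa> * J"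
      by metis
    define t where "t = (\<kappa> * J) powr (1 / p)"
    have tp: "t powr p = \<kappa> * J"
      using \<open>0 < p\<close> IJ \<open>\<kappa> \<ge> 0\<close> by (simp add: t_def powr_powr)
    have t: "norm (u (z i) - (A *v z i + b)) \<le> t" for i
      unfolding t_def using z(3)[of i] \<open>0 < p\<close> by (intro le_powr_inverse) auto
    have "norm (u y - (A *v y + b)) powr p \<le> K * (\<rho> powr (-p) * (\<Sum>i\<in>UNIV. strain u y (z i) powr p) + n * t powr p)"
      unfolding K_def n_def
    proof (rule rigid_pointwise)
      show "norm (z i - y - \<rho> *\<^sub>R axis i 1) \<le> \<rho> * ((3/4) / sqrt (real CARD('n)))" for i
      proof -
        have "norm (z i - y - \<rho> *\<^sub>R axis i 1) \<le> \<epsilon> * \<rho>"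
          using z(1)[of i] by (simp add: dist_norm norm_minus_commute diff_diff_eq)
        also have "\<dots> = (\<rho> / sqrt n) / 8" by (simp add: \<epsilon>_def)
        also have "\<dots> \<le> \<rho> * ((3/4) / sqrt n)"
          using divide_pos_pos[OF \<open>0 < \<rho>\<close>, of "sqrt n"] n1(1) by simp
        finally show ?thesis by (simp add: n_def)
      qed
    qed (use assms \<open>0 < \<rho>\<close> A t in auto)
    also have "\<dots> \<le> K * (\<rho> powr (-p) * (\<Sum>i\<in>(UNIV::'n set). \<kappa> * I) + n * t powr p)"
      using \<open>K > 0\<close> z(2) by (intro mult_left_mono add_right_mono sum_mono) auto
    also have "\<dots> = C * \<rho> powr (- p - n) * I + C * \<rho> powr (- n) * J"
      unfolding tp PN(1) C_def \<kappa>_def by (simp add: algebra_simps n_def N_def)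
    finally have "ennreal (norm (u y - (A *v y + b)) powr p) \<le> ennreal (C * \<rho> powr (- p - n) * I + C * \<rho> powr (- n) * J)"
      by (rule ennreal_leI)
    then show ?thesis using IJ \<open>C > 0\<close> by (simp add: ennreal_mult)
  qed
  then show ?thesis using \<open>C > 0\<close> unfolding n_def by blast
qed

text \<open>Two affine maps that are both close to \<open>u\<close> on a ball are close to each
  other. Their difference is small at \<open>n + 1\<close> points in general position, and
  subtracting its values removes the translations. Skewness does not enter.\<close>

lemma affine_gradient_compare:
  assumes "0 < p"
  shows "\<exists>C>0. \<forall>u\<in>borel_measurable borel. \<forall>A A' (b::real^'n) b'. \<forall>w::real^'n. \<forall>\<sigma>>0.
    ennreal (norm (A - A') powr p) \<le> ennreal (C * \<sigma> powr (- p - real CARD('n))) *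
      ((\<integral>\<^sup>+y\<in>ball w \<sigma>. ennreal (norm (u y - (A *v y + b)) powr p) \<partial>lborel)
      + (\<integral>\<^sup>+y\<in>ball w \<sigma>. ennreal (norm (u y - (A' *v y + b')) powr p) \<partial>lborel))"
proof -
  define n where "n = real CARD('n)"
  define v0 where "v0 = unit_ball_vol n"
  \<comment> \<open>The configuration has edge length \<open>\<sigma> / 2\<close>, so that it fits
    into \<open>ball w \<sigma>\<close>; the tolerance is halved accordingly.\<close>
  define \<epsilon> where "\<epsilon> = 1 / (16 * sqrt n)"
  define \<kappa>0 where "\<kappa>0 = 2 / (v0 * \<epsilon> ^ CARD('n))"
  define C where "C = (8 * n * n) powr p * 2 powr p * \<kappa>0"
  have n1: "n \<ge> 1" "sqrt n \<ge> 1" by (auto simp: n_def Suc_leI)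
  have v0: "v0 > 0" by (simp add: v0_def n_def)
  have "1 < sqrt n * 8" using n1(2) by linarith
  then have \<epsilon>: "0 < \<epsilon>" "\<epsilon> < 1/2" using n1(1) by (auto simp: \<epsilon>_def field_simps)
  have \<kappa>0: "\<kappa>0 > 0" using v0 \<epsilon> n1 by (simp add: \<kappa>0_def)
  have "C > 0" using n1 \<kappa>0 v0 by (auto simp: C_def intro!: mult_pos_pos)
  have "ennreal (norm (A - A') powr p) \<le> ennreal (C * \<sigma> powr (- p - n)) *
      ((\<integral>\<^sup>+y\<in>ball w \<sigma>. ennreal (norm (u y - (A *v y + b)) powr p) \<partial>lborel)
      + (\<integral>\<^sup>+y\<in>ball w \<sigma>. ennreal (norm (u y - (A' *v y + b')) powr p) \<partial>lborel))" (is "_ \<le> _ * (?I + ?J)")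
    if u[measurable]: "u \<in> borel_measurable borel" and "0 < \<sigma>"
    for u :: "real^'n \<Rightarrow> real^'n" and A A' b b' w \<sigma>
  proof (cases "?I + ?J")
    case top
    have "0 < C * \<sigma> powr (- p - n)" using \<open>C > 0\<close> \<open>0 < \<sigma>\<close> by auto
    then show ?thesis unfolding top by (auto simp: ennreal_mult_top)
  next
    case (real I)
    \<comment> \<open>Adding both deviations makes one selected point good for both affine
      maps.\<close>
    define f where "f y = ennreal (norm (u y - (A *v y + b)) powr p) + ennreal (norm (u y - (A' *v y + b')) powr p)" for y
    have f[measurable]: "f \<in> borel_measurable borel" unfolding f_def by measurable
    have fI: "(\<integral>\<^sup>+y\<in>ball w \<sigma>. f y \<partial>lborel) = ennreal I"
    proof -
      have "(\<lambda>y. ennreal (norm (u y - (B *v y + c)) powr p)) \<in> borel_measurable lborel" for B c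
        by measurable
      then show ?thesis
        unfolding real(2)[symmetric] f_def distrib_right
        by (intro nn_integral_add borel_measurable_times_ennreal borel_measurable_indicator) auto
    qed
    define N where "N = \<sigma> powr (-n)"
    have PN: "\<sigma> powr (- p - n) = \<sigma> powr (-p) * N" "N * \<sigma> ^ CARD('n) = 1" "0 < N"
      using \<open>0 < \<sigma>\<close> by (auto simp: N_def n_def powr_minus powr_realpow powr_diff divide_inverse)
    have rN: "1 / \<sigma> ^ CARD('n) = N" using PN(2) \<open>0 < \<sigma>\<close> by (simp add: field_simps)
    define \<kappa> where "\<kappa> = \<kappa>0 * N"
    have k: "ennreal \<kappa> = ennreal (real 2 / (unit_ball_vol (real CARD('n)) * (\<epsilon> * \<sigma>) ^ CARD('n)))"
      unfolding \<kappa>_def \<kappa>0_def v0_def n_def rN[symmetric] by (simp add: power_mult_distrib mult.assoc add.commute)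
    have "\<kappa> \<ge> 0" using \<kappa>0 PN by (simp add: \<kappa>_def)
    define \<tau> where "\<tau> = (2 powr p * (\<kappa> * I)) powr (1 / p)"
    have pt: "\<exists>y. norm (y - c) \<le> \<epsilon> * \<sigma> \<and> norm ((A - A') *v y + (b - b')) \<le> \<tau>" if c: "dist w c \<le> \<sigma> / 2" for c
    proof -
      have sub: "ball c (\<epsilon> * \<sigma>) \<subseteq> ball w \<sigma>"
      proof
        fix y assume "y \<in> ball c (\<epsilon> * \<sigma>)"
        then have "dist c y < \<epsilon> * \<sigma>" by simp
        also have "\<dots> < \<sigma> / 2" using \<epsilon> \<open>0 < \<sigma>\<close> by simp
        finally show "y \<in> ball w \<sigma>" using c dist_triangle[of w y c] by simp
      qed
      obtain y where y: "y \<in> ball c (\<epsilon> * \<sigma>)" "f y \<le> ennreal \<kappa> * (\<integral>\<^sup>+y\<in>ball c (\<epsilon> * \<sigma>). f y \<partial>lborel)"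
        using ball_choice[of "\<epsilon> * \<sigma>" "{()}" "\<lambda>_. f" 2 c] f \<epsilon> \<open>0 < \<sigma>\<close> unfolding k by auto
      have "(\<integral>\<^sup>+y\<in>ball c (\<epsilon> * \<sigma>). f y \<partial>lborel) \<le> ennreal I"
        unfolding fI[symmetric] using sub by (intro nn_integral_mono) (auto simp: indicator_def)
      then have "f y \<le> ennreal \<kappa> * ennreal I"
        using order_trans[OF y(2) mult_left_mono] by simp
      then have "f y \<le> ennreal (\<kappa> * I)"
        using \<open>\<kappa> \<ge> 0\<close> real(1) by (simp add: ennreal_mult)
      then have fy: "norm (u y - (A *v y + b)) powr p + norm (u y - (A' *v y + b')) powr p \<le> \<kappa> * I"
        using \<open>\<kappa> \<ge> 0\<close> real(1) by (simp add: f_def flip: ennreal_plus)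
      have "norm ((A - A') *v y + (b - b')) \<le> norm (u y - (A *v y + b)) + norm (u y - (A' *v y + b'))"
        using norm_triangle_ineq4[of "u y - (A' *v y + b')" "u y - (A *v y + b)"]
        by (simp add: matrix_vector_mult_diff_rdistrib algebra_simps)
      then have "norm ((A - A') *v y + (b - b')) powr p \<le> (norm (u y - (A *v y + b)) + norm (u y - (A' *v y + b'))) powr p"
        using assms by (intro powr_mono2) auto
      also have "\<dots> \<le> 2 powr p * (norm (u y - (A *v y + b)) powr p + norm (u y - (A' *v y + b')) powr p)"
        using assms by (intro add_powr_le) auto
      also have "\<dots> \<le> 2 powr p * (\<kappa> * I)"
        using fy by (intro mult_left_mono) auto
      finally have "norm ((A - A') *v y + (b - b')) \<le> \<tau>"
        unfolding \<tau>_def using assms by (intro le_powr_inverse) auto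
      moreover have "norm (y - c) \<le> \<epsilon> * \<sigma>" using y(1) by (simp add: dist_norm norm_minus_commute)
      ultimately show ?thesis by blast
    qed
    have "\<exists>y. norm (y - (w + (\<sigma> / 2) *\<^sub>R axis i 1)) \<le> \<epsilon> * \<sigma> \<and> norm ((A - A') *v y + (b - b')) \<le> \<tau>" for i
      using \<open>0 < \<sigma>\<close> by (intro pt) (simp add: dist_norm)
    then obtain y where y: "\<And>i. norm (y i - (w + (\<sigma> / 2) *\<^sub>R axis i 1)) \<le> \<epsilon> * \<sigma>"
        "\<And>i. norm ((A - A') *v y i + (b - b')) \<le> \<tau>" by metis
    obtain y0 where y0: "norm (y0 - w) \<le> \<epsilon> * \<sigma>" "norm ((A - A') *v y0 + (b - b')) \<le> \<tau>"
      using pt[of w] \<open>0 < \<sigma>\<close> by auto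
    define q where "q i = (2 / \<sigma>) *\<^sub>R (y i - y0)" for i
    have "norm (q i - axis i 1) \<le> (1/2) / sqrt (real CARD('n))" for i
    proof -
      have "q i - axis i 1 = (2 / \<sigma>) *\<^sub>R ((y i - (w + (\<sigma> / 2) *\<^sub>R axis i 1)) - (y0 - w))"
        using \<open>0 < \<sigma>\<close> by (simp add: q_def scaleR_diff_right scaleR_add_right)
      then have "norm (q i - axis i 1) = (2 / \<sigma>) * norm ((y i - (w + (\<sigma> / 2) *\<^sub>R axis i 1)) - (y0 - w))"
        using \<open>0 < \<sigma>\<close> by simp
      also have "\<dots> \<le> (2 / \<sigma>) * (\<epsilon> * \<sigma> + \<epsilon> * \<sigma>)"
        using \<open>0 < \<sigma>\<close> norm_triangle_le_diff[OF add_mono[OF y(1)[of i] y0(1)]] by (intro mult_left_mono) auto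
      also have "\<dots> = 1 / (4 * sqrt n)" using \<open>0 < \<sigma>\<close> by (simp add: \<epsilon>_def)
      also have "\<dots> \<le> (1/2) / sqrt n"
        using n1(1) by (simp add: frac_le)
      finally show ?thesis by (simp add: n_def)
    qed
    moreover have "norm ((A - A') *v q i) \<le> 4 * \<tau> / \<sigma>" for i
    proof -
      have "(A - A') *v q i = (2 / \<sigma>) *\<^sub>R (((A - A') *v y i + (b - b')) - ((A - A') *v y0 + (b - b')))"
        by (simp add: q_def matrix_vector_mult_scaleR matrix_vector_mult_diff_distrib)
      then have "norm ((A - A') *v q i) = (2 / \<sigma>) * norm (((A - A') *v y i + (b - b')) - ((A - A') *v y0 + (b - b')))"
        using \<open>0 < \<sigma>\<close> by simp
      also have "\<dots> \<le> (2 / \<sigma>) * (\<tau> + \<tau>)"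
        using \<open>0 < \<sigma>\<close> norm_triangle_le_diff[OF add_mono[OF y(2)[of i] y0(2)]] by (intro mult_left_mono) auto
      finally show ?thesis by simp
    qed
    ultimately have "norm (A - A') \<le> 2 * real CARD('n) * real CARD('n) * (4 * \<tau> / \<sigma>)"
      by (rule norm_matrix_le_basis)
    also have "\<dots> = (8 * n * n) * \<tau> / \<sigma>" by (simp add: n_def)
    finally have "norm (A - A') powr p \<le> ((8 * n * n) * \<tau> / \<sigma>) powr p"
      using assms by (intro powr_mono2) auto
    also have "\<dots> = (8 * n * n) powr p * \<tau> powr p * \<sigma> powr (-p)"
      using n1 \<open>0 < \<sigma>\<close> by (simp add: powr_divide powr_mult powr_minus_divide \<tau>_def)
    also have "\<tau> powr p = 2 powr p * (\<kappa> * I)"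
      using assms \<open>\<kappa> \<ge> 0\<close> real(1) by (simp add: \<tau>_def powr_powr)
    also have "(8 * n * n) powr p * (2 powr p * (\<kappa> * I)) * \<sigma> powr (-p) = C * \<sigma> powr (- p - n) * I"
      unfolding PN(1) C_def \<kappa>_def by simp
    finally have "ennreal (norm (A - A') powr p) \<le> ennreal (C * \<sigma> powr (- p - n) * I)"
      by (rule ennreal_leI)
    then show ?thesis using real \<open>C > 0\<close> by (simp add: ennreal_mult)
  qed
  then show ?thesis using \<open>C > 0\<close> unfolding n_def by blast
qed

section \<open>Chains of balls in John domains\<close>

text \<open>A partition of \<open>[0, s]\<close> followed by the point \<open>t\<close> is a
  partition of \<open>[0, t]\<close>. So the length up to \<open>s\<close> plus the final chord is
  at most the length up to \<open>t\<close>, and parametrisation by arc length makes the curve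
  1-Lipschitz.\<close>

lemma curve_length_dist_le:
  fixes \<gamma> :: "real \<Rightarrow> 'a::real_normed_vector"
  assumes s: "curve_length \<gamma> 0 s = ennreal s" and t: "curve_length \<gamma> 0 t = ennreal t" and "0 \<le> s" "s \<le> t"
  shows "dist (\<gamma> s) (\<gamma> t) \<le> t - s"
proof -
  have part: "(\<Sum>i<k. norm (\<gamma> (\<tau> (Suc i)) - \<gamma> (\<tau> i))) + dist (\<gamma> s) (\<gamma> t) \<le> t"
    if \<tau>: "\<tau> 0 = 0" "\<tau> k = s" "\<forall>i<k. \<tau> i \<le> \<tau> (Suc i)" for k :: nat and \<tau> :: "nat \<Rightarrow> real"
  proof -
    define \<tau>' where "\<tau>' = \<tau>(Suc k := t)"
    have "ennreal (\<Sum>i<Suc k. norm (\<gamma> (\<tau>' (Suc i)) - \<gamma> (\<tau>' i))) \<le> curve_length \<gamma> 0 t"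
      unfolding curve_length_def
      by (rule SUP_upper2[of "(Suc k, \<tau>')"]) (use \<tau> \<open>s \<le> t\<close> in \<open>auto simp: \<tau>'_def less_Suc_eq\<close>)
    also have "(\<Sum>i<Suc k. norm (\<gamma> (\<tau>' (Suc i)) - \<gamma> (\<tau>' i))) = (\<Sum>i<k. norm (\<gamma> (\<tau> (Suc i)) - \<gamma> (\<tau> i))) + dist (\<gamma> s) (\<gamma> t)"
      using \<tau> by (simp add: \<tau>'_def dist_norm norm_minus_commute)
    finally show ?thesis using assms by (simp add: t)
  qed
  \<comment> \<open>The coarsest partition shows that
    \<open>t - dist (\<gamma> s) (\<gamma> t)\<close> is not negative; otherwise
    \<open>ennreal\<close> would truncate it to 0 in the supremum below.\<close>
  have "norm (\<gamma> s - \<gamma> 0) + dist (\<gamma> s) (\<gamma> t) \<le> t"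
    using part[of "\<lambda>i. if i = 0 then 0 else s" 1] \<open>0 \<le> s\<close> by simp
  then have d: "dist (\<gamma> s) (\<gamma> t) \<le> t"
    using norm_ge_zero[of "\<gamma> s - \<gamma> 0"] by linarith
  have "ennreal s \<le> ennreal (t - dist (\<gamma> s) (\<gamma> t))"
    unfolding s[symmetric] curve_length_def
  proof (rule SUP_least, clarify)
    fix k and \<tau> :: "nat \<Rightarrow> real"
    assume "\<tau> 0 = 0" "s = \<tau> k" "\<forall>i<k. \<tau> i \<le> \<tau> (Suc i)"
    then show "ennreal (\<Sum>i<k. norm (\<gamma> (\<tau> (Suc i)) - \<gamma> (\<tau> i))) \<le> ennreal (t - dist (\<gamma> (\<tau> k)) (\<gamma> t))"
      using part[of \<tau> k] by (intro ennreal_leI) simp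
  qed
  then show ?thesis using d by simp
qed

text \<open>After arc length \<open>t\<close> the boundary distance is at least \<open>t / C\<close>
  by the John condition and at least \<open>bdist \<Omega> x - t\<close> by the triangle inequality;
  together these make it comparable to the scale \<open>s0 * \<mu> ^ k\<close>. The ratio
  \<open>\<mu>\<close> stays free, so that the steps can later be made an arbitrarily small fraction
  of the scale.\<close>

lemma john_domain_chain:
  fixes \<Omega> :: "(real^'n) set"
  assumes "john_domain \<Omega>"
  obtains K x0 where "K \<ge> 1" "x0 \<in> \<Omega>" "0 < bdist \<Omega> x0"
    "\<And>x \<mu> s0. x \<in> \<Omega> \<Longrightarrow> 1 < \<mu> \<Longrightarrow> \<mu> \<le> 2 \<Longrightarrow> 0 < s0 \<Longrightarrow> s0 \<le> bdist \<Omega> x \<Longrightarrow>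
      \<exists>N z. z 0 = x \<and> z N = x0 \<and> bdist \<Omega> x0 \<le> s0 * \<mu> ^ N \<and>
        (\<forall>k\<le>N. z k \<in> \<Omega> \<and> s0 * \<mu> ^ k \<le> K * bdist \<Omega> (z k) \<and> dist x (z k) \<le> s0 * \<mu> ^ k) \<and>
        (\<forall>k<N. dist (z k) (z (Suc k)) \<le> (\<mu> - 1) * (s0 * \<mu> ^ k))"
proof -
  have \<Omega>: "open \<Omega>" "bounded \<Omega>" "\<Omega> \<noteq> {}" using assms by (auto simp: john_domain_def)
  obtain C x0 where C: "C \<ge> 1" and x0: "x0 \<in> \<Omega>" and J: "\<And>x. x \<in> \<Omega> \<Longrightarrow> \<exists>(\<gamma>::real \<Rightarrow> real^'n) l.
        l \<ge> 0 \<and> \<gamma> ` {0..l} \<subseteq> \<Omega> \<and> \<gamma> 0 = x \<and> \<gamma> l = x0 \<and>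
        (\<forall>t\<in>{0..l}. curve_length \<gamma> 0 t = ennreal t) \<and> (\<forall>t\<in>{0..l}. bdist \<Omega> (\<gamma> t) \<ge> t / C)"
    using assms unfolding john_domain_def bdist_def by metis
  have "frontier \<Omega> \<noteq> {}"
    using \<Omega> frontier_eq_empty[of \<Omega>] not_bounded_UNIV by blast
  then have pos: "0 < bdist \<Omega> x0"
    unfolding bdist_def using x0 \<Omega>(1) by (intro infdist_pos_not_in_closed) (auto simp: frontier_def interior_open)
  have lip: "bdist \<Omega> a \<le> bdist \<Omega> b + dist a b" for a b
    unfolding bdist_def by (rule infdist_triangle)
  have "\<exists>N z. z 0 = x \<and> z N = x0 \<and> bdist \<Omega> x0 \<le> s0 * \<mu> ^ N \<and>
        (\<forall>k\<le>N. z k \<in> \<Omega> \<and> s0 * \<mu> ^ k \<le> (6 * C) * bdist \<Omega> (z k) \<and> dist x (z k) \<le> s0 * \<mu> ^ k) \<and>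
        (\<forall>k<N. dist (z k) (z (Suc k)) \<le> (\<mu> - 1) * (s0 * \<mu> ^ k))"
    if x: "x \<in> \<Omega>" and \<mu>: "1 < \<mu>" "\<mu> \<le> 2" and s0: "0 < s0" "s0 \<le> bdist \<Omega> x" for x \<mu> s0
  proof -
    obtain \<gamma> l where \<gamma>: "l \<ge> 0" "\<gamma> ` {0..l} \<subseteq> \<Omega>" "\<gamma> 0 = x" "\<gamma> l = x0"
        "\<And>t. t \<in> {0..l} \<Longrightarrow> curve_length \<gamma> 0 t = ennreal t"
        "\<And>t. t \<in> {0..l} \<Longrightarrow> t / C \<le> bdist \<Omega> (\<gamma> t)"
      using J[OF x] by blast
    define \<delta> where "\<delta> = bdist \<Omega> x"
    define S where "S = l + \<delta>"
    define T where "T s = min l (max 0 (s - \<delta>))" for s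
    \<comment> \<open>the point of scale \<open>s\<close>: it stays at \<open>x\<close> until \<open>s\<close> reaches the distance to the boundary\<close>
    define z where "z k = \<gamma> (T (s0 * \<mu> ^ k))" for k
    have T: "T s \<in> {0..l}" for s using \<gamma>(1) by (auto simp: T_def)
    have \<delta>: "\<delta> > 0" using s0 by (simp add: \<delta>_def)
    have gl: "dist (\<gamma> (T s)) (\<gamma> (T t)) \<le> t - s" if "s \<le> t" for s t
    proof -
      have "T s \<le> T t" "T t - T s \<le> t - s" using that by (auto simp: T_def)
      then show ?thesis using curve_length_dist_le[of \<gamma> "T s" "T t"] T[of s] T[of t] \<gamma>(5) by fastforce
    qed
    have T0: "T s = 0" if "s \<le> \<delta>" for s using that \<gamma>(1) by (simp add: T_def)
    obtain N0 where "S / s0 < \<mu> ^ N0" using real_arch_pow[OF \<mu>(1)] by blast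
    then have "S \<le> s0 * \<mu> ^ N0" using s0 by (simp add: field_simps)
    define N where "N = (LEAST N. S \<le> s0 * \<mu> ^ N)"
    have N: "S \<le> s0 * \<mu> ^ N" unfolding N_def by (rule LeastI) fact
    have Nk: "s0 * \<mu> ^ k < S" if "k < N" for k using not_less_Least[OF that[unfolded N_def]] by simp
    \<comment> \<open>The last scale is the first to reach \<open>S\<close>, and since
      \<open>\<mu> \<le> 2\<close> it overshoots by a factor of at most 2.\<close>
    have s2: "s0 * \<mu> ^ k \<le> 2 * S" if "k \<le> N" for k
    proof (cases "k < N")
      case True
      then show ?thesis using Nk[of k] \<delta> \<gamma>(1) by (simp add: S_def)
    next
      case False
      then have "k = N" using that by simp
      show ?thesis
      proof (cases N)
        case 0
        then show ?thesis using s0 \<open>k = N\<close> \<gamma>(1) by (simp add: S_def \<delta>_def)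
      next
        case (Suc m)
        have "s0 * \<mu> ^ N = \<mu> * (s0 * \<mu> ^ m)" by (simp add: Suc)
        also have "\<dots> \<le> 2 * S" using Nk[of m] Suc \<mu> s0 by (intro mult_mono) auto
        finally show ?thesis using \<open>k = N\<close> by simp
      qed
    qed
    have "z 0 = x" using s0 by (simp add: z_def T0 \<delta>_def \<gamma>(3))
    moreover have "z N = x0"
      using N \<gamma>(1,4) by (simp add: z_def T_def S_def min_def max_def)
    moreover have "bdist \<Omega> x0 \<le> s0 * \<mu> ^ N"
    proof -
      have "dist (\<gamma> 0) (\<gamma> l) \<le> l - 0"
        using \<gamma>(1) \<gamma>(5) by (intro curve_length_dist_le) auto
      then show ?thesis using lip[of x0 x] N \<gamma>(3,4) by (simp add: S_def \<delta>_def dist_commute)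
    qed
    moreover have "z k \<in> \<Omega> \<and> s0 * \<mu> ^ k \<le> (6 * C) * bdist \<Omega> (z k) \<and> dist x (z k) \<le> s0 * \<mu> ^ k" if "k \<le> N" for k
    proof -
      define s where "s = s0 * \<mu> ^ k"
      have s: "0 < s" "s \<le> 2 * S" using s2[OF that] s0 \<mu> by (auto simp: s_def)
      define D where "D = bdist \<Omega> (z k)"
      have zk: "z k = \<gamma> (T s)" by (simp add: z_def s_def)
      have dx: "dist x (z k) \<le> T s"
      proof -
        have "dist (\<gamma> 0) (\<gamma> (T s)) \<le> T s - 0"
          using T[of s] \<gamma>(1,5) by (intro curve_length_dist_le) auto
        then show ?thesis by (simp add: zk \<gamma>(3))
      qed
      have TC: "T s \<le> C * D" using \<gamma>(6)[OF T[of s]] C by (simp add: D_def zk field_simps)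
      have \<delta>D: "\<delta> \<le> D + T s" using lip[of x "z k"] dx by (simp add: D_def \<delta>_def)
      have "0 \<le> D" by (simp add: D_def bdist_def infdist_nonneg)
      then have CD: "D \<le> C * D" using C by (simp add: mult_le_cancel_right1)
      \<comment> \<open>Origin of \<open>6 * C\<close>: inserting
        \<open>\<delta> \<le> D + T s\<close> gives \<open>s \<le> 4 * T s + 2 * D\<close>, and both
        \<open>T s\<close> and \<open>D\<close> are at most \<open>C * D\<close>.\<close>
      have "s \<le> 2 * (T s + \<delta>)"
        using s \<delta> \<gamma>(1) by (auto simp: T_def S_def min_def max_def)
      then have "s \<le> 6 * E" if "T s \<le> E" "D \<le> E" for E using \<delta>D that by argo
      then have "s \<le> 6 * (C * D)" using TC CD by blast
      moreover have "T s \<le> s" using s \<delta> by (auto simp: T_def)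
      moreover have "z k \<in> \<Omega>" using \<gamma>(2) T[of s] by (auto simp: zk)
      ultimately show ?thesis using dx by (simp add: D_def s_def)
    qed
    moreover have "dist (z k) (z (Suc k)) \<le> (\<mu> - 1) * (s0 * \<mu> ^ k)" for k
    proof -
      have "s0 * \<mu> ^ k \<le> s0 * \<mu> ^ Suc k"
        using s0 \<mu> by (intro mult_left_mono power_increasing) auto
      from gl[OF this] show ?thesis by (simp add: z_def algebra_simps)
    qed
    ultimately show ?thesis by blast
  qed
  then show ?thesis using that[of "6 * C" x0] C x0 pos by simp
qed

section \<open>Dyadic estimate of radial integrals\<close>

lemma powr_le_of_between:
  fixes r \<rho> e :: real
  assumes "0 < \<rho>" "\<rho> \<le> r" "r \<le> 2 * \<rho>"
  shows "r powr e \<le> 2 powr \<bar>e\<bar> * \<rho> powr e"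
proof (cases "0 \<le> e")
  case True
  then have "r powr e \<le> (2 * \<rho>) powr e" using assms by (intro powr_mono2) auto
  then show ?thesis using True by (simp add: powr_mult)
next
  case False
  then have "r powr e \<le> \<rho> powr e" using assms by (intro powr_mono2') auto
  also have "\<dots> \<le> 2 powr \<bar>e\<bar> * \<rho> powr e"
    using ge_one_powr_ge_zero[of 2 "\<bar>e\<bar>"] by (simp add: mult_le_cancel_right1)
  finally show ?thesis .
qed

lemma ex_power2_bracket:
  fixes r :: real
  assumes "1 \<le> r"
  shows "\<exists>j::nat. 2 ^ j \<le> r \<and> r < 2 * 2 ^ j"
proof -
  obtain m where m: "r < 2 ^ m" using real_arch_pow[of 2 r] by auto
  define j where "j = (LEAST m. r < 2 ^ m)"
  have "r < 2 ^ j" unfolding j_def by (rule LeastI) fact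
  with assms have "j \<noteq> 0" by (intro notI) auto
  then obtain i where i: "j = Suc i" by (cases j) auto
  have "\<not> r < 2 ^ i" using not_less_Least[of i "\<lambda>m. r < 2 ^ m"] i by (simp add: j_def)
  then show ?thesis using \<open>r < 2 ^ j\<close> i by (intro exI[of _ i]) auto
qed

lemma suminf_ennreal_geometric:
  fixes c q :: real
  assumes "0 \<le> c" "0 \<le> q" "q < 1"
  shows "(\<Sum>j. ennreal (c * q ^ j)) = ennreal (c / (1 - q))"
proof -
  have "(\<lambda>j. c * q ^ j) sums (c * (1 / (1 - q)))"
    using assms by (intro sums_mult geometric_sums) auto
  then show ?thesis using assms by (simp add: sums_iff suminf_ennreal2)
qed

text \<open>Dyadic shells outside and inside radius \<open>d\<close>, each estimated by its outer
  ball. Outside, the shells sum up geometrically because \<open>\<alpha> < Q\<close>; inside, the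
  second factor is the constant \<open>d powr (- Q)\<close> and the sum converges because
  \<open>0 < \<alpha>\<close>.\<close>

lemma radial_integral_bound:
  assumes "0 < \<alpha>" "\<alpha> < Q"
  obtains C where "C > 0" "\<And>d. 0 < d \<Longrightarrow>
    (\<integral>\<^sup>+w. ennreal (norm w powr (\<alpha> - real CARD('n)) * max (norm w) d powr (- Q)) \<partial>(lborel :: (real^'n) measure)) \<le> ennreal (C * d powr (\<alpha> - Q))"
proof -
  define n where "n = real CARD('n)"
  define v0 where "v0 = unit_ball_vol n"
  define M where "M = 2 powr \<bar>\<alpha> - n\<bar>"
  define c where "c = M * v0 * 4 ^ CARD('n)"
  define q1 :: real where "q1 = 2 powr (\<alpha> - Q)"
  define q2 :: real where "q2 = 2 powr (- \<alpha>)"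
  define C where "C = c / (1 - q1) + c * 2 powr (- \<alpha>) / (1 - q2)"
  have v0: "v0 > 0" by (simp add: v0_def n_def)
  have "c > 0" using v0 by (simp add: c_def M_def)
  have q: "0 < q1" "q1 < 1" "0 < q2" "q2 < 1"
    using assms by (auto simp: q1_def q2_def powr_less_one)
  have "C > 0" unfolding C_def using \<open>c > 0\<close> q by (intro add_pos_pos divide_pos_pos mult_pos_pos) auto
  have "(\<integral>\<^sup>+w. ennreal (norm w powr (\<alpha> - n) * max (norm w) d powr (- Q)) \<partial>(lborel :: (real^'n) measure)) \<le> ennreal (C * d powr (\<alpha> - Q))"
    if "0 < d" for d
  proof -
    \<comment> \<open>The shell is closed with outer radius \<open>2 * \<rho>\<close>; the radius
      \<open>4 * \<rho>\<close> places it inside an open ball.\<close>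
    define T where "T \<rho> w = ennreal (M * \<rho> powr (\<alpha> - n)) * indicator (ball 0 (4 * \<rho>)) w" for \<rho> and w :: "real^'n"
    have Tm[measurable]: "T \<rho> \<in> borel_measurable borel" for \<rho>
      unfolding T_def by measurable
    have Ti: "(\<integral>\<^sup>+w. T \<rho> w \<partial>lborel) = ennreal (c * \<rho> powr \<alpha>)" if "0 < \<rho>" for \<rho>
    proof -
      have "(\<integral>\<^sup>+w. T \<rho> w \<partial>lborel) = ennreal (M * \<rho> powr (\<alpha> - n)) * emeasure lborel (ball (0::real^'n) (4 * \<rho>))"
        unfolding T_def by (intro nn_integral_cmult_indicator) simp
      also have "\<dots> = ennreal (M * \<rho> powr (\<alpha> - n) * (v0 * (4 * \<rho>) ^ CARD('n)))"
        using that by (simp add: emeasure_ball_cart ennreal_mult v0_def n_def M_def)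
      also have "M * \<rho> powr (\<alpha> - n) * (v0 * (4 * \<rho>) ^ CARD('n)) = c * (\<rho> powr (\<alpha> - n) * \<rho> ^ CARD('n))"
        by (simp add: c_def power_mult_distrib)
      also have "\<rho> powr (\<alpha> - n) * \<rho> ^ CARD('n) = \<rho> powr \<alpha>"
        using that by (simp add: n_def powr_diff powr_realpow)
      finally show ?thesis .
    qed
    have Tw: "ennreal (norm w powr (\<alpha> - n)) \<le> T \<rho> w" if "0 < \<rho>" "\<rho> \<le> norm w" "norm w \<le> 2 * \<rho>" for \<rho> w
      using powr_le_of_between[OF that, of "\<alpha> - n"] that by (simp add: T_def M_def ennreal_leI)
    define U where "U j w = T (2 ^ j * d) w * ennreal ((2 ^ j * d) powr (- Q))" for j w
    define V where "V j w = T (d / (2 * 2 ^ j)) w * ennreal (d powr (- Q))" for j w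
    have [measurable]: "U j \<in> borel_measurable lborel" "V j \<in> borel_measurable lborel" for j
      unfolding U_def V_def by measurable
    have pw: "ennreal (norm w powr (\<alpha> - n) * max (norm w) d powr (- Q)) \<le> (\<Sum>j. U j w) + (\<Sum>j. V j w)" for w
    proof -
      have one: "f j \<le> (\<Sum>j. f j)" for f :: "nat \<Rightarrow> ennreal" and j
        using sum_le_suminf[of f "{j}"] by simp
      \<comment> \<open>At the origin, which lies in no shell, the integrand is 0 because
        \<open>0 powr e = 0\<close> for every exponent.\<close>
      consider "w = 0" | "w \<noteq> 0" "norm w \<ge> d" | "w \<noteq> 0" "norm w < d" by linarith
      then show ?thesis
      proof cases
        case 2
        then have "1 \<le> norm w / d" using \<open>0 < d\<close> by simp
        then obtain j where j: "2 ^ j \<le> norm w / d" "norm w / d < 2 * 2 ^ j" using ex_power2_bracket by blast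
        then have j': "2 ^ j * d \<le> norm w" "norm w \<le> 2 * (2 ^ j * d)"
          using \<open>0 < d\<close> by (auto simp: field_simps)
        have "ennreal (norm w powr (\<alpha> - n) * max (norm w) d powr (- Q)) \<le> T (2 ^ j * d) w * ennreal ((2 ^ j * d) powr (- Q))"
          unfolding ennreal_mult''[OF powr_ge_zero]
        proof (rule mult_mono)
          show "ennreal (norm w powr (\<alpha> - n)) \<le> T (2 ^ j * d) w" using j' \<open>0 < d\<close> by (intro Tw) auto
          show "ennreal (max (norm w) d powr - Q) \<le> ennreal ((2 ^ j * d) powr - Q)"
            using assms j' \<open>0 < d\<close> by (intro ennreal_leI powr_mono2') auto
        qed auto
        also have "\<dots> \<le> (\<Sum>j. U j w)" using one[of "\<lambda>j. U j w" j] by (simp add: U_def)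
        finally show ?thesis by (simp add: add_increasing2)
      next
        case 3
        then have "1 \<le> d / norm w" using \<open>0 < d\<close> by simp
        then obtain j where j: "2 ^ j \<le> d / norm w" "d / norm w < 2 * 2 ^ j" using ex_power2_bracket by blast
        then have j': "d / (2 * 2 ^ j) \<le> norm w" "norm w \<le> 2 * (d / (2 * 2 ^ j))"
          using \<open>0 < d\<close> 3 by (auto simp: field_simps)
        have "ennreal (norm w powr (\<alpha> - n) * max (norm w) d powr (- Q)) \<le> T (d / (2 * 2 ^ j)) w * ennreal (d powr (- Q))"
          unfolding ennreal_mult''[OF powr_ge_zero]
        proof (rule mult_mono)
          show "ennreal (norm w powr (\<alpha> - n)) \<le> T (d / (2 * 2 ^ j)) w" using j' \<open>0 < d\<close> by (intro Tw) auto
          show "ennreal (max (norm w) d powr - Q) \<le> ennreal (d powr - Q)"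
            using assms \<open>0 < d\<close> by (intro ennreal_leI powr_mono2') auto
        qed auto
        also have "\<dots> \<le> (\<Sum>j. V j w)" using one[of "\<lambda>j. V j w" j] by (simp add: V_def)
        finally show ?thesis by (simp add: add_increasing)
      qed simp
    qed
    have Ui: "(\<integral>\<^sup>+w. U j w \<partial>lborel) = ennreal (c * d powr (\<alpha> - Q) * q1 ^ j)" for j
    proof -
      have "(\<integral>\<^sup>+w. U j w \<partial>lborel) = ennreal (c * (2 ^ j * d) powr \<alpha>) * ennreal ((2 ^ j * d) powr (- Q))"
        unfolding U_def using \<open>0 < d\<close> by (subst nn_integral_multc) (auto simp: Ti)
      also have "\<dots> = ennreal (c * ((2 ^ j * d) powr \<alpha> * (2 ^ j * d) powr (- Q)))"
        using \<open>c > 0\<close> by (simp add: ennreal_mult mult.assoc)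
      also have "(2 ^ j * d) powr \<alpha> * (2 ^ j * d) powr (- Q) = (2 ^ j * d) powr (\<alpha> - Q)"
        by (simp add: powr_diff powr_minus divide_inverse)
      also have "\<dots> = q1 ^ j * d powr (\<alpha> - Q)"
        using \<open>0 < d\<close> by (simp add: powr_mult q1_def powr_power powr_powr mult.commute flip: powr_realpow)
      finally show ?thesis by (simp add: ac_simps)
    qed
    have Vi: "(\<integral>\<^sup>+w. V j w \<partial>lborel) = ennreal (c * 2 powr (- \<alpha>) * d powr (\<alpha> - Q) * q2 ^ j)" for j
    proof -
      have "(\<integral>\<^sup>+w. V j w \<partial>lborel) = ennreal (c * (d / (2 * 2 ^ j)) powr \<alpha>) * ennreal (d powr (- Q))"
        unfolding V_def using \<open>0 < d\<close> by (subst nn_integral_multc) (auto simp: Ti)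
      also have "\<dots> = ennreal (c * ((d / (2 * 2 ^ j)) powr \<alpha> * d powr (- Q)))"
        using \<open>c > 0\<close> by (simp add: ennreal_mult mult.assoc)
      also have "(d / (2 * 2 ^ j)) powr \<alpha> = d powr \<alpha> * (2 powr (- \<alpha>) * q2 ^ j)"
      proof -
        have "((2::real) ^ j) powr \<alpha> = (2 powr \<alpha>) ^ j"
          by (simp add: powr_power powr_powr mult.commute flip: powr_realpow)
        then show ?thesis
          using \<open>0 < d\<close> by (simp add: powr_divide powr_mult powr_minus_divide q2_def power_divide)
      qed
      also have "d powr \<alpha> * (2 powr (- \<alpha>) * q2 ^ j) * d powr (- Q) = 2 powr (- \<alpha>) * d powr (\<alpha> - Q) * q2 ^ j"
        by (simp add: powr_diff powr_minus divide_inverse)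
      finally show ?thesis by (simp add: ac_simps)
    qed
    have "(\<integral>\<^sup>+w. ennreal (norm w powr (\<alpha> - n) * max (norm w) d powr (- Q)) \<partial>(lborel :: (real^'n) measure))
        \<le> (\<integral>\<^sup>+w. (\<Sum>j. U j w) + (\<Sum>j. V j w) \<partial>lborel)"
      by (intro nn_integral_mono pw)
    also have "\<dots> = (\<Sum>j. \<integral>\<^sup>+w. U j w \<partial>lborel) + (\<Sum>j. \<integral>\<^sup>+w. V j w \<partial>lborel)"
      by (subst nn_integral_add) (simp_all add: nn_integral_suminf)
    also have "\<dots> = (\<Sum>j. ennreal (c * d powr (\<alpha> - Q) * q1 ^ j)) + (\<Sum>j. ennreal (c * 2 powr (- \<alpha>) * d powr (\<alpha> - Q) * q2 ^ j))"
      unfolding Ui Vi ..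
    also have "(\<Sum>j. ennreal (c * d powr (\<alpha> - Q) * q1 ^ j)) = ennreal (c * d powr (\<alpha> - Q) / (1 - q1))"
      using \<open>c > 0\<close> q by (intro suminf_ennreal_geometric) auto
    also have "(\<Sum>j. ennreal (c * 2 powr (- \<alpha>) * d powr (\<alpha> - Q) * q2 ^ j)) = ennreal (c * 2 powr (- \<alpha>) * d powr (\<alpha> - Q) / (1 - q2))"
      using \<open>c > 0\<close> q by (intro suminf_ennreal_geometric) auto
    also have "ennreal (c * d powr (\<alpha> - Q) / (1 - q1)) + ennreal (c * 2 powr (- \<alpha>) * d powr (\<alpha> - Q) / (1 - q2)) = ennreal (C * d powr (\<alpha> - Q))"
      using \<open>c > 0\<close> q by (simp add: C_def distrib_right flip: ennreal_plus)
    finally show ?thesis .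
  qed
  then show ?thesis using that \<open>C > 0\<close> by (simp add: n_def)
qed

section \<open>Chains of overlapping balls\<close>

text \<open>Turns the chain of points into balls with prescribed ends: it starts with the ball of
  radius \<open>\<rho>\<close> at \<open>x\<close> and ends with a ball at \<open>x0\<close> whose
  radius \<open>\<rho>0\<close> is independent of \<open>x\<close> and \<open>\<rho>\<close>.
  Neighbours share a ball of comparable size even after shrinking by \<open>c\<close>, since affine
  approximations are only compared within shrunken balls.\<close>

lemma john_ball_chain:
  fixes \<Omega> :: "(real^'n) set"
  assumes "john_domain \<Omega>" and c: "0 < c" "c \<le> 1"
  obtains L \<mu> \<kappa> x0 \<rho>0 where "L \<ge> 1" "\<mu> > 1" "\<kappa> > 0"
    "\<And>x \<rho>. x \<in> \<Omega> \<Longrightarrow> 0 < \<rho> \<Longrightarrow> 9 * \<rho> \<le> bdist \<Omega> x \<Longrightarrow>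
      \<exists>M w r. w 0 = x \<and> r 0 = \<rho> \<and> w M = x0 \<and> r M = \<rho>0 \<and>
        (\<forall>j\<le>M. w j \<in> \<Omega> \<and> 0 < r j \<and> 9 * r j \<le> bdist \<Omega> (w j) \<and> r j \<le> \<rho> * \<mu> ^ j \<and> \<rho> * \<mu> ^ j \<le> L * r j \<and>
          dist x (w j) \<le> 9 * \<rho> * \<mu> ^ j) \<and>
        (\<forall>j<M. \<exists>y \<sigma>. 0 < \<sigma> \<and> \<kappa> * r j \<le> \<sigma> \<and> \<kappa> * r (Suc j) \<le> \<sigma> \<and>
          ball y \<sigma> \<subseteq> ball (w j) (c * r j) \<and> ball y \<sigma> \<subseteq> ball (w (Suc j)) (c * r (Suc j)))"
proof -
  obtain K x0 where K: "K \<ge> 1" and x0: "x0 \<in> \<Omega>" "0 < bdist \<Omega> x0" and chain: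
    "\<And>x \<mu> s0. x \<in> \<Omega> \<Longrightarrow> 1 < \<mu> \<Longrightarrow> \<mu> \<le> 2 \<Longrightarrow> 0 < s0 \<Longrightarrow> s0 \<le> bdist \<Omega> x \<Longrightarrow>
      \<exists>N z. z 0 = x \<and> z N = x0 \<and> bdist \<Omega> x0 \<le> s0 * \<mu> ^ N \<and>
        (\<forall>k\<le>N. z k \<in> \<Omega> \<and> s0 * \<mu> ^ k \<le> K * bdist \<Omega> (z k) \<and> dist x (z k) \<le> s0 * \<mu> ^ k) \<and>
        (\<forall>k<N. dist (z k) (z (Suc k)) \<le> (\<mu> - 1) * (s0 * \<mu> ^ k))"
    using john_domain_chain[OF assms(1)] by blast
  \<comment> \<open>Chosen so that the step bound
    \<open>(\<mu> - 1) * (9 * \<rho> * \<mu> ^ k)\<close> is half of \<open>c * \<rho>' k\<close>,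
    the radius of the shrunken ball at \<open>z k\<close>.\<close>
  define \<mu> where "\<mu> = 1 + c / (18 * K)"
  define \<kappa> where "\<kappa> = c / (4 * K)"
  define \<rho>0 where "\<rho>0 = bdist \<Omega> x0 / (9 * K)"
  have "c / (18 * K) \<le> 1" using c K by (simp add: divide_le_eq)
  then have \<mu>: "1 < \<mu>" "\<mu> \<le> 2" using c K by (auto simp: \<mu>_def)
  have \<kappa>: "\<kappa> > 0" "\<kappa> \<le> c / 4" "\<kappa> * K \<le> c / 4"
    using c K by (auto simp: \<kappa>_def divide_le_eq field_simps mult_le_cancel_left1)
  have \<rho>0: "\<rho>0 > 0" using x0 K by (simp add: \<rho>0_def)
  have "\<exists>M w r. w 0 = x \<and> r 0 = \<rho> \<and> w M = x0 \<and> r M = \<rho>0 \<and>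
        (\<forall>j\<le>M. w j \<in> \<Omega> \<and> 0 < r j \<and> 9 * r j \<le> bdist \<Omega> (w j) \<and> r j \<le> \<rho> * \<mu> ^ j \<and> \<rho> * \<mu> ^ j \<le> (4 * K\<^sup>2) * r j \<and>
          dist x (w j) \<le> 9 * \<rho> * \<mu> ^ j) \<and>
        (\<forall>j<M. \<exists>y \<sigma>. 0 < \<sigma> \<and> \<kappa> * r j \<le> \<sigma> \<and> \<kappa> * r (Suc j) \<le> \<sigma> \<and>
          ball y \<sigma> \<subseteq> ball (w j) (c * r j) \<and> ball y \<sigma> \<subseteq> ball (w (Suc j)) (c * r (Suc j)))"
    if x: "x \<in> \<Omega>" and \<rho>: "0 < \<rho>" "9 * \<rho> \<le> bdist \<Omega> x" for x \<rho>
  proof -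
    obtain N z where z: "z 0 = x" "z N = x0" "bdist \<Omega> x0 \<le> 9 * \<rho> * \<mu> ^ N"
      "\<And>k. k \<le> N \<Longrightarrow> z k \<in> \<Omega> \<and> 9 * \<rho> * \<mu> ^ k \<le> K * bdist \<Omega> (z k) \<and> dist x (z k) \<le> 9 * \<rho> * \<mu> ^ k"
      "\<And>k. k < N \<Longrightarrow> dist (z k) (z (Suc k)) \<le> (\<mu> - 1) * (9 * \<rho> * \<mu> ^ k)"
      using chain[OF x \<mu>, of "9 * \<rho>"] \<rho> by auto
    define \<rho>' where "\<rho>' k = \<rho> * \<mu> ^ k / K" for k
    \<comment> \<open>The sampled points are shifted by one index. An extra ball at each end lets
      the radius pass from \<open>\<rho>\<close> to \<open>\<rho>' 0\<close> and from
      \<open>\<rho>' N\<close> to \<open>\<rho>0\<close> with the centre fixed.\<close>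
    define w where "w j = (case j of 0 \<Rightarrow> x | Suc k \<Rightarrow> if k \<le> N then z k else x0)" for j
    define r where "r j = (case j of 0 \<Rightarrow> \<rho> | Suc k \<Rightarrow> if k \<le> N then \<rho>' k else \<rho>0)" for j
    have w: "w 0 = x" "\<And>k. k \<le> N \<Longrightarrow> w (Suc k) = z k" "w (Suc (Suc N)) = x0"
      and r: "r 0 = \<rho>" "\<And>k. k \<le> N \<Longrightarrow> r (Suc k) = \<rho>' k" "r (Suc (Suc N)) = \<rho>0"
      by (auto simp: w_def r_def)
    have \<rho>'K: "K * \<rho>' k = \<rho> * \<mu> ^ k" for k using K by (simp add: \<rho>'_def)
    have \<rho>'pos: "\<rho>' k > 0" for k using \<rho> \<mu> K by (simp add: \<rho>'_def)
    have \<mu>pos: "\<rho> * \<mu> ^ k > 0" for k using \<rho> \<mu> by simp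
    have \<rho>'le: "\<rho>' k \<le> \<rho> * \<mu> ^ k" for k
      using K \<rho>'pos[of k] by (simp add: mult_le_cancel_right1 flip: \<rho>'K)
    have \<mu>mono: "\<rho> * \<mu> ^ k \<le> \<rho> * \<mu> ^ Suc k" "\<rho> * \<mu> ^ Suc k \<le> 2 * (\<rho> * \<mu> ^ k)" for k
      using \<mu> \<rho> by auto
    have KK: "a \<le> K * a" if "0 \<le> a" for a using K that by (simp add: mult_le_cancel_right1)
    have \<rho>0N: "\<rho>0 \<le> \<rho>' N" "\<rho>' N \<le> K * \<rho>0"
    proof -
      have "\<rho>0 \<le> (9 * \<rho> * \<mu> ^ N) / (9 * K)"
        unfolding \<rho>0_def using z(3) K by (intro divide_right_mono) auto
      then show "\<rho>0 \<le> \<rho>' N" by (simp add: \<rho>'_def)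
      have "9 * \<rho> * \<mu> ^ N / (9 * K) \<le> K * bdist \<Omega> x0 / (9 * K)"
        using z(4)[of N] z(2) K by (intro divide_right_mono) auto
      then show "\<rho>' N \<le> K * \<rho>0" by (simp add: \<rho>'_def \<rho>0_def)
    qed
    have A: "w j \<in> \<Omega> \<and> 0 < r j \<and> 9 * r j \<le> bdist \<Omega> (w j) \<and> r j \<le> \<rho> * \<mu> ^ j \<and> \<rho> * \<mu> ^ j \<le> (4 * K\<^sup>2) * r j \<and>
          dist x (w j) \<le> 9 * \<rho> * \<mu> ^ j" if jN: "j \<le> Suc (Suc N)" for j
    proof -
      consider "j = 0" | k where "j = Suc k" "k \<le> N" | "j = Suc (Suc N)"
        using jN by (cases j) (auto simp: le_Suc_eq)
      then show ?thesis
      proof cases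
        case 1
        have "1 \<le> 4 * K\<^sup>2" using K one_le_power[of K 2] by linarith
        then have "\<rho> \<le> 4 * K\<^sup>2 * \<rho>" using \<rho> by (simp add: mult_le_cancel_right1)
        then show ?thesis using 1 x \<rho> by (simp add: w r)
      next
        case (2 k)
        have "9 * (K * \<rho>' k) \<le> K * bdist \<Omega> (z k)" using z(4)[OF 2(2)] by (simp add: \<rho>'K)
        then have "K * (9 * \<rho>' k) \<le> K * bdist \<Omega> (z k)" by (simp add: ac_simps)
        then have "9 * \<rho>' k \<le> bdist \<Omega> (z k)" using K by (subst (asm) mult_le_cancel_left_pos) auto
        moreover have "\<rho>' k \<le> \<rho> * \<mu> ^ Suc k" using \<rho>'le[of k] \<mu>mono(1)[of k] by linarith
        moreover have "\<rho> * \<mu> ^ Suc k \<le> (4 * K\<^sup>2) * \<rho>' k"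
        proof -
          have "\<rho> * \<mu> ^ Suc k \<le> 2 * (K * \<rho>' k)" using \<mu>mono(2)[of k] by (simp add: \<rho>'K)
          also have "\<dots> \<le> 4 * (K * (K * \<rho>' k))"
            using KK[of "K * \<rho>' k"] mult_pos_pos[OF _ \<rho>'pos[of k], of K] K by linarith
          finally show ?thesis by (simp add: power2_eq_square mult.assoc)
        qed
        moreover have "dist x (z k) \<le> 9 * \<rho> * \<mu> ^ Suc k"
          using z(4)[OF 2(2)] \<mu>mono(1)[of k] by linarith
        ultimately show ?thesis using 2 z(4)[OF 2(2)] \<rho>'pos[of k] by (simp only: w r)
      next
        case 3
        have "9 * \<rho>0 \<le> bdist \<Omega> x0"
          using K x0 by (simp add: \<rho>0_def divide_le_eq mult_le_cancel_left1)
        moreover have "\<rho>0 \<le> \<rho> * \<mu> ^ Suc (Suc N)"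
          using \<rho>0N(1) \<rho>'le[of N] \<mu>mono(1)[of N] \<mu>mono(1)[of "Suc N"] by linarith
        \<comment> \<open>Origin of \<open>4 * K\<^sup>2\<close>: the shift by two indices costs at
          most \<open>2 * 2\<close>, one \<open>K\<close> is the divisor in \<open>\<rho>'\<close>,
          the other compares \<open>\<rho>' N\<close> with \<open>\<rho>0\<close>.\<close>
        moreover have "\<rho> * \<mu> ^ Suc (Suc N) \<le> (4 * K\<^sup>2) * \<rho>0"
        proof -
          have "\<rho> * \<mu> ^ Suc (Suc N) \<le> 4 * (K * \<rho>' N)"
            using \<mu>mono(2)[of N] \<mu>mono(2)[of "Suc N"] unfolding \<rho>'K by linarith
          also have "\<dots> \<le> 4 * (K * (K * \<rho>0))"
            using \<rho>0N(2) K by (intro mult_left_mono) auto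
          finally show ?thesis by (simp add: power2_eq_square mult.assoc)
        qed
        moreover have "dist x x0 \<le> 9 * \<rho> * \<mu> ^ Suc (Suc N)"
          using z(4)[of N] z(2) \<mu>mono(1)[of N] \<mu>mono(1)[of "Suc N"] by simp
        ultimately show ?thesis using 3 x0 \<rho>0 by (simp only: w r)
      qed
    qed
    have B: "\<exists>y \<sigma>. 0 < \<sigma> \<and> \<kappa> * r j \<le> \<sigma> \<and> \<kappa> * r (Suc j) \<le> \<sigma> \<and>
          ball y \<sigma> \<subseteq> ball (w j) (c * r j) \<and> ball y \<sigma> \<subseteq> ball (w (Suc j)) (c * r (Suc j))" if jN: "j < Suc (Suc N)" for j
    proof -
      \<comment> \<open>The two end transitions: concentric balls whose radius shrinks by a factor
        of at most \<open>K\<close>, so the smaller shrunken ball is the overlap.\<close>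
      have same: ?thesis if "w j = w (Suc j)" "0 < r (Suc j)" "r (Suc j) \<le> r j" "r j \<le> K * r (Suc j)"
      proof (intro exI conjI)
        show "0 < c * r (Suc j)" using that c by simp
        show "\<kappa> * r j \<le> c * r (Suc j)"
        proof -
          have "\<kappa> * r j \<le> (\<kappa> * K) * r (Suc j)" using that \<kappa> by (simp add: mult.assoc mult_left_mono)
          also have "\<dots> \<le> c * r (Suc j)" using that \<kappa> c by (intro mult_right_mono) auto
          finally show ?thesis .
        qed
        show "\<kappa> * r (Suc j) \<le> c * r (Suc j)" using that \<kappa> c by (intro mult_right_mono) auto
        show "ball (w j) (c * r (Suc j)) \<subseteq> ball (w j) (c * r j)"
          using that c by (intro subset_ball mult_left_mono) auto
        show "ball (w j) (c * r (Suc j)) \<subseteq> ball (w (Suc j)) (c * r (Suc j))" using that by simp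
      qed
      consider "j = 0" | k where "j = Suc k" "k < N" | "j = Suc N"
        using jN by (cases j) (auto simp: less_Suc_eq)
      then show ?thesis
      proof cases
        case 1
        then show ?thesis
          using \<rho>'pos[of 0] \<rho>'le[of 0] \<rho>'K[of 0] by (intro same) (simp_all add: w r z)
      next
        case (2 k)
        define \<sigma> where "\<sigma> = c * \<rho>' k / 2"
        have \<rho>'S: "\<rho>' k \<le> \<rho>' (Suc k)" "\<rho>' (Suc k) \<le> 2 * \<rho>' k"
          using \<mu>mono[of k] K by (auto simp: \<rho>'_def divide_right_mono field_simps)
        have d: "dist (z k) (z (Suc k)) \<le> \<sigma>"
        proof -
          have "\<mu> - 1 = c / (18 * K)" by (simp add: \<mu>_def)
          then have "(\<mu> - 1) * (9 * \<rho> * \<mu> ^ k) = c / (18 * K) * (9 * \<rho> * \<mu> ^ k)" by simp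
          also have "\<dots> = \<sigma>" using K by (simp add: \<sigma>_def \<rho>'_def field_simps)
          finally have "(\<mu> - 1) * (9 * \<rho> * \<mu> ^ k) = \<sigma>" .
          then show ?thesis using z(5)[OF 2(2)] by simp
        qed
        have "0 < \<sigma>" using c \<rho>'pos by (simp add: \<sigma>_def)
        moreover have "\<kappa> * \<rho>' k \<le> \<sigma>" "\<kappa> * \<rho>' (Suc k) \<le> \<sigma>"
        proof -
          have "\<kappa> * \<rho>' k \<le> (c / 4) * \<rho>' k" using \<kappa> \<rho>'pos[of k] by (intro mult_right_mono) auto
          then show "\<kappa> * \<rho>' k \<le> \<sigma>" using \<open>0 < \<sigma>\<close> by (simp add: \<sigma>_def)
          have "\<kappa> * \<rho>' (Suc k) \<le> (c / 4) * (2 * \<rho>' k)" using \<kappa> \<rho>'S \<rho>'pos[of "Suc k"] c by (intro mult_mono) auto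
          then show "\<kappa> * \<rho>' (Suc k) \<le> \<sigma>" by (simp add: \<sigma>_def)
        qed
        moreover have "ball (z k) \<sigma> \<subseteq> ball (z k) (c * \<rho>' k)"
          using c \<rho>'pos[of k] by (intro subset_ball) (simp add: \<sigma>_def)
        moreover have "ball (z k) \<sigma> \<subseteq> ball (z (Suc k)) (c * \<rho>' (Suc k))"
        proof -
          have "2 * \<sigma> \<le> c * \<rho>' (Suc k)" using \<rho>'S(1) c by (simp add: \<sigma>_def)
          then have "dist (z (Suc k)) v < c * \<rho>' (Suc k)" if "dist (z k) v < \<sigma>" for v
            using d that dist_triangle[of "z (Suc k)" v "z k"] by (simp add: dist_commute)
          then show ?thesis by auto
        qed
        ultimately show ?thesis using 2 by (intro exI[of _ "z k"] exI[of _ \<sigma>]) (simp add: w r)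
      next
        case 3
        then show ?thesis using \<rho>0 \<rho>0N z(2) by (intro same) (simp_all add: w r)
      qed
    qed
    show ?thesis
      by (intro exI[of _ "Suc (Suc N)"] exI[of _ w] exI[of _ r] conjI allI impI A B w r)
  qed
  moreover have "4 * K\<^sup>2 \<ge> 1" using K one_le_power[of K 2] by linarith
  ultimately show ?thesis using that[of "4 * K\<^sup>2" \<mu> \<kappa> x0 \<rho>0] \<mu> \<kappa> by blast
qed

section \<open>Whitney pairs and their energies\<close>

text \<open>A ball is connected, so if it met both the set and its complement it would contain a
  frontier point, closer to \<open>w\<close> than the distance to the frontier.\<close>

lemma ball_bdist_subset:
  fixes \<Omega> :: "(real^'n) set"
  assumes "w \<in> \<Omega>"
  shows "ball w (bdist \<Omega> w) \<subseteq> \<Omega>"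
proof (rule ccontr)
  assume "\<not> ?thesis"
  then obtain y where y: "y \<in> ball w (bdist \<Omega> w)" "y \<notin> \<Omega>" by blast
  then have "w \<in> ball w (bdist \<Omega> w)"
    by (metis centre_in_ball dist_not_less_zero mem_ball not_le order_le_less_trans)
  then obtain z where "z \<in> ball w (bdist \<Omega> w)" "z \<in> frontier \<Omega>"
    using connected_Int_frontier[of "ball w (bdist \<Omega> w)" \<Omega>] y assms connected_ball by blast
  then show False using infdist_le[of z "frontier \<Omega>" w] by (simp add: bdist_def)
qed

lemma bdist_measurable [measurable]:
  fixes \<Omega> :: "(real^'n) set"
  assumes "f \<in> borel_measurable M"
  shows "(\<lambda>x. bdist \<Omega> (f x)) \<in> borel_measurable M"
proof -
  have "bdist \<Omega> \<in> borel_measurable borel"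
    unfolding bdist_def by (intro borel_measurable_continuous_onI continuous_intros)
  then show ?thesis using assms by (rule measurable_compose[rotated])
qed

text \<open>The domain of integration of the seminorms, as a subset of the product. It is not
  symmetric: the distance is compared with the boundary distance of the first point.\<close>

definition whitney_pairs :: "(real^'n) set \<Rightarrow> real \<Rightarrow> ((real^'n) \<times> (real^'n)) set" where
  "whitney_pairs \<Omega> \<tau> = {(a, b). a \<in> \<Omega> \<and> dist a b < \<tau> * bdist \<Omega> a}"

lemma whitney_pairs_measurable [measurable]:
  assumes "open \<Omega>" and [measurable]: "f \<in> borel_measurable M" "g \<in> borel_measurable M"
  shows "Measurable.pred M (\<lambda>x. (f x, g x) \<in> whitney_pairs \<Omega> \<tau>)"
proof -
  have [measurable]: "\<Omega> \<in> sets borel" using assms(1) by simp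
  show ?thesis unfolding whitney_pairs_def by simp
qed

definition near_energy :: "real \<Rightarrow> (real^'n \<Rightarrow> real^'n) \<Rightarrow> real^'n \<Rightarrow> real \<Rightarrow> ennreal" where
  "near_energy p u x h = (\<integral>\<^sup>+z\<in>ball x h. ennreal (strain u x z powr p) \<partial>lborel)"

text \<open>Stands for a whole chain starting at \<open>x\<close>: every admissible pair
  contributes, weighted by the scale at which a chain from \<open>x\<close> could first meet it. No
  chain occurs in it, so it can be integrated over \<open>x\<close>.\<close>

definition far_energy :: "real \<Rightarrow> real \<Rightarrow> (real^'n) set \<Rightarrow> real \<Rightarrow> (real^'n \<Rightarrow> real^'n) \<Rightarrow> real^'n \<Rightarrow> real \<Rightarrow> ennreal" where
  "far_energy p q \<Omega> \<tau> u x h = (\<integral>\<^sup>+a. (\<integral>\<^sup>+b. ennreal (strain u a b powr p * max h (max (dist a b) (dist a x)) powr (- q))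
     * indicator (whitney_pairs \<Omega> \<tau>) (a, b) \<partial>lborel) \<partial>lborel)"

text \<open>Pairs in the double ball are Whitney pairs by the margin
  \<open>4 \<le> (3 / 5) * 7\<close>. All three entries of the maximum in the kernel are at most
  \<open>11 * R\<close>: \<open>dist a x\<close> is below \<open>2 * r + 9 * R\<close>,
  \<open>dist a b\<close> is below \<open>4 * r\<close>, and \<open>h \<le> R\<close>. So the kernel
  is bounded below by \<open>(11 * R) powr (- q)\<close>, whatever the position of
  \<open>w\<close>.\<close>

lemma energy_le_far_energy:
  fixes u :: "real^'n \<Rightarrow> real^'n"
  assumes "open \<Omega>" and u[measurable]: "u \<in> borel_measurable borel"
    and w: "w \<in> \<Omega>" "0 < r" "9 * r \<le> bdist \<Omega> w" and \<tau>: "3 / 5 \<le> \<tau>"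
    and R: "r \<le> R" "dist x w \<le> 9 * R" "0 < h" "h \<le> R" and "0 < q"
  shows "energy p u w r \<le> ennreal ((11 * R) powr q) * far_energy p q \<Omega> \<tau> u x h"
proof -
  define F where "F a b = ennreal (strain u a b powr p * max h (max (dist a b) (dist a x)) powr (- q))
     * indicator (whitney_pairs \<Omega> \<tau>) (a, b)" for a b
  have Fm: "(\<lambda>z. F (f z) (g z)) \<in> borel_measurable M"
    if [measurable]: "f \<in> borel_measurable M" "g \<in> borel_measurable M" for f g and M :: "((real^'n) \<times> (real^'n)) measure"
    using whitney_pairs_measurable[OF assms(1) that] unfolding F_def by measurable
  have Fm1: "(\<lambda>b. F a b) \<in> borel_measurable lborel" for a
  proof -
    have "(\<lambda>b. (a, b)) \<in> lborel \<rightarrow>\<^sub>M borel \<Otimes>\<^sub>M borel" by measurable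
    from measurable_compose[OF this Fm[OF measurable_fst measurable_snd]] show ?thesis by simp
  qed
  have Fm2: "(\<lambda>a. \<integral>\<^sup>+b. F a b \<partial>lborel) \<in> borel_measurable lborel"
    by (rule lborel.borel_measurable_nn_integral) (simp add: split_beta' Fm)
  have pt: "ennreal (strain u a b powr p) \<le> ennreal ((11 * R) powr q) * F a b"
    if ab: "a \<in> ball w (2 * r)" "b \<in> ball w (2 * r)" for a b
  proof -
    have da: "dist w a < 2 * r" "dist w b < 2 * r" using ab by auto
    have "a \<in> ball w (bdist \<Omega> w)" using da w by simp
    then have a: "a \<in> \<Omega>" using ball_bdist_subset[OF w(1)] by blast
    have "bdist \<Omega> w \<le> bdist \<Omega> a + dist w a"
      unfolding bdist_def by (rule infdist_triangle)
    then have \<delta>a: "7 * r \<le> bdist \<Omega> a" using da w by linarith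
    have "dist a b < 4 * r" using da dist_triangle[of a b w] by (simp add: dist_commute)
    also have "\<dots> \<le> (3 / 5) * (7 * r)" using w by simp
    also have "\<dots> \<le> \<tau> * bdist \<Omega> a" using \<tau> \<delta>a w by (intro mult_mono) auto
    finally have adm: "(a, b) \<in> whitney_pairs \<Omega> \<tau>" using a by (simp add: whitney_pairs_def)
    define m where "m = max h (max (dist a b) (dist a x))"
    have m: "0 < m" "m \<le> 11 * R"
      using da R \<open>dist a b < 4 * r\<close> dist_triangle[of a x w] by (auto simp: m_def dist_commute)
    have "1 = (11 * R) powr q * (11 * R) powr (- q)" using m by (simp add: powr_minus)
    also have "\<dots> \<le> (11 * R) powr q * m powr (- q)"
      using m \<open>0 < q\<close> by (intro mult_left_mono powr_mono2') auto
    finally have "strain u a b powr p * 1 \<le> strain u a b powr p * ((11 * R) powr q * m powr (- q))"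
      by (intro mult_left_mono) auto
    then have "ennreal (strain u a b powr p) \<le> ennreal ((11 * R) powr q * (strain u a b powr p * m powr (- q)))"
      by (intro ennreal_leI) (simp add: ac_simps)
    then show ?thesis using adm by (simp add: F_def m_def ennreal_mult)
  qed
  have "energy p u w r \<le> (\<integral>\<^sup>+a. (\<integral>\<^sup>+b. ennreal ((11 * R) powr q) * F a b \<partial>lborel) \<partial>lborel)"
    unfolding energy_def
  proof (intro nn_integral_mono)
    fix a :: "real^'n"
    show "(\<integral>\<^sup>+b\<in>ball w (2 * r). ennreal (strain u a b powr p) \<partial>lborel) * indicator (ball w (2 * r)) a
        \<le> (\<integral>\<^sup>+b. ennreal ((11 * R) powr q) * F a b \<partial>lborel)"
    proof (cases "a \<in> ball w (2 * r)")
      case True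
      have "(\<integral>\<^sup>+b\<in>ball w (2 * r). ennreal (strain u a b powr p) \<partial>lborel) \<le> (\<integral>\<^sup>+b. ennreal ((11 * R) powr q) * F a b \<partial>lborel)"
      proof (intro nn_integral_mono)
        fix b
        show "ennreal (strain u a b powr p) * indicator (ball w (2 * r)) b \<le> ennreal ((11 * R) powr q) * F a b"
          using pt[OF True, of b] by (cases "b \<in> ball w (2 * r)") simp_all
      qed
      then show ?thesis using True by simp
    qed simp
  qed
  also have "\<dots> = (\<integral>\<^sup>+a. ennreal ((11 * R) powr q) * (\<integral>\<^sup>+b. F a b \<partial>lborel) \<partial>lborel)"
    by (intro nn_integral_cong nn_integral_cmult Fm1)
  also have "\<dots> = ennreal ((11 * R) powr q) * far_energy p q \<Omega> \<tau> u x h"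
    unfolding far_energy_def F_def[symmetric] by (intro nn_integral_cmult Fm2)
  finally show ?thesis .
qed

section \<open>The pointwise estimate\<close>

lemma norm_telescope_le:
  fixes f :: "nat \<Rightarrow> 'a::real_normed_vector"
  shows "norm (f 0 - f M) \<le> (\<Sum>j<M. norm (f j - f (Suc j)))"
proof (induction M)
  case (Suc M)
  have "norm (f 0 - f (Suc M)) \<le> norm (f 0 - f M) + norm (f M - f (Suc M))"
    using norm_triangle_ineq[of "f 0 - f M" "f M - f (Suc M)"] by simp
  then show ?case using Suc by simp
qed simp

lemma sum_geometric_le:
  fixes q :: real
  assumes "0 \<le> q" "q < 1" "finite S"
  shows "(\<Sum>j\<in>S. q ^ j) \<le> 1 / (1 - q)"
proof -
  have "(\<Sum>j\<in>S. q ^ j) \<le> (\<Sum>j. q ^ j)"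
    using assms by (intro sum_le_suminf summable_geometric) auto
  then show ?thesis using assms by (simp add: suminf_geometric)
qed

text \<open>The weights \<open>\<mu> powr (- \<eta> / p)\<close> to the power \<open>j\<close> have
  bounded sum, so the constant does not depend on the length \<open>M\<close>; the price is the
  growing factor in front of the \<open>j\<close>-th difference.\<close>

lemma geometric_chain_powr_le:
  fixes f :: "nat \<Rightarrow> 'a::real_normed_vector"
  assumes "0 < p" "0 < \<eta>" "1 < \<mu>"
  shows "norm (f 0 - f M) powr p \<le> (1 / (1 - \<mu> powr (- \<eta> / p))) powr p * (\<Sum>j<M. (\<mu> powr \<eta>) ^ j * norm (f j - f (Suc j)) powr p)"
proof -
  define q where "q = \<mu> powr (- \<eta> / p)"
  have q: "0 < q" "q < 1" using assms by (auto simp: q_def powr_less_one)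
  have eq: "(norm (f j - f (Suc j)) / q ^ j) powr p = (\<mu> powr \<eta>) ^ j * norm (f j - f (Suc j)) powr p" for j
  proof -
    have "(q ^ j) powr p = (q powr p) ^ j"
      using q by (simp add: powr_power powr_powr mult.commute flip: powr_realpow)
    also have "q powr p = \<mu> powr (- \<eta>)" using assms by (simp add: q_def powr_powr)
    finally have "(q ^ j) powr p = 1 / (\<mu> powr \<eta>) ^ j" by (simp add: powr_minus_divide power_divide)
    then show ?thesis using q by (simp add: powr_divide mult.commute)
  qed
  have "norm (f 0 - f M) powr p \<le> (\<Sum>j<M. norm (f j - f (Suc j))) powr p"
    using assms by (intro powr_mono2 norm_telescope_le) auto
  also have "\<dots> \<le> (\<Sum>j<M. q ^ j) powr p * (\<Sum>j<M. (norm (f j - f (Suc j)) / q ^ j) powr p)"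
    using assms q by (intro sum_powr_le_weighted) auto
  also have "\<dots> \<le> (1 / (1 - q)) powr p * (\<Sum>j<M. (norm (f j - f (Suc j)) / q ^ j) powr p)"
    using assms q by (intro mult_right_mono powr_mono2 sum_geometric_le sum_nonneg) auto
  finally show ?thesis unfolding eq unfolding q_def .
qed

text \<open>The weight \<open>\<mu> powr \<eta>\<close> absorbs the summation along the chain; it is affordable because
  \<open>far_energy\<close> is later integrated against a positive power of \<open>h\<close>.\<close>

lemma chain_gradient_bound:
  assumes "0 < p" "0 < \<eta>" "1 < \<mu>" "0 < \<kappa>" "0 < C1"
  obtains C where "C > 0"
    "\<And>u (A :: nat \<Rightarrow> real^'n^'n) (b :: nat \<Rightarrow> real^'n) w r M. u \<in> borel_measurable borel \<Longrightarrow>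
    (\<And>j. j \<le> M \<Longrightarrow> 0 < r j \<and> (\<integral>\<^sup>+y\<in>ball (w j) (r j / (2 * sqrt (real CARD('n)))). ennreal (norm (u y - (A j *v y + b j)) powr p) \<partial>lborel)
        \<le> ennreal (C1 * r j powr (- p - real CARD('n))) * energy p u (w j) (r j)) \<Longrightarrow>
    (\<And>j. j < M \<Longrightarrow> \<exists>y \<sigma>. 0 < \<sigma> \<and> \<kappa> * r j \<le> \<sigma> \<and> \<kappa> * r (Suc j) \<le> \<sigma> \<and>
          ball y \<sigma> \<subseteq> ball (w j) (r j / (2 * sqrt (real CARD('n)))) \<and>
          ball y \<sigma> \<subseteq> ball (w (Suc j)) (r (Suc j) / (2 * sqrt (real CARD('n))))) \<Longrightarrow>
    ennreal (norm (A 0 - A M) powr p) \<le> ennreal C *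
      (\<Sum>j\<le>M. ennreal ((\<mu> powr \<eta>) ^ j * r j powr (- (2 * p + 2 * real CARD('n)))) * energy p u (w j) (r j))"
proof -
  define n where "n = real CARD('n)"
  obtain C3 where C3: "C3 > 0" "\<And>(u::real^'n \<Rightarrow> real^'n) A A' b b' w \<sigma>. u \<in> borel_measurable borel \<Longrightarrow> 0 < \<sigma> \<Longrightarrow>
    ennreal (norm (A - A') powr p) \<le> ennreal (C3 * \<sigma> powr (- p - n)) *
      ((\<integral>\<^sup>+y\<in>ball w \<sigma>. ennreal (norm (u y - (A *v y + b)) powr p) \<partial>lborel)
      + (\<integral>\<^sup>+y\<in>ball w \<sigma>. ennreal (norm (u y - (A' *v y + b')) powr p) \<partial>lborel))"
    using affine_gradient_compare[OF \<open>0 < p\<close>] unfolding n_def by blast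
  define W where "W = (1 / (1 - \<mu> powr (- \<eta> / p))) powr p"
  define C4 where "C4 = C3 * C1 * \<kappa> powr (- p - n)"
  have "\<mu> powr (- \<eta> / p) < 1" using assms by (simp add: powr_less_one)
  then have "W > 0" by (simp add: W_def)
  have "C4 > 0" using C3 assms by (simp add: C4_def)
  define C where "C = W * (C4 * 2)"
  have "C > 0" using \<open>W > 0\<close> \<open>C4 > 0\<close> by (simp add: C_def)
  have main: "ennreal (norm (A 0 - A M) powr p) \<le> ennreal C *
      (\<Sum>j\<le>M. ennreal ((\<mu> powr \<eta>) ^ j * r j powr (- (2 * p + 2 * n))) * energy p u (w j) (r j))"
    if u: "u \<in> borel_measurable borel"
      and loc: "\<And>j. j \<le> M \<Longrightarrow> 0 < r j \<and> (\<integral>\<^sup>+y\<in>ball (w j) (r j / (2 * sqrt n)). ennreal (norm (u y - (A j *v y + b j)) powr p) \<partial>lborel)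
        \<le> ennreal (C1 * r j powr (- p - n)) * energy p u (w j) (r j)"
      and sub: "\<And>j. j < M \<Longrightarrow> \<exists>y \<sigma>. 0 < \<sigma> \<and> \<kappa> * r j \<le> \<sigma> \<and> \<kappa> * r (Suc j) \<le> \<sigma> \<and>
          ball y \<sigma> \<subseteq> ball (w j) (r j / (2 * sqrt n)) \<and> ball y \<sigma> \<subseteq> ball (w (Suc j)) (r (Suc j) / (2 * sqrt n))"
    for u and A :: "nat \<Rightarrow> real^'n^'n" and b w r M
  proof -
    define G where "G j = ennreal (r j powr (- (2 * p + 2 * n))) * energy p u (w j) (r j)" for j
    define m where "m = \<mu> powr \<eta>"
    have m: "1 \<le> m" using assms by (simp add: m_def ge_one_powr_ge_zero)
    have step: "ennreal (norm (A j - A (Suc j)) powr p) \<le> ennreal C4 * (G j + G (Suc j))" if j: "j < M" for j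
    proof -
      obtain y \<sigma> where y: "0 < \<sigma>" "\<kappa> * r j \<le> \<sigma>" "\<kappa> * r (Suc j) \<le> \<sigma>"
          "ball y \<sigma> \<subseteq> ball (w j) (r j / (2 * sqrt n))" "ball y \<sigma> \<subseteq> ball (w (Suc j)) (r (Suc j) / (2 * sqrt n))"
        using sub[OF j] by blast
      have one: "ennreal (C3 * \<sigma> powr (- p - n)) * (\<integral>\<^sup>+z\<in>ball y \<sigma>. ennreal (norm (u z - (A i *v z + b i)) powr p) \<partial>lborel) \<le> ennreal C4 * G i"
        if i: "i \<le> M" "\<kappa> * r i \<le> \<sigma>" "ball y \<sigma> \<subseteq> ball (w i) (r i / (2 * sqrt n))" for i
      proof -
        have ri: "0 < r i" using loc[OF i(1)] by simp
        have "(\<integral>\<^sup>+z\<in>ball y \<sigma>. ennreal (norm (u z - (A i *v z + b i)) powr p) \<partial>lborel)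
            \<le> (\<integral>\<^sup>+z\<in>ball (w i) (r i / (2 * sqrt n)). ennreal (norm (u z - (A i *v z + b i)) powr p) \<partial>lborel)"
          using i(3) by (intro nn_integral_mono mult_left_mono) (auto simp: indicator_def)
        also have "\<dots> \<le> ennreal (C1 * r i powr (- p - n)) * energy p u (w i) (r i)"
          using loc[OF i(1)] by blast
        finally have 1: "(\<integral>\<^sup>+z\<in>ball y \<sigma>. ennreal (norm (u z - (A i *v z + b i)) powr p) \<partial>lborel)
            \<le> ennreal (C1 * r i powr (- p - n)) * energy p u (w i) (r i)" .
        have "\<sigma> powr (- p - n) \<le> (\<kappa> * r i) powr (- p - n)"
          using i(2) ri assms by (intro powr_mono2') (auto simp: n_def)
        also have "\<dots> = \<kappa> powr (- p - n) * r i powr (- p - n)" by (rule powr_mult)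
        finally have 2: "ennreal (C3 * \<sigma> powr (- p - n)) \<le> ennreal (C3 * (\<kappa> powr (- p - n) * r i powr (- p - n)))"
          using C3 by (intro ennreal_leI mult_left_mono) auto
        have "ennreal (C3 * \<sigma> powr (- p - n)) * (\<integral>\<^sup>+z\<in>ball y \<sigma>. ennreal (norm (u z - (A i *v z + b i)) powr p) \<partial>lborel)
            \<le> ennreal (C3 * (\<kappa> powr (- p - n) * r i powr (- p - n))) * (ennreal (C1 * r i powr (- p - n)) * energy p u (w i) (r i))"
          using 1 2 by (intro mult_mono) auto
        also have "\<dots> = ennreal (C4 * (r i powr (- p - n) * r i powr (- p - n))) * energy p u (w i) (r i)"
          unfolding mult.assoc[symmetric] using C3 assms
          by (subst ennreal_mult[symmetric]) (auto simp: C4_def ac_simps)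
        \<comment> \<open>The exponent arises twice: once from comparing gradients on an overlap of
          size about \<open>r i\<close>, once from the local approximation on the ball
          itself.\<close>
        also have "r i powr (- p - n) * r i powr (- p - n) = r i powr (- (2 * p + 2 * n))"
          by (simp flip: powr_add)
        also have "ennreal (C4 * r i powr (- (2 * p + 2 * n))) * energy p u (w i) (r i) = ennreal C4 * G i"
          using \<open>C4 > 0\<close> by (simp add: G_def ennreal_mult mult.assoc)
        finally show ?thesis .
      qed
      have "ennreal (norm (A j - A (Suc j)) powr p) \<le> ennreal (C3 * \<sigma> powr (- p - n)) *
        ((\<integral>\<^sup>+z\<in>ball y \<sigma>. ennreal (norm (u z - (A j *v z + b j)) powr p) \<partial>lborel)
        + (\<integral>\<^sup>+z\<in>ball y \<sigma>. ennreal (norm (u z - (A (Suc j) *v z + b (Suc j))) powr p) \<partial>lborel))"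
        by (rule C3(2)[OF u y(1)])
      also have "\<dots> \<le> ennreal C4 * G j + ennreal C4 * G (Suc j)"
        unfolding distrib_left using y j by (intro add_mono one) auto
      finally show ?thesis by (simp add: distrib_left)
    qed
    have "norm (A 0 - A M) powr p \<le> W * (\<Sum>j<M. m ^ j * norm (A j - A (Suc j)) powr p)"
      unfolding W_def m_def by (rule geometric_chain_powr_le) fact+
    then have "ennreal (norm (A 0 - A M) powr p) \<le> ennreal (W * (\<Sum>j<M. m ^ j * norm (A j - A (Suc j)) powr p))"
      by (rule ennreal_leI)
    also have "\<dots> = ennreal W * (\<Sum>j<M. ennreal (m ^ j) * ennreal (norm (A j - A (Suc j)) powr p))"
      using \<open>W > 0\<close> m by (simp add: ennreal_mult sum_nonneg flip: sum_ennreal)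
    also have "\<dots> \<le> ennreal W * (\<Sum>j<M. ennreal (m ^ j) * (ennreal C4 * (G j + G (Suc j))))"
      by (intro mult_left_mono sum_mono step) auto
    also have "\<dots> = ennreal W * (ennreal C4 * (\<Sum>j<M. ennreal (m ^ j) * (G j + G (Suc j))))"
      by (simp add: sum_distrib_left ac_simps)
    \<comment> \<open>Raising the weight of \<open>G (Suc j)\<close> to \<open>m ^ Suc j\<close>
      makes the second sum a shift of the first, so each ball is counted at most twice.\<close>
    also have "(\<Sum>j<M. ennreal (m ^ j) * (G j + G (Suc j))) \<le> (\<Sum>j<M. ennreal (m ^ j) * G j) + (\<Sum>j<M. ennreal (m ^ Suc j) * G (Suc j))"
      unfolding distrib_left sum.distrib
      using m by (intro add_mono sum_mono order_refl mult_right_mono ennreal_leI power_increasing) auto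
    also have "\<dots> \<le> (\<Sum>j\<le>M. ennreal (m ^ j) * G j) + (\<Sum>j\<le>M. ennreal (m ^ j) * G j)"
    proof (rule add_mono)
      show "(\<Sum>j<M. ennreal (m ^ j) * G j) \<le> (\<Sum>j\<le>M. ennreal (m ^ j) * G j)"
        by (intro sum_mono2) auto
      have "(\<Sum>j<M. ennreal (m ^ Suc j) * G (Suc j)) = (\<Sum>j\<in>Suc ` {..<M}. ennreal (m ^ j) * G j)"
        by (simp add: sum.reindex)
      also have "\<dots> \<le> (\<Sum>j\<le>M. ennreal (m ^ j) * G j)"
        by (intro sum_mono2) auto
      finally show "(\<Sum>j<M. ennreal (m ^ Suc j) * G (Suc j)) \<le> (\<Sum>j\<le>M. ennreal (m ^ j) * G j)" .
    qed
    also have "\<dots> = ennreal 2 * (\<Sum>j\<le>M. ennreal (m ^ j) * G j)" by (simp add: mult_2)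
    finally have "ennreal (norm (A 0 - A M) powr p) \<le> ennreal W * (ennreal C4 * (ennreal 2 * (\<Sum>j\<le>M. ennreal (m ^ j) * G j)))"
      by (simp add: mult_left_mono)
    also have "\<dots> = ennreal C * (\<Sum>j\<le>M. ennreal (m ^ j) * G j)"
      unfolding mult.assoc[symmetric] C_def using \<open>W > 0\<close> \<open>C4 > 0\<close> by (simp add: ennreal_mult)
    also have "(\<Sum>j\<le>M. ennreal (m ^ j) * G j) = (\<Sum>j\<le>M. ennreal (m ^ j * r j powr (- (2 * p + 2 * n))) * energy p u (w j) (r j))"
      using m by (simp add: G_def ennreal_mult mult.assoc)
    finally show ?thesis unfolding m_def .
  qed
  show ?thesis
    by (rule that[OF \<open>C > 0\<close>], rule main[unfolded n_def])
qed

lemma add3_powr_le: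
  fixes a b c :: real
  assumes "0 < p" "0 \<le> a" "0 \<le> b" "0 \<le> c"
  shows "(a + b + c) powr p \<le> 3 powr p * (a powr p + b powr p + c powr p)"
  using sum_powr_le[of "{..<3::nat}" p "\<lambda>i. if i = 0 then a else if i = 1 then b else c"] assms
  by (simp add: lessThan_nat_numeral lessThan_Suc eval_nat_numeral ac_simps)

text \<open>With \<open>R = \<rho> * \<mu> ^ j\<close> comparable to \<open>r j\<close>, the factors
  \<open>r j powr (- Q)\<close> and \<open>R powr (Q - \<alpha>)\<close> leave
  \<open>R powr (- \<alpha>)\<close>. Half of the resulting decay in \<open>j\<close> pays for the
  weight \<open>\<mu> powr (\<alpha> / 2)\<close>, the other half makes the sum geometric;
  \<open>h \<le> \<rho>\<close> does the rest.\<close>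

lemma chain_energy_le_far_energy:
  fixes u :: "real^'n \<Rightarrow> real^'n"
  assumes "open \<Omega>" "u \<in> borel_measurable borel" "3 / 5 \<le> \<tau>"
    and \<alpha>: "0 < \<alpha>" "\<alpha> < Q" and \<mu>: "1 < \<mu>" and L: "0 < L" and h: "0 < h" "h \<le> \<rho>"
    and c: "\<And>j. j \<le> M \<Longrightarrow> w j \<in> \<Omega> \<and> 0 < r j \<and> 9 * r j \<le> bdist \<Omega> (w j) \<and> r j \<le> \<rho> * \<mu> ^ j \<and> \<rho> * \<mu> ^ j \<le> L * r j \<and>
          dist x (w j) \<le> 9 * \<rho> * \<mu> ^ j"
  shows "(\<Sum>j\<le>M. ennreal ((\<mu> powr (\<alpha> / 2)) ^ j * r j powr (- Q)) * energy p u (w j) (r j))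
    \<le> ennreal (L powr Q * 11 powr (Q - \<alpha>) / (1 - \<mu> powr (- \<alpha> / 2))) * (ennreal (h powr (- \<alpha>)) * far_energy p (Q - \<alpha>) \<Omega> \<tau> u x h)"
proof -
  define \<Phi> where "\<Phi> = far_energy p (Q - \<alpha>) \<Omega> \<tau> u x h"
  define q where "q = \<mu> powr (- \<alpha> / 2)"
  define k where "k = L powr Q * 11 powr (Q - \<alpha>)"
  have q: "0 < q" "q < 1" using \<alpha> \<mu> by (auto simp: q_def powr_less_one)
  have "k > 0" using L by (simp add: k_def)
  have \<rho>: "0 < \<rho>" using h by linarith
  have "ennreal ((\<mu> powr (\<alpha> / 2)) ^ j * r j powr (- Q)) * energy p u (w j) (r j) \<le> ennreal (k * h powr (- \<alpha>) * q ^ j) * \<Phi>" if j: "j \<le> M" for j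
  proof -
    define R where "R = \<rho> * \<mu> ^ j"
    have rR: "0 < r j" "r j \<le> R" "R \<le> L * r j" "dist x (w j) \<le> 9 * R" using c[OF j] by (auto simp: R_def)
    have \<mu>j: "1 \<le> \<mu> ^ j" using \<mu> by simp
    have "\<rho> \<le> R" using \<rho> \<mu>j by (simp add: R_def mult_le_cancel_left1)
    have "energy p u (w j) (r j) \<le> ennreal ((11 * R) powr (Q - \<alpha>)) * \<Phi>"
      unfolding \<Phi>_def using assms(1-3) c[OF j] rR \<open>\<rho> \<le> R\<close> h \<alpha>
      by (intro energy_le_far_energy) auto
    then have "ennreal ((\<mu> powr (\<alpha> / 2)) ^ j * r j powr (- Q)) * energy p u (w j) (r j)
        \<le> ennreal ((\<mu> powr (\<alpha> / 2)) ^ j * r j powr (- Q)) * (ennreal ((11 * R) powr (Q - \<alpha>)) * \<Phi>)"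
      by (intro mult_left_mono) auto
    also have "\<dots> = ennreal ((\<mu> powr (\<alpha> / 2)) ^ j * r j powr (- Q) * (11 * R) powr (Q - \<alpha>)) * \<Phi>"
      by (simp add: ennreal_mult mult.assoc)
    also have "\<dots> \<le> ennreal (k * h powr (- \<alpha>) * q ^ j) * \<Phi>"
    proof (intro mult_right_mono ennreal_leI)
      have "r j powr (- Q) \<le> (R / L) powr (- Q)"
        using rR L \<alpha> \<rho> \<mu> by (intro powr_mono2') (auto simp: R_def divide_le_eq mult.commute)
      also have "\<dots> = L powr Q * R powr (- Q)"
        using L \<rho> \<mu> by (simp add: R_def powr_divide powr_minus_divide)
      finally have "(\<mu> powr (\<alpha> / 2)) ^ j * r j powr (- Q) * (11 * R) powr (Q - \<alpha>)
          \<le> (\<mu> powr (\<alpha> / 2)) ^ j * (L powr Q * R powr (- Q)) * (11 * R) powr (Q - \<alpha>)"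
        by (intro mult_right_mono mult_left_mono) auto
      also have "\<dots> = k * ((\<mu> powr (\<alpha> / 2)) ^ j * (R powr (- Q) * R powr (Q - \<alpha>)))"
        by (simp add: k_def powr_mult)
      also have "R powr (- Q) * R powr (Q - \<alpha>) = R powr (- \<alpha>)"
        by (simp flip: powr_add)
      also have "R powr (- \<alpha>) = \<rho> powr (- \<alpha>) * (\<mu> powr (- \<alpha>)) ^ j"
        using \<mu> by (simp add: R_def powr_mult powr_power powr_powr mult.commute flip: powr_realpow)
      also have "(\<mu> powr (\<alpha> / 2)) ^ j * (\<rho> powr (- \<alpha>) * (\<mu> powr (- \<alpha>)) ^ j) = \<rho> powr (- \<alpha>) * (\<mu> powr (\<alpha> / 2) * \<mu> powr (- \<alpha>)) ^ j"
        by (simp add: power_mult_distrib)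
      also have "\<mu> powr (\<alpha> / 2) * \<mu> powr (- \<alpha>) = q"
        by (simp add: q_def flip: powr_add)
      also have "k * (\<rho> powr (- \<alpha>) * q ^ j) \<le> k * (h powr (- \<alpha>) * q ^ j)"
        using h \<alpha> q \<open>k > 0\<close> by (intro mult_left_mono mult_right_mono powr_mono2') auto
      finally show "(\<mu> powr (\<alpha> / 2)) ^ j * r j powr (- Q) * (11 * R) powr (Q - \<alpha>) \<le> k * h powr (- \<alpha>) * q ^ j"
        by (simp add: mult.assoc)
    qed auto
    finally show ?thesis .
  qed
  then have "(\<Sum>j\<le>M. ennreal ((\<mu> powr (\<alpha> / 2)) ^ j * r j powr (- Q)) * energy p u (w j) (r j))
      \<le> (\<Sum>j\<le>M. ennreal (k * h powr (- \<alpha>) * q ^ j) * \<Phi>)"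
    by (intro sum_mono) auto
  also have "\<dots> = ennreal (k * h powr (- \<alpha>) * (\<Sum>j\<le>M. q ^ j)) * \<Phi>"
    using \<open>k > 0\<close> q by (simp add: sum_distrib_left flip: sum_distrib_right)
  also have "\<dots> \<le> ennreal (k * h powr (- \<alpha>) * (1 / (1 - q))) * \<Phi>"
    using \<open>k > 0\<close> q by (intro mult_right_mono ennreal_leI mult_left_mono sum_geometric_le) auto
  also have "k * h powr (- \<alpha>) * (1 / (1 - q)) = k / (1 - q) * h powr (- \<alpha>)" by simp
  also have "ennreal (k / (1 - q) * h powr (- \<alpha>)) * \<Phi> = ennreal (k / (1 - q)) * (ennreal (h powr (- \<alpha>)) * \<Phi>)"
    using \<open>k > 0\<close> q by (subst ennreal_mult) (auto simp: mult.assoc)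
  finally show ?thesis unfolding k_def q_def \<Phi>_def .
qed

text \<open>Three contributions: the deviation of \<open>u\<close> at \<open>x\<close> and at
  \<open>y\<close> from the rigid motion of a ball of size about \<open>h\<close> around
  \<open>x\<close>, and the drift of its matrix along the chain, multiplied by \<open>h\<close>. The
  matrix \<open>A0\<close> is quantified before \<open>x\<close> and \<open>y\<close>.\<close>

lemma korn_pointwise:
  fixes \<Omega> :: "(real^'n) set"
  assumes "john_domain \<Omega>" and "0 < p" and \<tau>: "3 / 5 \<le> \<tau>" and \<alpha>: "0 < \<alpha>" "\<alpha> < 2 * p + 2 * real CARD('n)"
  obtains C where "C > 0"
    "\<And>u. u \<in> borel_measurable borel \<Longrightarrow> \<exists>A0::real^'n^'n. transpose A0 = - A0 \<and>
      (\<forall>x\<in>\<Omega>. \<forall>y. x \<noteq> y \<longrightarrow> 36 * sqrt (real CARD('n)) * dist x y \<le> bdist \<Omega> x \<longrightarrow>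
        ennreal (norm (u y - u x - A0 *v (y - x)) powr p) \<le> ennreal C *
          (ennreal (dist x y powr (- p - real CARD('n))) * (near_energy p u x (dist x y) + near_energy p u y (dist x y))
           + ennreal (dist x y powr (p - \<alpha>)) * far_energy p (2 * p + 2 * real CARD('n) - \<alpha>) \<Omega> \<tau> u x (dist x y)))"
proof -
  define n where "n = real CARD('n)"
  define Q where "Q = 2 * p + 2 * n"
  define c where "c = 1 / (2 * sqrt n)"
  have n1: "n \<ge> 1" "sqrt n \<ge> 1" by (auto simp: n_def Suc_leI)
  have "1 \<le> 2 * sqrt n" using n1(2) by linarith
  then have c: "0 < c" "c \<le> 1" using n1(1) by (auto simp: c_def)
  have cr: "c * r = r / (2 * sqrt n)" for r by (simp add: c_def)
  have "open \<Omega>" using assms(1) by (simp add: john_domain_def)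
  obtain L \<mu> \<kappa> x0 \<rho>0 where L: "L \<ge> 1" "\<mu> > 1" "\<kappa> > 0" and chain:
    "\<And>x \<rho>. x \<in> \<Omega> \<Longrightarrow> 0 < \<rho> \<Longrightarrow> 9 * \<rho> \<le> bdist \<Omega> x \<Longrightarrow>
      \<exists>M w r. w 0 = x \<and> r 0 = \<rho> \<and> w M = x0 \<and> r M = \<rho>0 \<and>
        (\<forall>j\<le>M. w j \<in> \<Omega> \<and> 0 < r j \<and> 9 * r j \<le> bdist \<Omega> (w j) \<and> r j \<le> \<rho> * \<mu> ^ j \<and> \<rho> * \<mu> ^ j \<le> L * r j \<and>
          dist x (w j) \<le> 9 * \<rho> * \<mu> ^ j) \<and>
        (\<forall>j<M. \<exists>y \<sigma>. 0 < \<sigma> \<and> \<kappa> * r j \<le> \<sigma> \<and> \<kappa> * r (Suc j) \<le> \<sigma> \<and>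
          ball y \<sigma> \<subseteq> ball (w j) (r j / (2 * sqrt n)) \<and> ball y \<sigma> \<subseteq> ball (w (Suc j)) (r (Suc j) / (2 * sqrt n)))"
    using john_ball_chain[OF assms(1) c] unfolding cr by blast
  obtain C1 where C1: "C1 > 0" "\<And>(u::real^'n \<Rightarrow> real^'n) x \<rho>. u \<in> borel_measurable borel \<Longrightarrow> 0 < \<rho> \<Longrightarrow> \<exists>A b. transpose A = - A \<and>
    (\<integral>\<^sup>+y\<in>ball x (\<rho> / (2 * sqrt n)). ennreal (norm (u y - (A *v y + b)) powr p) \<partial>lborel)
      \<le> ennreal (C1 * \<rho> powr (- p - n)) * energy p u x \<rho>"
    using local_rigid_approx[OF \<open>0 < p\<close>] unfolding n_def by blast
  obtain C2 where C2: "C2 > 0" "\<And>(u::real^'n \<Rightarrow> real^'n) A b y \<rho>. u \<in> borel_measurable borel \<Longrightarrow> 0 < \<rho> \<Longrightarrow> transpose A = - A \<Longrightarrow>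
    ennreal (norm (u y - (A *v y + b)) powr p) \<le>
      ennreal (C2 * \<rho> powr (- p - n)) * (\<integral>\<^sup>+z\<in>ball y (2 * \<rho>). ennreal (strain u y z powr p) \<partial>lborel)
      + ennreal (C2 * \<rho> powr (- n)) * (\<integral>\<^sup>+z\<in>ball y (2 * \<rho>). ennreal (norm (u z - (A *v z + b)) powr p) \<partial>lborel)"
    using rigid_pointwise_integral[OF \<open>0 < p\<close>] unfolding n_def by blast
  have "0 < \<alpha> / 2" using \<alpha> by simp
  note chain_bound = chain_gradient_bound[OF \<open>0 < p\<close> this L(2,3) C1(1), where 'n = 'n]
  obtain C6 where C6: "C6 > 0" "\<And>u (A :: nat \<Rightarrow> real^'n^'n) (b :: nat \<Rightarrow> real^'n) w r M. u \<in> borel_measurable borel \<Longrightarrow>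
    (\<And>j. j \<le> M \<Longrightarrow> 0 < r j \<and> (\<integral>\<^sup>+y\<in>ball (w j) (r j / (2 * sqrt n)). ennreal (norm (u y - (A j *v y + b j)) powr p) \<partial>lborel)
        \<le> ennreal (C1 * r j powr (- p - n)) * energy p u (w j) (r j)) \<Longrightarrow>
    (\<And>j. j < M \<Longrightarrow> \<exists>y \<sigma>. 0 < \<sigma> \<and> \<kappa> * r j \<le> \<sigma> \<and> \<kappa> * r (Suc j) \<le> \<sigma> \<and>
          ball y \<sigma> \<subseteq> ball (w j) (r j / (2 * sqrt n)) \<and>
          ball y \<sigma> \<subseteq> ball (w (Suc j)) (r (Suc j) / (2 * sqrt n))) \<Longrightarrow>
    ennreal (norm (A 0 - A M) powr p) \<le> ennreal C6 *
      (\<Sum>j\<le>M. ennreal ((\<mu> powr (\<alpha> / 2)) ^ j * r j powr (- Q)) * energy p u (w j) (r j))"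
    unfolding n_def Q_def
  proof (rule chain_bound, goal_cases)
    case (1 C)
    show ?case by (rule 1(1)[OF 1(2)], rule 1(3))
  qed
  define C7 where "C7 = L powr Q * 11 powr (Q - \<alpha>) / (1 - \<mu> powr (- \<alpha> / 2))"
  define c8 where "c8 = 2 powr n * (4 * sqrt n) powr (p + n)"
  define Ca where "Ca = C2 * 2 powr (p + n)"
  define Cb where "Cb = C2 * C1 * c8"
  define C where "C = 3 powr p * (Ca + (2 * Cb + C6) * C7)"
  have "\<mu> powr (- \<alpha> / 2) < 1" using \<alpha> L by (simp add: powr_less_one)
  then have "C7 > 0" using L by (simp add: C7_def)
  have pos: "Ca > 0" "Cb > 0" using C1 C2 n1 by (auto simp: Ca_def Cb_def c8_def)
  have "C > 0" using pos C6(1) \<open>C7 > 0\<close> by (simp add: C_def add_pos_pos)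
  have main: "\<exists>A0::real^'n^'n. transpose A0 = - A0 \<and>
      (\<forall>x\<in>\<Omega>. \<forall>y. x \<noteq> y \<longrightarrow> 36 * sqrt n * dist x y \<le> bdist \<Omega> x \<longrightarrow>
        ennreal (norm (u y - u x - A0 *v (y - x)) powr p) \<le> ennreal C *
          (ennreal (dist x y powr (- p - n)) * (near_energy p u x (dist x y) + near_energy p u y (dist x y))
           + ennreal (dist x y powr (p - \<alpha>)) * far_energy p (Q - \<alpha>) \<Omega> \<tau> u x (dist x y)))"
    if u: "u \<in> borel_measurable borel" for u :: "real^'n \<Rightarrow> real^'n"
  proof -
    \<comment> \<open>Matrices are fixed for all centres and radii before any chain is drawn, so the
      last matrix of every chain is the same \<open>A x0 \<rho>0\<close>. The guard
      \<open>0 < \<rho>\<close> makes the choice total.\<close>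
    define good where "good x \<rho> A b \<longleftrightarrow> transpose A = - A \<and> (0 < \<rho> \<longrightarrow>
      (\<integral>\<^sup>+y\<in>ball x (\<rho> / (2 * sqrt n)). ennreal (norm (u y - (A *v y + b)) powr p) \<partial>lborel)
      \<le> ennreal (C1 * \<rho> powr (- p - n)) * energy p u x \<rho>)" for x :: "real^'n" and \<rho> A b
    have "\<exists>A b. good x \<rho> A b" for x \<rho>
    proof (cases "0 < \<rho>")
      case True
      then show ?thesis using C1(2)[OF u True, of x] by (simp add: good_def)
    next
      case False
      moreover have "transpose (0::real^'n^'n) = - 0" by (simp add: transpose_def vec_eq_iff)
      ultimately show ?thesis unfolding good_def by blast
    qed
    then obtain A b where good: "\<And>x \<rho>. good x \<rho> (A x \<rho>) (b x \<rho>)" by metis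
    then have A: "\<And>x \<rho>. transpose (A x \<rho>) = - A x \<rho>"
      and Ab: "\<And>x \<rho>. 0 < \<rho> \<Longrightarrow> (\<integral>\<^sup>+y\<in>ball x (\<rho> / (2 * sqrt n)). ennreal (norm (u y - (A x \<rho> *v y + b x \<rho>)) powr p) \<partial>lborel)
      \<le> ennreal (C1 * \<rho> powr (- p - n)) * energy p u x \<rho>"
      by (auto simp: good_def)
    have "ennreal (norm (u y - u x - A x0 \<rho>0 *v (y - x)) powr p) \<le> ennreal C *
          (ennreal (dist x y powr (- p - n)) * (near_energy p u x (dist x y) + near_energy p u y (dist x y))
           + ennreal (dist x y powr (p - \<alpha>)) * far_energy p (Q - \<alpha>) \<Omega> \<tau> u x (dist x y))"
      if x: "x \<in> \<Omega>" and "x \<noteq> y" and xy: "36 * sqrt n * dist x y \<le> bdist \<Omega> x" for x y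
    proof -
      define h where "h = dist x y"
      \<comment> \<open>The approximation at \<open>x\<close> then holds within radius
        \<open>2 * h\<close>, and this ball contains the balls of radius \<open>h\<close> around
        \<open>x\<close> and around \<open>y\<close>.\<close>
      define \<rho> where "\<rho> = 4 * sqrt n * h"
      have h: "0 < h" using \<open>x \<noteq> y\<close> by (simp add: h_def)
      have \<rho>: "0 < \<rho>" "9 * \<rho> \<le> bdist \<Omega> x" "h \<le> \<rho>" "\<rho> / (2 * sqrt n) = 2 * h"
      proof -
        show "0 < \<rho>" using h n1(1) by (simp add: \<rho>_def)
        show "9 * \<rho> \<le> bdist \<Omega> x" using xy by (simp add: \<rho>_def h_def)
        have "1 \<le> 4 * sqrt n" using n1(2) by linarith
        then show "h \<le> \<rho>" using h by (simp add: \<rho>_def mult_le_cancel_right1)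
        show "\<rho> / (2 * sqrt n) = 2 * h" using n1(1) by (simp add: \<rho>_def)
      qed
      obtain M w r where w: "w 0 = x" "r 0 = \<rho>" "w M = x0" "r M = \<rho>0"
        and wr: "\<forall>j\<le>M. w j \<in> \<Omega> \<and> 0 < r j \<and> 9 * r j \<le> bdist \<Omega> (w j) \<and> r j \<le> \<rho> * \<mu> ^ j \<and> \<rho> * \<mu> ^ j \<le> L * r j \<and>
          dist x (w j) \<le> 9 * \<rho> * \<mu> ^ j"
        and sub: "\<forall>j<M. \<exists>y \<sigma>. 0 < \<sigma> \<and> \<kappa> * r j \<le> \<sigma> \<and> \<kappa> * r (Suc j) \<le> \<sigma> \<and>
          ball y \<sigma> \<subseteq> ball (w j) (r j / (2 * sqrt n)) \<and> ball y \<sigma> \<subseteq> ball (w (Suc j)) (r (Suc j) / (2 * sqrt n))"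
        using chain[OF x \<rho>(1,2)] by blast
      define \<Gamma> where "\<Gamma> = (\<Sum>j\<le>M. ennreal ((\<mu> powr (\<alpha> / 2)) ^ j * r j powr (- Q)) * energy p u (w j) (r j))"
      define \<Phi> where "\<Phi> = far_energy p (Q - \<alpha>) \<Omega> \<tau> u x h"
      define A1 where "A1 = A x \<rho>"
      define b1 where "b1 = b x \<rho>"
      have \<Gamma>\<Phi>: "\<Gamma> \<le> ennreal C7 * (ennreal (h powr (- \<alpha>)) * \<Phi>)"
        unfolding \<Gamma>_def C7_def \<Phi>_def
        by (rule chain_energy_le_far_energy[where \<rho> = \<rho>])
          (use \<open>open \<Omega>\<close> u \<tau> \<alpha> L h \<rho> wr in \<open>auto simp: Q_def n_def\<close>)
      \<comment> \<open>The first ball of the chain is the local one, so the local energy is the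
        term \<open>j = 0\<close> of \<open>\<Gamma>\<close> and needs no separate
        treatment.\<close>
      have G0: "ennreal (\<rho> powr (- Q)) * energy p u x \<rho> \<le> \<Gamma>"
      proof -
        have "(\<lambda>j. ennreal ((\<mu> powr (\<alpha> / 2)) ^ j * r j powr (- Q)) * energy p u (w j) (r j)) 0 \<le> \<Gamma>"
          unfolding \<Gamma>_def by (intro member_le_sum) auto
        then show ?thesis by (simp add: w)
      qed
      have dA: "ennreal (norm (A1 - A x0 \<rho>0) powr p) \<le> ennreal C6 * \<Gamma>"
      proof -
        have "ennreal (norm (A (w 0) (r 0) - A (w M) (r M)) powr p) \<le> ennreal C6 * \<Gamma>"
          unfolding \<Gamma>_def
          by (rule C6(2)[OF u, where A = "\<lambda>j. A (w j) (r j)" and b = "\<lambda>j. b (w j) (r j)"]) (use Ab wr sub in blast)+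
        then show ?thesis by (simp add: w A1_def)
      qed
      have T: "ennreal (norm (u v - (A1 *v v + b1)) powr p)
          \<le> ennreal Ca * (ennreal (h powr (- p - n)) * near_energy p u v h) + ennreal Cb * (ennreal (h powr p) * \<Gamma>)"
        if v: "dist x v \<le> h" for v
      proof -
        have vb: "ball v h \<subseteq> ball x (\<rho> / (2 * sqrt n))"
        proof
          fix z assume "z \<in> ball v h"
          then show "z \<in> ball x (\<rho> / (2 * sqrt n))"
            using v dist_triangle[of x z v] unfolding \<rho>(4) by simp
        qed
        let ?J = "\<integral>\<^sup>+z\<in>ball v h. ennreal (norm (u z - (A1 *v z + b1)) powr p) \<partial>lborel"
        have "?J \<le> (\<integral>\<^sup>+z\<in>ball x (\<rho> / (2 * sqrt n)). ennreal (norm (u z - (A1 *v z + b1)) powr p) \<partial>lborel)"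
          using vb by (intro nn_integral_mono mult_left_mono) (auto simp: indicator_def)
        also have "\<dots> \<le> ennreal (C1 * \<rho> powr (- p - n)) * energy p u x \<rho>"
          unfolding A1_def b1_def by (rule Ab[OF \<open>0 < \<rho>\<close>])
        finally have J: "?J \<le> ennreal (C1 * \<rho> powr (- p - n)) * energy p u x \<rho>" .
        \<comment> \<open>The radius is \<open>h / 2\<close> because the averages run over the
          doubled ball, which becomes \<open>ball v h\<close>.\<close>
        have "ennreal (norm (u v - (A1 *v v + b1)) powr p) \<le>
            ennreal (C2 * (h / 2) powr (- p - n)) * near_energy p u v h + ennreal (C2 * (h / 2) powr (- n)) * ?J"
          using C2(2)[OF u, of "h / 2" A1 v b1] h A by (simp add: A1_def near_energy_def)
        also have "\<dots> \<le> ennreal (C2 * (h / 2) powr (- p - n)) * near_energy p u v h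
            + ennreal (C2 * (h / 2) powr (- n)) * (ennreal (C1 * \<rho> powr (- p - n)) * energy p u x \<rho>)"
          using J by (intro add_left_mono mult_left_mono) auto
        also have "C2 * (h / 2) powr (- p - n) = Ca * h powr (- p - n)"
        proof -
          have "(h / 2) powr (- p - n) = h powr (- p - n) / 2 powr (- p - n)" by (rule powr_divide)
          also have "(2::real) powr (- p - n) = 1 / 2 powr (p + n)" by (simp flip: powr_minus_divide)
          finally show ?thesis by (simp add: Ca_def)
        qed
        also have "ennreal (C2 * (h / 2) powr (- n)) * (ennreal (C1 * \<rho> powr (- p - n)) * energy p u x \<rho>)
            = ennreal (C2 * (h / 2) powr (- n) * (C1 * \<rho> powr (- p - n))) * energy p u x \<rho>"
          using C1 C2 by (simp add: ennreal_mult mult.assoc)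
        \<comment> \<open>As \<open>\<rho>\<close> is a fixed multiple of \<open>h\<close>, the
          factor can be traded for \<open>h powr p * \<rho> powr (- Q)\<close>, the form in which
          the drift along the chain appears too.\<close>
        also have "C2 * (h / 2) powr (- n) * (C1 * \<rho> powr (- p - n)) = Cb * h powr p * \<rho> powr (- Q)"
        proof -
          have "(h / 2) powr (- n) = h powr (- n) / 2 powr (- n)" by (rule powr_divide)
          also have "(2::real) powr (- n) = 1 / 2 powr n" by (rule powr_minus_divide)
          finally have 1: "(h / 2) powr (- n) = 2 powr n * h powr (- n)" by simp
          have 2: "\<rho> powr (- p - n) = \<rho> powr (p + n) * \<rho> powr (- Q)"
            unfolding powr_add[symmetric] by (simp add: Q_def)
          have "\<rho> powr (p + n) = (4 * sqrt n) powr (p + n) * h powr (p + n)"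
            unfolding \<rho>_def by (rule powr_mult)
          also have "h powr (p + n) = h powr p * h powr n" by (rule powr_add)
          finally have 3: "\<rho> powr (p + n) = (4 * sqrt n) powr (p + n) * (h powr p * h powr n)" .
          have "(h / 2) powr (- n) * \<rho> powr (- p - n) = c8 * h powr p * \<rho> powr (- Q) * (h powr (- n) * h powr n)"
            unfolding 1 2 3 c8_def by (simp only: ac_simps)
          moreover have "h powr (- n) * h powr n = 1" using h by (simp flip: powr_add)
          ultimately show ?thesis by (simp add: Cb_def)
        qed
        also have "ennreal (Cb * h powr p * \<rho> powr (- Q)) * energy p u x \<rho> = ennreal Cb * (ennreal (h powr p) * (ennreal (\<rho> powr (- Q)) * energy p u x \<rho>))"
          using pos by (simp add: ennreal_mult mult.assoc)
        also have "\<dots> \<le> ennreal Cb * (ennreal (h powr p) * \<Gamma>)"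
          using G0 by (intro mult_left_mono) auto
        also have "ennreal (Ca * h powr (- p - n)) * near_energy p u v h = ennreal Ca * (ennreal (h powr (- p - n)) * near_energy p u v h)"
          using pos by (simp add: ennreal_mult mult.assoc)
        finally show ?thesis by (simp add: add_left_mono)
      qed
      let ?a = "norm (u y - (A1 *v y + b1))" and ?b = "norm (u x - (A1 *v x + b1))" and ?d = "norm (A1 - A x0 \<rho>0)"
      \<comment> \<open>The translation \<open>b1\<close> cancels, and the last term is the drift of
        the matrix between the two ends of the chain.\<close>
      have "u y - u x - A x0 \<rho>0 *v (y - x) = (u y - (A1 *v y + b1)) - (u x - (A1 *v x + b1)) + (A1 - A x0 \<rho>0) *v (y - x)"
        by (simp add: matrix_vector_mult_diff_distrib matrix_vector_mult_diff_rdistrib)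
      then have "norm (u y - u x - A x0 \<rho>0 *v (y - x)) \<le> ?a + ?b + norm ((A1 - A x0 \<rho>0) *v (y - x))"
        using norm_triangle_mono[OF norm_triangle_ineq4 order_refl] by (simp only:)
      also have "norm ((A1 - A x0 \<rho>0) *v (y - x)) \<le> ?d * h"
        using norm_matrix_vector_mult_le[of "A1 - A x0 \<rho>0" "y - x"] by (simp add: h_def dist_norm norm_minus_commute)
      finally have "norm (u y - u x - A x0 \<rho>0 *v (y - x)) powr p \<le> (?a + ?b + ?d * h) powr p"
        using \<open>0 < p\<close> by (intro powr_mono2) auto
      also have "\<dots> \<le> 3 powr p * (?a powr p + ?b powr p + (?d * h) powr p)"
        using \<open>0 < p\<close> h by (intro add3_powr_le) auto
      also have "(?d * h) powr p = h powr p * ?d powr p" by (simp add: powr_mult mult.commute)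
      finally have "ennreal (norm (u y - u x - A x0 \<rho>0 *v (y - x)) powr p)
          \<le> ennreal (3 powr p * (?a powr p + ?b powr p + h powr p * ?d powr p))"
        by (rule ennreal_leI)
      also have "\<dots> = ennreal (3 powr p) * (ennreal (?a powr p) + ennreal (?b powr p) + ennreal (h powr p) * ennreal (?d powr p))"
        by (simp add: ennreal_mult)
      also have "\<dots> \<le> ennreal (3 powr p) * ((ennreal Ca * (ennreal (h powr (- p - n)) * near_energy p u y h) + ennreal Cb * (ennreal (h powr p) * \<Gamma>))
          + (ennreal Ca * (ennreal (h powr (- p - n)) * near_energy p u x h) + ennreal Cb * (ennreal (h powr p) * \<Gamma>)) + ennreal (h powr p) * (ennreal C6 * \<Gamma>))"
        using dA h by (intro mult_left_mono add_mono T) (auto simp: h_def)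
      also have "\<dots> = ennreal (3 powr p) * (ennreal Ca * (ennreal (h powr (- p - n)) * (near_energy p u x h + near_energy p u y h))
          + (2 * ennreal Cb + ennreal C6) * (ennreal (h powr p) * \<Gamma>))"
        by (simp add: algebra_simps mult_2)
      also have "\<dots> \<le> ennreal (3 powr p) * (ennreal Ca * (ennreal (h powr (- p - n)) * (near_energy p u x h + near_energy p u y h))
          + (2 * ennreal Cb + ennreal C6) * (ennreal (h powr p) * (ennreal C7 * (ennreal (h powr (- \<alpha>)) * \<Phi>))))"
        using \<Gamma>\<Phi> by (intro mult_left_mono add_left_mono) auto
      also have "\<dots> = ennreal (3 powr p) * (ennreal Ca * (ennreal (h powr (- p - n)) * (near_energy p u x h + near_energy p u y h))
          + ((2 * ennreal Cb + ennreal C6) * ennreal C7) * (ennreal (h powr p * h powr (- \<alpha>)) * \<Phi>))"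
        by (simp add: ennreal_mult ac_simps)
      also have "(2 * ennreal Cb + ennreal C6) * ennreal C7 = ennreal ((2 * Cb + C6) * C7)"
        using pos C6(1) \<open>C7 > 0\<close> by (simp add: ennreal_mult flip: ennreal_numeral)
      also have "h powr p * h powr (- \<alpha>) = h powr (p - \<alpha>)" by (simp flip: powr_add)
      also have "ennreal (3 powr p) * (ennreal Ca * (ennreal (h powr (- p - n)) * (near_energy p u x h + near_energy p u y h))
          + ennreal ((2 * Cb + C6) * C7) * (ennreal (h powr (p - \<alpha>)) * \<Phi>))
          \<le> ennreal (3 powr p) * (ennreal (Ca + (2 * Cb + C6) * C7) * (ennreal (h powr (- p - n)) * (near_energy p u x h + near_energy p u y h))
          + ennreal (Ca + (2 * Cb + C6) * C7) * (ennreal (h powr (p - \<alpha>)) * \<Phi>))"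
        using pos C6(1) \<open>C7 > 0\<close> by (intro mult_left_mono add_mono mult_right_mono ennreal_leI) auto
      also have "\<dots> = ennreal C * (ennreal (h powr (- p - n)) * (near_energy p u x h + near_energy p u y h) + ennreal (h powr (p - \<alpha>)) * \<Phi>)"
      proof -
        have "ennreal C = ennreal (3 powr p) * ennreal (Ca + (2 * Cb + C6) * C7)"
          unfolding C_def using pos C6(1) \<open>C7 > 0\<close> by (intro ennreal_mult) auto
        then show ?thesis by (simp only: distrib_left mult.assoc)
      qed
      finally show ?thesis unfolding \<Phi>_def h_def .
    qed
    then show ?thesis using A by blast
  qed
  show ?thesis
    by (rule that[OF \<open>C > 0\<close>], rule main[unfolded n_def Q_def])
qed

section \<open>Integration of the pointwise estimate\<close>

lemma nn_integral_lborel_translate: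
  fixes f :: "'a::euclidean_space \<Rightarrow> ennreal"
  assumes [measurable]: "f \<in> borel_measurable borel"
  shows "(\<integral>\<^sup>+y. f (c + y) \<partial>lborel) = (\<integral>\<^sup>+y. f y \<partial>lborel)"
proof -
  have "(\<integral>\<^sup>+y. f y \<partial>lborel) = (\<integral>\<^sup>+y. f y \<partial>(distr lborel borel ((+) c)))"
    by (simp add: lborel_distr_plus)
  also have "\<dots> = (\<integral>\<^sup>+y. f (c + y) \<partial>lborel)"
    by (subst nn_integral_distr) simp_all
  finally show ?thesis by simp
qed

lemma radial_integral_bound_at:
  assumes "0 < \<alpha>" "\<alpha> < Q"
  obtains C where "C > 0" "\<And>(x::real^'n) d. 0 < d \<Longrightarrow>
    (\<integral>\<^sup>+y. ennreal (dist x y powr (\<alpha> - real CARD('n)) * max (dist x y) d powr (- Q)) \<partial>lborel) \<le> ennreal (C * d powr (\<alpha> - Q))"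
proof -
  obtain C where C: "C > 0" "\<And>d. 0 < d \<Longrightarrow>
    (\<integral>\<^sup>+w. ennreal (norm w powr (\<alpha> - real CARD('n)) * max (norm w) d powr (- Q)) \<partial>(lborel :: (real^'n) measure)) \<le> ennreal (C * d powr (\<alpha> - Q))"
    using radial_integral_bound[OF assms, where 'n = 'n] by blast
  have "(\<integral>\<^sup>+y. ennreal (dist x y powr (\<alpha> - real CARD('n)) * max (dist x y) d powr (- Q)) \<partial>lborel) \<le> ennreal (C * d powr (\<alpha> - Q))"
    if "0 < d" for x :: "real^'n" and d
  proof -
    have "(\<integral>\<^sup>+y. ennreal (dist x y powr (\<alpha> - real CARD('n)) * max (dist x y) d powr (- Q)) \<partial>lborel)
        = (\<integral>\<^sup>+y. ennreal (dist x (x + y) powr (\<alpha> - real CARD('n)) * max (dist x (x + y)) d powr (- Q)) \<partial>lborel)"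
      by (rule nn_integral_lborel_translate[symmetric]) measurable
    then show ?thesis using C(2)[OF that] by (simp add: dist_norm)
  qed
  then show ?thesis using that C(1) by blast
qed

lemma decay_integral_bound_at:
  assumes "real CARD('n) < Q"
  obtains C where "C > 0" "\<And>(x::real^'n) d. 0 < d \<Longrightarrow>
    (\<integral>\<^sup>+y. ennreal (max (dist x y) d powr (- Q)) \<partial>lborel) \<le> ennreal (C * d powr (real CARD('n) - Q))"
proof -
  obtain C where C: "C > 0" "\<And>(x::real^'n) d. 0 < d \<Longrightarrow>
    (\<integral>\<^sup>+y. ennreal (dist x y powr (real CARD('n) - real CARD('n)) * max (dist x y) d powr (- Q)) \<partial>lborel) \<le> ennreal (C * d powr (real CARD('n) - Q))"
    using radial_integral_bound_at[of "real CARD('n)" Q, where 'n = 'n] assms by auto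
  have "(\<integral>\<^sup>+y. ennreal (max (dist x y) d powr (- Q)) \<partial>lborel)
      = (\<integral>\<^sup>+y. ennreal (dist x y powr (real CARD('n) - real CARD('n)) * max (dist x y) d powr (- Q)) \<partial>lborel)" for x :: "real^'n" and d
  proof (rule nn_integral_cong_AE)
    \<comment> \<open>The case of exponent 0 in the radial bound. The identity fails at
      \<open>y = x\<close>, where \<open>0 powr 0 = 0\<close>.\<close>
    show "AE y in lborel. ennreal (max (dist x y) d powr (- Q)) = ennreal (dist x y powr (real CARD('n) - real CARD('n)) * max (dist x y) d powr (- Q))"
      using AE_lborel_singleton[of x] by eventually_elim simp
  qed
  then show ?thesis using that C by simp
qed

lemma nn_integral_lborel_swap:
  fixes f :: "'a::euclidean_space \<Rightarrow> 'b::euclidean_space \<Rightarrow> ennreal"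
  assumes "(\<lambda>(x, y). f x y) \<in> borel_measurable (borel \<Otimes>\<^sub>M borel)"
  shows "(\<integral>\<^sup>+x. \<integral>\<^sup>+y. f x y \<partial>lborel \<partial>lborel) = (\<integral>\<^sup>+y. \<integral>\<^sup>+x. f x y \<partial>lborel \<partial>lborel)"
proof -
  have "sets (lborel \<Otimes>\<^sub>M lborel :: ('a \<times> 'b) measure) = sets (borel \<Otimes>\<^sub>M borel)"
    by (intro sets_pair_measure_cong) auto
  then have "case_prod f \<in> borel_measurable (lborel \<Otimes>\<^sub>M lborel)"
    using assms by (simp cong: measurable_cong_sets)
  then show ?thesis by (rule lborel_pair.Fubini'[symmetric])
qed

lemma nn_integral_lborel_rotate:
  fixes f :: "'a::euclidean_space \<Rightarrow> 'b::euclidean_space \<Rightarrow> 'c::euclidean_space \<Rightarrow> ennreal"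
  assumes m: "(\<lambda>(x, a, b). f x a b) \<in> borel_measurable (borel \<Otimes>\<^sub>M borel \<Otimes>\<^sub>M borel)"
  shows "(\<integral>\<^sup>+x. \<integral>\<^sup>+a. \<integral>\<^sup>+b. f x a b \<partial>lborel \<partial>lborel \<partial>lborel)
    = (\<integral>\<^sup>+a. \<integral>\<^sup>+b. \<integral>\<^sup>+x. f x a b \<partial>lborel \<partial>lborel \<partial>lborel)"
proof -
  have mm: "(\<lambda>z. f (i z) (j z) (k z)) \<in> borel_measurable M"
    if "i \<in> borel_measurable M" "j \<in> borel_measurable M" "k \<in> borel_measurable M"
    for i j k and M :: "'d measure"
    using measurable_compose[OF measurable_Pair[OF that(1) measurable_Pair[OF that(2,3)]] m] by simp
  have "(\<integral>\<^sup>+x. \<integral>\<^sup>+a. \<integral>\<^sup>+b. f x a b \<partial>lborel \<partial>lborel \<partial>lborel)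
      = (\<integral>\<^sup>+a. \<integral>\<^sup>+x. \<integral>\<^sup>+b. f x a b \<partial>lborel \<partial>lborel \<partial>lborel)"
  proof (rule nn_integral_lborel_swap)
    have "(\<lambda>(z, b). f (fst z) (snd z) b) \<in> borel_measurable ((borel \<Otimes>\<^sub>M borel) \<Otimes>\<^sub>M lborel)"
      using measurable_compose[OF _ m, of "\<lambda>(z, b). (fst z, snd z, b)"] by (simp add: split_beta')
    then have "(\<lambda>z. \<integral>\<^sup>+b. f (fst z) (snd z) b \<partial>lborel) \<in> borel_measurable (borel \<Otimes>\<^sub>M borel)"
      by (rule lborel.borel_measurable_nn_integral)
    then show "(\<lambda>(x, a). \<integral>\<^sup>+b. f x a b \<partial>lborel) \<in> borel_measurable (borel \<Otimes>\<^sub>M borel)"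
      by (simp add: split_beta')
  qed
  also have "\<dots> = (\<integral>\<^sup>+a. \<integral>\<^sup>+b. \<integral>\<^sup>+x. f x a b \<partial>lborel \<partial>lborel \<partial>lborel)"
  proof (rule nn_integral_cong, rule nn_integral_lborel_swap)
    fix a :: 'b
    show "(\<lambda>(x, b). f x a b) \<in> borel_measurable (borel \<Otimes>\<^sub>M borel)"
      using measurable_compose[OF _ m, of "\<lambda>(x, b). (x, a, b)"] by (simp add: split_beta')
  qed
  finally show ?thesis .
qed

text \<open>For \<open>k = n + s * p + p\<close>, the \<open>p\<close>-th power of the seminorm
  \<open>X_semi\<close> of a Borel field, with the domain of integration moved into the integrand so
  that orders of integration can be exchanged.\<close>

definition strain_energy :: "real \<Rightarrow> real \<Rightarrow> (real^'n) set \<Rightarrow> real \<Rightarrow> (real^'n \<Rightarrow> real^'n) \<Rightarrow> ennreal" where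
  "strain_energy p k \<Omega> \<tau> u = (\<integral>\<^sup>+a. \<integral>\<^sup>+b. ennreal (strain u a b powr p * dist a b powr (- k))
     * indicator (whitney_pairs \<Omega> \<tau>) (a, b) \<partial>lborel \<partial>lborel)"

definition pair_energy :: "real \<Rightarrow> (real^'n) set \<Rightarrow> real \<Rightarrow> (real^'n \<Rightarrow> real^'n) \<Rightarrow> real^'n \<Rightarrow> real^'n \<Rightarrow> ennreal" where
  "pair_energy p \<Omega> \<tau> u a b = ennreal (strain u a b powr p) * indicator (whitney_pairs \<Omega> \<tau>) (a, b)"

lemma pair_energy_measurable:
  assumes "open \<Omega>" and [measurable]: "u \<in> borel_measurable borel" "f \<in> borel_measurable M" "h \<in> borel_measurable M"
  shows "(\<lambda>z. pair_energy p \<Omega> \<tau> u (f z) (h z)) \<in> borel_measurable M"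
  using whitney_pairs_measurable[OF assms(1,3,4)] unfolding pair_energy_def by measurable

section \<open>The inequality for Borel fields\<close>

text \<open>Every term of the pointwise estimate is an integral over pairs against a kernel.
  Integrating out the remaining variables first leaves a power of the distance of the pair, and all
  exponents add up to the one in \<open>strain_energy\<close>.\<close>

lemma korn_lborel:
  fixes \<Omega> :: "(real^'n) set"
  assumes "john_domain \<Omega>" and p: "1 < p" and s: "0 < s" "s < 1"
    and \<tau>1: "0 < \<tau>1" "\<tau>1 < 1 / (36 * sqrt (real CARD('n)))" and \<tau>2: "3 / 5 \<le> \<tau>2"
  obtains c where "c > 0" "\<And>u. u \<in> borel_measurable borel \<Longrightarrow> \<exists>A0::real^'n^'n. transpose A0 = - A0 \<and>
     (\<integral>\<^sup>+x\<in>\<Omega>. (\<integral>\<^sup>+y\<in>ball x (\<tau>1 * bdist \<Omega> x).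
        ennreal (norm (u y - u x - A0 *v (y - x)) powr p / norm (y - x) powr (real CARD('n) + s * p)) \<partial>lborel) \<partial>lborel)
      \<le> ennreal c * strain_energy p (real CARD('n) + s * p + p) \<Omega> \<tau>2 u"
proof -
  define n where "n = real CARD('n)"
  define \<beta> where "\<beta> = (1 - s) * p"
  define e where "e = n + s * p"
  \<comment> \<open>\<open>Q1\<close> collects the powers of \<open>h\<close> in the near terms.
    \<open>Q2 + Q3\<close> is the exponent of the far kernel, divided so that both integrals
    converge: \<open>\<beta> / 2 < Q2\<close> for the one over \<open>y\<close>,
    \<open>n < Q3\<close> for the one over \<open>x\<close>.\<close>
  define Q1 where "Q1 = 2 * n + p + s * p"
  define Q2 where "Q2 = n + p - \<beta> / 2"
  define Q3 where "Q3 = n + p"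
  have n1: "n \<ge> 1" "sqrt n \<ge> 1" by (auto simp: n_def Suc_leI)
  have sp: "0 < s * p" "s * p < p" using s p by auto
  have \<beta>: "0 < \<beta>" "\<beta> = p - s * p" using s p by (auto simp: \<beta>_def algebra_simps)
  have "open \<Omega>" using assms(1) by (simp add: john_domain_def)
  have \<tau>1': "\<tau>1 < 1 / 36"
  proof -
    have "1 / (36 * sqrt n) \<le> 1 / 36" using n1 by (intro frac_le) auto
    then show ?thesis using \<tau>1 unfolding n_def[symmetric] by linarith
  qed
  obtain C where C: "C > 0" "\<And>u. u \<in> borel_measurable borel \<Longrightarrow> \<exists>A0::real^'n^'n. transpose A0 = - A0 \<and>
      (\<forall>x\<in>\<Omega>. \<forall>y. x \<noteq> y \<longrightarrow> 36 * sqrt n * dist x y \<le> bdist \<Omega> x \<longrightarrow>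
        ennreal (norm (u y - u x - A0 *v (y - x)) powr p) \<le> ennreal C *
          (ennreal (dist x y powr (- p - n)) * (near_energy p u x (dist x y) + near_energy p u y (dist x y))
           + ennreal (dist x y powr (p - \<beta> / 2)) * far_energy p (2 * p + 2 * n - \<beta> / 2) \<Omega> \<tau>2 u x (dist x y)))"
  proof -
    have "0 < p" "0 < \<beta> / 2" "\<beta> / 2 < 2 * p + 2 * real CARD('n)"
      using p \<beta> sp by auto
    from korn_pointwise[OF assms(1) this(1) \<tau>2 this(2,3)] that show ?thesis
      unfolding n_def by blast
  qed
  have "real CARD('n) < Q1" "real CARD('n) < Q3" using sp p n1 by (auto simp: Q1_def Q3_def n_def)
  then obtain C1 C3 where
    C1: "C1 > 0" "\<And>(x::real^'n) d. 0 < d \<Longrightarrow> (\<integral>\<^sup>+y. ennreal (max (dist x y) d powr (- Q1)) \<partial>lborel) \<le> ennreal (C1 * d powr (n - Q1))" and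
    C3: "C3 > 0" "\<And>(x::real^'n) d. 0 < d \<Longrightarrow> (\<integral>\<^sup>+y. ennreal (max (dist x y) d powr (- Q3)) \<partial>lborel) \<le> ennreal (C3 * d powr (n - Q3))"
    unfolding n_def by (metis decay_integral_bound_at)
  have "0 < \<beta> / 2" "\<beta> / 2 < Q2" using \<beta> sp n1(1) p unfolding Q2_def by linarith+
  then obtain C2 where C2: "C2 > 0" "\<And>(x::real^'n) d. 0 < d \<Longrightarrow>
      (\<integral>\<^sup>+y. ennreal (dist x y powr (\<beta> / 2 - n) * max (dist x y) d powr (- Q2)) \<partial>lborel) \<le> ennreal (C2 * d powr (\<beta> / 2 - Q2))"
    unfolding n_def by (blast intro: radial_integral_bound_at[where 'n = 'n])
  have "0 \<le> Q2" using \<open>0 < \<beta> / 2\<close> \<open>\<beta> / 2 < Q2\<close> by linarith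
  define c where "c = C * (2 * C1 + C2 * C3)"
  have "c > 0" using C C1 C2 C3 by (simp add: c_def add_pos_pos)
  have main: "\<exists>A0::real^'n^'n. transpose A0 = - A0 \<and>
     (\<integral>\<^sup>+x\<in>\<Omega>. (\<integral>\<^sup>+y\<in>ball x (\<tau>1 * bdist \<Omega> x).
        ennreal (norm (u y - u x - A0 *v (y - x)) powr p / norm (y - x) powr e) \<partial>lborel) \<partial>lborel)
      \<le> ennreal c * strain_energy p (e + p) \<Omega> \<tau>2 u"
    if u[measurable]: "u \<in> borel_measurable borel" for u
  proof -
    obtain A0 :: "real^'n^'n" where A0: "transpose A0 = - A0" and pw: "\<And>x y. x \<in> \<Omega> \<Longrightarrow> x \<noteq> y \<Longrightarrow> 36 * sqrt n * dist x y \<le> bdist \<Omega> x \<Longrightarrow>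
        ennreal (norm (u y - u x - A0 *v (y - x)) powr p) \<le> ennreal C *
          (ennreal (dist x y powr (- p - n)) * (near_energy p u x (dist x y) + near_energy p u y (dist x y))
           + ennreal (dist x y powr (p - \<beta> / 2)) * far_energy p (2 * p + 2 * n - \<beta> / 2) \<Omega> \<tau>2 u x (dist x y))"
      using C(2)[OF u] by blast
    define g where "g = pair_energy p \<Omega> \<tau>2 u"
    note gm[measurable] = pair_energy_measurable[OF \<open>open \<Omega>\<close> u, of _ _ _ p \<tau>2, folded g_def]
    \<comment> \<open>The kernel integrals are bounded only for \<open>0 < dist a b\<close>; the
      diagonal contributes nothing.\<close>
    have g0: "g a a = 0" for a using p by (simp add: g_def pair_energy_def)
    define T1 where "T1 x y = (\<integral>\<^sup>+z. g x z * ennreal (max (dist x y) (dist x z) powr (- Q1)) \<partial>lborel)" for x y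
    define T2 where "T2 x y = (\<integral>\<^sup>+z. g y z * ennreal (max (dist y x) (dist y z) powr (- Q1)) \<partial>lborel)" for x y
    \<comment> \<open>The three-fold maximum in the far kernel is split into a factor with
      \<open>dist x y\<close> and a factor with \<open>dist a x\<close>. So \<open>y\<close> can be
      integrated out first, then \<open>x\<close>, each by a one-variable estimate.\<close>
    define T3 where "T3 x y = (\<integral>\<^sup>+a. \<integral>\<^sup>+b. g a b * (ennreal (dist x y powr (\<beta> / 2 - n) * max (dist x y) (dist a b) powr (- Q2))
        * ennreal (max (dist a x) (dist a b) powr (- Q3))) \<partial>lborel \<partial>lborel)" for x y
    have Tm: "(\<lambda>y. T1 x y) \<in> borel_measurable lborel" "(\<lambda>y. T2 x y) \<in> borel_measurable lborel" "(\<lambda>y. T3 x y) \<in> borel_measurable lborel" for x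
      unfolding T1_def T2_def T3_def by measurable
    have Tmm: "(\<lambda>x. \<integral>\<^sup>+y. T1 x y \<partial>lborel) \<in> borel_measurable lborel" "(\<lambda>x. \<integral>\<^sup>+y. T2 x y \<partial>lborel) \<in> borel_measurable lborel"
      "(\<lambda>x. \<integral>\<^sup>+y. T3 x y \<partial>lborel) \<in> borel_measurable lborel"
      unfolding T1_def T2_def T3_def by measurable
    define S where "S = strain_energy p (e + p) \<Omega> \<tau>2 u"
    have S: "S = (\<integral>\<^sup>+a. \<integral>\<^sup>+b. g a b * ennreal (dist a b powr (- (e + p))) \<partial>lborel \<partial>lborel)"
      unfolding S_def strain_energy_def g_def pair_energy_def by (simp add: ennreal_mult ac_simps)
    have cS: "(\<integral>\<^sup>+a. \<integral>\<^sup>+b. g a b * ennreal (k * dist a b powr (- (e + p))) \<partial>lborel \<partial>lborel) = ennreal k * S" if "0 \<le> k" for k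
    proof -
      have "(\<integral>\<^sup>+a. \<integral>\<^sup>+b. g a b * ennreal (k * dist a b powr (- (e + p))) \<partial>lborel \<partial>lborel)
          = (\<integral>\<^sup>+a. \<integral>\<^sup>+b. ennreal k * (g a b * ennreal (dist a b powr (- (e + p)))) \<partial>lborel \<partial>lborel)"
        using that by (simp add: ennreal_mult ac_simps)
      also have "\<dots> = (\<integral>\<^sup>+a. ennreal k * (\<integral>\<^sup>+b. g a b * ennreal (dist a b powr (- (e + p))) \<partial>lborel) \<partial>lborel)"
        by (intro nn_integral_cong nn_integral_cmult) measurable
      also have "\<dots> = ennreal k * S"
        unfolding S by (intro nn_integral_cmult) measurable
      finally show ?thesis .
    qed
    have k1: "g a b * (\<integral>\<^sup>+y. ennreal (max (dist a y) (dist a b) powr (- Q1)) \<partial>lborel) \<le> g a b * ennreal (C1 * dist a b powr (- (e + p)))" for a b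
    proof (cases "a = b")
      case False
      have "n - Q1 = - (e + p)" by (simp add: Q1_def e_def)
      then show ?thesis using C1(2)[of "dist a b" a] False by (intro mult_left_mono) auto
    qed (simp add: g0)
    have I1: "(\<integral>\<^sup>+x. \<integral>\<^sup>+y. T1 x y \<partial>lborel \<partial>lborel) \<le> ennreal C1 * S"
    proof -
      have T1i: "(\<integral>\<^sup>+y. T1 x y \<partial>lborel) = (\<integral>\<^sup>+z. g x z * (\<integral>\<^sup>+y. ennreal (max (dist x y) (dist x z) powr (- Q1)) \<partial>lborel) \<partial>lborel)" for x
      proof -
        have "(\<integral>\<^sup>+y. T1 x y \<partial>lborel) = (\<integral>\<^sup>+z. \<integral>\<^sup>+y. g x z * ennreal (max (dist x y) (dist x z) powr (- Q1)) \<partial>lborel \<partial>lborel)"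
          unfolding T1_def by (rule nn_integral_lborel_swap) measurable
        also have "\<dots> = (\<integral>\<^sup>+z. g x z * (\<integral>\<^sup>+y. ennreal (max (dist x y) (dist x z) powr (- Q1)) \<partial>lborel) \<partial>lborel)"
          by (intro nn_integral_cong nn_integral_cmult) measurable
        finally show ?thesis .
      qed
      have "(\<integral>\<^sup>+x. \<integral>\<^sup>+y. T1 x y \<partial>lborel \<partial>lborel) \<le> (\<integral>\<^sup>+x. \<integral>\<^sup>+z. g x z * ennreal (C1 * dist x z powr (- (e + p))) \<partial>lborel \<partial>lborel)"
        unfolding T1i by (intro nn_integral_mono k1)
      then show ?thesis using cS[of C1] C1(1) by simp
    qed
    have I2: "(\<integral>\<^sup>+x. \<integral>\<^sup>+y. T2 x y \<partial>lborel \<partial>lborel) \<le> ennreal C1 * S"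
    proof -
      \<comment> \<open>Here the kernel is centred at \<open>y\<close>, so \<open>x\<close> is the
        variable to integrate out and \<open>y, z\<close> is the pair that remains.\<close>
      have "(\<integral>\<^sup>+x. \<integral>\<^sup>+y. T2 x y \<partial>lborel \<partial>lborel) = (\<integral>\<^sup>+y. \<integral>\<^sup>+z. \<integral>\<^sup>+x. g y z * ennreal (max (dist y x) (dist y z) powr (- Q1)) \<partial>lborel \<partial>lborel \<partial>lborel)"
        unfolding T2_def by (rule nn_integral_lborel_rotate) measurable
      also have "\<dots> = (\<integral>\<^sup>+y. \<integral>\<^sup>+z. g y z * (\<integral>\<^sup>+x. ennreal (max (dist y x) (dist y z) powr (- Q1)) \<partial>lborel) \<partial>lborel \<partial>lborel)"
        by (intro nn_integral_cong nn_integral_cmult) measurable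
      also have "\<dots> \<le> (\<integral>\<^sup>+y. \<integral>\<^sup>+z. g y z * ennreal (C1 * dist y z powr (- (e + p))) \<partial>lborel \<partial>lborel)"
        by (intro nn_integral_mono k1)
      finally show ?thesis using cS[of C1] C1(1) by simp
    qed
    have I3: "(\<integral>\<^sup>+x. \<integral>\<^sup>+y. T3 x y \<partial>lborel \<partial>lborel) \<le> ennreal (C2 * C3) * S"
    proof -
      define K where "K x y d = ennreal (dist x y powr (\<beta> / 2 - n) * max (dist x y) d powr (- Q2))" for x y :: "real^'n" and d
      define k where "k a x d = ennreal (max (dist a x) d powr (- Q3))" for a x :: "real^'n" and d
      have [measurable]: "(\<lambda>z. K (f z) (f' z) (r z)) \<in> borel_measurable M" "(\<lambda>z. k (f z) (f' z) (r z)) \<in> borel_measurable M"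
        if [measurable]: "f \<in> borel_measurable M" "f' \<in> borel_measurable M" "r \<in> borel_measurable M"
        for f f' r and M :: "((real^'n) \<times> (real^'n) \<times> (real^'n)) measure"
        unfolding K_def k_def by measurable
      have [measurable]: "(\<lambda>z. K (f z) (f' z) (r z)) \<in> borel_measurable M" "(\<lambda>z. k (f z) (f' z) (r z)) \<in> borel_measurable M"
        if [measurable]: "f \<in> borel_measurable M" "f' \<in> borel_measurable M" "r \<in> borel_measurable M"
        for f f' r and M :: "(real^'n) measure"
        unfolding K_def k_def by measurable
      have one: "(\<integral>\<^sup>+y. T3 x y \<partial>lborel) \<le> (\<integral>\<^sup>+a. \<integral>\<^sup>+b. g a b * (ennreal (C2 * dist a b powr (\<beta> / 2 - Q2)) * k a x (dist a b)) \<partial>lborel \<partial>lborel)" for x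
      proof -
        have "(\<integral>\<^sup>+y. T3 x y \<partial>lborel) = (\<integral>\<^sup>+a. \<integral>\<^sup>+b. \<integral>\<^sup>+y. g a b * (K x y (dist a b) * k a x (dist a b)) \<partial>lborel \<partial>lborel \<partial>lborel)"
          unfolding T3_def K_def[symmetric] k_def[symmetric] by (rule nn_integral_lborel_rotate) measurable
        also have "\<dots> = (\<integral>\<^sup>+a. \<integral>\<^sup>+b. (g a b * k a x (dist a b)) * (\<integral>\<^sup>+y. K x y (dist a b) \<partial>lborel) \<partial>lborel \<partial>lborel)"
        proof (intro nn_integral_cong)
          fix a b
          have "(\<integral>\<^sup>+y. g a b * (K x y (dist a b) * k a x (dist a b)) \<partial>lborel) = (\<integral>\<^sup>+y. (g a b * k a x (dist a b)) * K x y (dist a b) \<partial>lborel)"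
            by (simp add: ac_simps)
          also have "\<dots> = (g a b * k a x (dist a b)) * (\<integral>\<^sup>+y. K x y (dist a b) \<partial>lborel)"
            by (intro nn_integral_cmult) measurable
          finally show "(\<integral>\<^sup>+y. g a b * (K x y (dist a b) * k a x (dist a b)) \<partial>lborel) = (g a b * k a x (dist a b)) * (\<integral>\<^sup>+y. K x y (dist a b) \<partial>lborel)" .
        qed
        also have "\<dots> \<le> (\<integral>\<^sup>+a. \<integral>\<^sup>+b. g a b * (ennreal (C2 * dist a b powr (\<beta> / 2 - Q2)) * k a x (dist a b)) \<partial>lborel \<partial>lborel)"
        proof (intro nn_integral_mono)
          fix a b
          show "(g a b * k a x (dist a b)) * (\<integral>\<^sup>+y. K x y (dist a b) \<partial>lborel) \<le> g a b * (ennreal (C2 * dist a b powr (\<beta> / 2 - Q2)) * k a x (dist a b))"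
          proof (cases "a = b")
            case False
            then have "(\<integral>\<^sup>+y. K x y (dist a b) \<partial>lborel) \<le> ennreal (C2 * dist a b powr (\<beta> / 2 - Q2))"
              unfolding K_def by (intro C2(2)) auto
            then have "(g a b * k a x (dist a b)) * (\<integral>\<^sup>+y. K x y (dist a b) \<partial>lborel) \<le> (g a b * k a x (dist a b)) * ennreal (C2 * dist a b powr (\<beta> / 2 - Q2))"
              by (intro mult_left_mono) auto
            then show ?thesis by (simp add: ac_simps)
          qed (simp add: g0)
        qed
        finally show ?thesis .
      qed
      have "(\<integral>\<^sup>+x. \<integral>\<^sup>+y. T3 x y \<partial>lborel \<partial>lborel)
          \<le> (\<integral>\<^sup>+x. \<integral>\<^sup>+a. \<integral>\<^sup>+b. g a b * (ennreal (C2 * dist a b powr (\<beta> / 2 - Q2)) * k a x (dist a b)) \<partial>lborel \<partial>lborel \<partial>lborel)"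
        by (intro nn_integral_mono one)
      also have "\<dots> = (\<integral>\<^sup>+a. \<integral>\<^sup>+b. \<integral>\<^sup>+x. g a b * (ennreal (C2 * dist a b powr (\<beta> / 2 - Q2)) * k a x (dist a b)) \<partial>lborel \<partial>lborel \<partial>lborel)"
        by (rule nn_integral_lborel_rotate) measurable
      also have "\<dots> = (\<integral>\<^sup>+a. \<integral>\<^sup>+b. (g a b * ennreal (C2 * dist a b powr (\<beta> / 2 - Q2))) * (\<integral>\<^sup>+x. k a x (dist a b) \<partial>lborel) \<partial>lborel \<partial>lborel)"
        unfolding mult.assoc[symmetric] by (intro nn_integral_cong nn_integral_cmult) measurable
      also have "\<dots> \<le> (\<integral>\<^sup>+a. \<integral>\<^sup>+b. g a b * ennreal (C2 * C3 * dist a b powr (- (e + p))) \<partial>lborel \<partial>lborel)"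
      proof (intro nn_integral_mono)
        fix a b
        show "(g a b * ennreal (C2 * dist a b powr (\<beta> / 2 - Q2))) * (\<integral>\<^sup>+x. k a x (dist a b) \<partial>lborel) \<le> g a b * ennreal (C2 * C3 * dist a b powr (- (e + p)))"
        proof (cases "a = b")
          case False
          then have "(\<integral>\<^sup>+x. k a x (dist a b) \<partial>lborel) \<le> ennreal (C3 * dist a b powr (n - Q3))"
            unfolding k_def by (intro C3(2)) auto
          then have "(g a b * ennreal (C2 * dist a b powr (\<beta> / 2 - Q2))) * (\<integral>\<^sup>+x. k a x (dist a b) \<partial>lborel)
              \<le> (g a b * ennreal (C2 * dist a b powr (\<beta> / 2 - Q2))) * ennreal (C3 * dist a b powr (n - Q3))"
            by (intro mult_left_mono) auto
          also have "\<dots> = g a b * ennreal (C2 * dist a b powr (\<beta> / 2 - Q2) * (C3 * dist a b powr (n - Q3)))"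
            using C2(1) C3(1) by (simp add: ennreal_mult mult.assoc)
          also have "C2 * dist a b powr (\<beta> / 2 - Q2) * (C3 * dist a b powr (n - Q3)) = C2 * C3 * (dist a b powr (\<beta> / 2 - Q2) * dist a b powr (n - Q3))"
            by simp
          also have "dist a b powr (\<beta> / 2 - Q2) * dist a b powr (n - Q3) = dist a b powr (- (e + p))"
          proof -
            have "\<beta> / 2 - Q2 + (n - Q3) = - (e + p)"
              unfolding Q2_def Q3_def e_def using \<beta>(2) by argo
            then show ?thesis unfolding powr_add[symmetric] by (simp only:)
          qed
          finally show ?thesis .
        qed (simp add: g0)
      qed
      finally show ?thesis using cS[of "C2 * C3"] C2(1) C3(1) by simp
    qed
    have pt: "ennreal (norm (u y - u x - A0 *v (y - x)) powr p / norm (y - x) powr e) \<le> ennreal C * (T1 x y + T2 x y + T3 x y)"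
      if x: "x \<in> \<Omega>" and y: "y \<in> ball x (\<tau>1 * bdist \<Omega> x)" for x y
    proof (cases "x = y")
      case False
      define h where "h = dist x y"
      have h: "0 < h" "h < \<tau>1 * bdist \<Omega> x" using False y by (auto simp: h_def)
      have \<delta>0: "0 < bdist \<Omega> x" using h \<tau>1 by (metis less_trans zero_less_mult_pos)
      have \<delta>: "36 * sqrt n * h \<le> bdist \<Omega> x"
      proof -
        have "36 * sqrt n * h \<le> 36 * sqrt n * (\<tau>1 * bdist \<Omega> x)" using h n1 by (intro mult_left_mono) auto
        also have "\<dots> = (\<tau>1 * (36 * sqrt n)) * bdist \<Omega> x" by simp
        also have "\<dots> \<le> 1 * bdist \<Omega> x"
          using \<tau>1 n1 \<delta>0 unfolding n_def[symmetric] by (intro mult_right_mono) (auto simp: less_divide_eq)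
        finally show ?thesis by simp
      qed
      have h36: "36 * h < bdist \<Omega> x"
        using h \<tau>1' \<delta>0 mult_strict_right_mono[OF \<tau>1' \<delta>0] by simp
      have "h < bdist \<Omega> x" and \<delta>x: "35 * h < bdist \<Omega> x" using h36 h(1) by linarith+
      then have "y \<in> ball x (bdist \<Omega> x)" by (simp add: h_def)
      then have y\<Omega>: "y \<in> \<Omega>" using ball_bdist_subset[OF x] by blast
      \<comment> \<open>Moving from \<open>x\<close> to \<open>y\<close> costs one \<open>h\<close>
        of the available \<open>36 * h\<close>. Around both points the pairs closer than
        \<open>h\<close> are then Whitney pairs, so both near energies are seen by the right-hand
        side.\<close>
      have "bdist \<Omega> x \<le> bdist \<Omega> y + h" unfolding bdist_def h_def by (rule infdist_triangle)
      then have \<delta>y: "35 * h < bdist \<Omega> y" using h36 by linarith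
      have wp: "(v, z) \<in> whitney_pairs \<Omega> \<tau>2" if "v \<in> \<Omega>" "35 * h < bdist \<Omega> v" "dist v z < h" for v z
      proof -
        have "h \<le> (3 / 5) * (35 * h)" using h by simp
        also have "\<dots> \<le> \<tau>2 * bdist \<Omega> v" using that \<tau>2 h by (intro mult_mono) auto
        finally show ?thesis using that by (simp add: whitney_pairs_def)
      qed
      have near: "ennreal (h powr (- p - n)) * near_energy p u v h * ennreal (h powr (- e))
          \<le> (\<integral>\<^sup>+z. g v z * ennreal (max h (dist v z) powr (- Q1)) \<partial>lborel)" if v: "v \<in> \<Omega>" "35 * h < bdist \<Omega> v" for v
      proof -
        have "ennreal (h powr (- p - n)) * near_energy p u v h * ennreal (h powr (- e)) = ennreal (h powr (- p - n) * h powr (- e)) * near_energy p u v h"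
          by (simp add: ennreal_mult ac_simps)
        also have "h powr (- p - n) * h powr (- e) = h powr (- Q1)"
        proof -
          have "- p - n + - e = - Q1" unfolding Q1_def e_def by argo
          then show ?thesis unfolding powr_add[symmetric] by (simp only:)
        qed
        also have "ennreal (h powr (- Q1)) * near_energy p u v h = (\<integral>\<^sup>+z. ennreal (h powr (- Q1)) * (ennreal (strain u v z powr p) * indicator (ball v h) z) \<partial>lborel)"
          unfolding near_energy_def by (intro nn_integral_cmult[symmetric]) measurable
        also have "\<dots> \<le> (\<integral>\<^sup>+z. g v z * ennreal (max h (dist v z) powr (- Q1)) \<partial>lborel)"
        proof (intro nn_integral_mono)
          fix z
          show "ennreal (h powr (- Q1)) * (ennreal (strain u v z powr p) * indicator (ball v h) z) \<le> g v z * ennreal (max h (dist v z) powr (- Q1))"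
          proof (cases "dist v z < h")
            case True
            then show ?thesis using wp[OF v True] by (simp add: g_def pair_energy_def max_def mult.commute)
          qed simp
        qed
        finally show ?thesis .
      qed
      have n1': "ennreal (h powr (- p - n)) * near_energy p u x h * ennreal (h powr (- e)) \<le> T1 x y"
        using near[OF x \<delta>x] by (simp add: T1_def h_def)
      have n2': "ennreal (h powr (- p - n)) * near_energy p u y h * ennreal (h powr (- e)) \<le> T2 x y"
        using near[OF y\<Omega> \<delta>y] by (simp add: T2_def h_def dist_commute)
      have f3: "ennreal (h powr (p - \<beta> / 2)) * far_energy p (2 * p + 2 * n - \<beta> / 2) \<Omega> \<tau>2 u x h * ennreal (h powr (- e)) \<le> T3 x y"
      proof -
        let ?q = "2 * p + 2 * n - \<beta> / 2"
        have "ennreal (h powr (p - \<beta> / 2)) * far_energy p ?q \<Omega> \<tau>2 u x h * ennreal (h powr (- e))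
            = ennreal (h powr (p - \<beta> / 2) * h powr (- e)) * far_energy p ?q \<Omega> \<tau>2 u x h"
          by (simp add: ennreal_mult ac_simps)
        also have "h powr (p - \<beta> / 2) * h powr (- e) = h powr (\<beta> / 2 - n)"
        proof -
          have "p - \<beta> / 2 + - e = \<beta> / 2 - n" unfolding e_def using \<beta>(2) by argo
          then show ?thesis unfolding powr_add[symmetric] by (simp only:)
        qed
        also have "ennreal (h powr (\<beta> / 2 - n)) * far_energy p ?q \<Omega> \<tau>2 u x h
            = ennreal (h powr (\<beta> / 2 - n)) * (\<integral>\<^sup>+a. \<integral>\<^sup>+b. g a b * ennreal (max h (max (dist a b) (dist a x)) powr (- ?q)) \<partial>lborel \<partial>lborel)"
          unfolding far_energy_def g_def pair_energy_def by (simp add: ennreal_mult ac_simps)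
        also have "\<dots> = (\<integral>\<^sup>+a. ennreal (h powr (\<beta> / 2 - n)) * (\<integral>\<^sup>+b. g a b * ennreal (max h (max (dist a b) (dist a x)) powr (- ?q)) \<partial>lborel) \<partial>lborel)"
          by (intro nn_integral_cmult[symmetric]) measurable
        also have "\<dots> = (\<integral>\<^sup>+a. \<integral>\<^sup>+b. ennreal (h powr (\<beta> / 2 - n)) * (g a b * ennreal (max h (max (dist a b) (dist a x)) powr (- ?q))) \<partial>lborel \<partial>lborel)"
          by (intro nn_integral_cong nn_integral_cmult[symmetric]) measurable
        also have "\<dots> \<le> T3 x y"
          unfolding T3_def h_def[symmetric]
        proof (intro nn_integral_mono)
          fix a b
          let ?m = "max h (max (dist a b) (dist a x))"
          have "?m powr (- ?q) = ?m powr (- Q2) * ?m powr (- Q3)"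
          proof -
            have "- Q2 + - Q3 = - ?q" unfolding Q2_def Q3_def by argo
            then show ?thesis unfolding powr_add[symmetric] by (simp only:)
          qed
          \<comment> \<open>Omitting an entry from the maximum makes it smaller and its negative
            power larger; \<open>a \<noteq> b\<close> keeps the smaller maxima positive.\<close>
          also have "\<dots> \<le> max h (dist a b) powr (- Q2) * max (dist a x) (dist a b) powr (- Q3)" if "a \<noteq> b"
          proof (intro mult_mono powr_mono2')
            have "0 < dist a b" using that by simp
            then show "0 < max (dist a x) (dist a b)" by (rule less_max_iff_disj[THEN iffD2, OF disjI2])
          qed (use h \<open>0 \<le> Q2\<close> p n1 in \<open>auto simp: Q3_def\<close>)
          finally have *: "?m powr (- ?q) \<le> max h (dist a b) powr (- Q2) * max (dist a x) (dist a b) powr (- Q3)" if "a \<noteq> b"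
            using that by blast
          show "ennreal (h powr (\<beta> / 2 - n)) * (g a b * ennreal (?m powr (- ?q)))
              \<le> g a b * (ennreal (h powr (\<beta> / 2 - n) * max h (dist a b) powr (- Q2)) * ennreal (max (dist a x) (dist a b) powr (- Q3)))"
          proof (cases "a = b")
            case False
            have "ennreal (h powr (\<beta> / 2 - n)) * (g a b * ennreal (?m powr (- ?q))) = g a b * (ennreal (h powr (\<beta> / 2 - n)) * ennreal (?m powr (- ?q)))"
              by (simp only: ac_simps)
            also have "\<dots> \<le> g a b * (ennreal (h powr (\<beta> / 2 - n)) * ennreal (max h (dist a b) powr (- Q2) * max (dist a x) (dist a b) powr (- Q3)))"
              using *[OF False] by (intro mult_left_mono ennreal_leI) auto
            finally show ?thesis by (simp add: ennreal_mult mult.assoc)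
          qed (simp add: g0)
        qed
        finally show ?thesis .
      qed
      have "ennreal (norm (u y - u x - A0 *v (y - x)) powr p / norm (y - x) powr e) = ennreal (norm (u y - u x - A0 *v (y - x)) powr p) * ennreal (h powr (- e))"
        by (simp add: h_def dist_norm norm_minus_commute powr_minus divide_inverse ennreal_mult)
      also have "\<dots> \<le> (ennreal C * (ennreal (h powr (- p - n)) * (near_energy p u x h + near_energy p u y h)
           + ennreal (h powr (p - \<beta> / 2)) * far_energy p (2 * p + 2 * n - \<beta> / 2) \<Omega> \<tau>2 u x h)) * ennreal (h powr (- e))"
        using pw[OF x False] \<delta> unfolding h_def by (intro mult_right_mono) auto
      also have "\<dots> = ennreal C * (ennreal (h powr (- p - n)) * near_energy p u x h * ennreal (h powr (- e))
          + ennreal (h powr (- p - n)) * near_energy p u y h * ennreal (h powr (- e))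
          + ennreal (h powr (p - \<beta> / 2)) * far_energy p (2 * p + 2 * n - \<beta> / 2) \<Omega> \<tau>2 u x h * ennreal (h powr (- e)))"
        by (simp only: distrib_left distrib_right mult.assoc)
      also have "\<dots> \<le> ennreal C * (T1 x y + T2 x y + T3 x y)"
        by (intro mult_left_mono add_mono n1' n2' f3) auto
      finally show ?thesis .
    qed (use p in simp)
    have "(\<integral>\<^sup>+x\<in>\<Omega>. (\<integral>\<^sup>+y\<in>ball x (\<tau>1 * bdist \<Omega> x).
        ennreal (norm (u y - u x - A0 *v (y - x)) powr p / norm (y - x) powr e) \<partial>lborel) \<partial>lborel)
       \<le> (\<integral>\<^sup>+x. \<integral>\<^sup>+y. ennreal C * (T1 x y + T2 x y + T3 x y) \<partial>lborel \<partial>lborel)"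
    proof (intro nn_integral_mono)
      fix x
      have "(\<integral>\<^sup>+y\<in>ball x (\<tau>1 * bdist \<Omega> x). ennreal (norm (u y - u x - A0 *v (y - x)) powr p / norm (y - x) powr e) \<partial>lborel)
          \<le> (\<integral>\<^sup>+y. ennreal C * (T1 x y + T2 x y + T3 x y) \<partial>lborel)" if "x \<in> \<Omega>"
      proof (intro nn_integral_mono)
        fix y
        show "ennreal (norm (u y - u x - A0 *v (y - x)) powr p / norm (y - x) powr e) * indicator (ball x (\<tau>1 * bdist \<Omega> x)) y
            \<le> ennreal C * (T1 x y + T2 x y + T3 x y)"
          using pt[OF that, of y] by (cases "y \<in> ball x (\<tau>1 * bdist \<Omega> x)") simp_all
      qed
      then show "(\<integral>\<^sup>+y\<in>ball x (\<tau>1 * bdist \<Omega> x). ennreal (norm (u y - u x - A0 *v (y - x)) powr p / norm (y - x) powr e) \<partial>lborel) * indicator \<Omega> x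
          \<le> (\<integral>\<^sup>+y. ennreal C * (T1 x y + T2 x y + T3 x y) \<partial>lborel)"
        by (cases "x \<in> \<Omega>") simp_all
    qed
    also have "\<dots> = ennreal C * ((\<integral>\<^sup>+x. \<integral>\<^sup>+y. T1 x y \<partial>lborel \<partial>lborel) + (\<integral>\<^sup>+x. \<integral>\<^sup>+y. T2 x y \<partial>lborel \<partial>lborel) + (\<integral>\<^sup>+x. \<integral>\<^sup>+y. T3 x y \<partial>lborel \<partial>lborel))"
      using Tm Tmm by (simp add: nn_integral_cmult nn_integral_add)
    also have "\<dots> \<le> ennreal C * (ennreal C1 * S + ennreal C1 * S + ennreal (C2 * C3) * S)"
      by (intro mult_left_mono add_mono I1 I2 I3) auto
    also have "\<dots> = ennreal c * S"
    proof -
      have "ennreal c = ennreal C * (ennreal C1 + ennreal C1 + ennreal (C2 * C3))"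
      proof -
        have "c = C * (C1 + C1 + C2 * C3)" by (simp add: c_def)
        then have "ennreal c = ennreal C * ennreal (C1 + C1 + C2 * C3)"
          using C(1) C1(1) C2(1) C3(1) by (simp only:) (intro ennreal_mult, auto)
        also have "ennreal (C1 + C1 + C2 * C3) = ennreal (C1 + C1) + ennreal (C2 * C3)"
          using C1(1) C2(1) C3(1) by (intro ennreal_plus) auto
        also have "ennreal (C1 + C1) = ennreal C1 + ennreal C1"
          using C1(1) by (intro ennreal_plus) auto
        finally show ?thesis .
      qed
      then show ?thesis by (simp only: distrib_right distrib_left mult.assoc)
    qed
    finally show ?thesis using A0 unfolding S_def by blast
  qed
  show ?thesis
    by (rule that[OF \<open>c > 0\<close>], rule main[unfolded n_def e_def])
qed

section \<open>Borel representatives and Lebesgue integrals\<close>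

text \<open>The Tonelli arguments need integrands that are jointly Borel measurable in several
  points, which a Lebesgue measurable field does not provide. Each coordinate of its extension by
  zero is replaced by an almost everywhere equal Borel function.\<close>

lemma AE_lborel_representative:
  fixes u :: "'a::euclidean_space \<Rightarrow> real^'n"
  assumes "S \<in> sets lebesgue" and u: "u \<in> borel_measurable (lebesgue_on S)"
  obtains u' where "u' \<in> borel_measurable borel" "AE x in lborel. x \<in> S \<longrightarrow> u x = u' x"
proof -
  define v where "v x = (if x \<in> S then u x else 0)" for x
  have v: "v \<in> borel_measurable lebesgue"
    using borel_measurable_if_I[OF u assms(1)] by (simp add: v_def[abs_def])
  have "(\<lambda>x. v x $ i) \<in> borel_measurable lebesgue" for i
    using measurable_compose[OF v borel_measurable_nth] by simp
  then have "\<exists>w\<in>borel_measurable lborel. AE x in lborel. v x $ i = w x" for i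
    by (rule completion_ex_borel_measurable_real)
  then obtain w where w: "\<And>i. w i \<in> borel_measurable lborel" "\<And>i. AE x in lborel. v x $ i = w i x"
    by metis
  have "AE x in lborel. \<forall>i. v x $ i = w i x"
    using w(2) by (simp add: AE_all_countable)
  then have "AE x in lborel. x \<in> S \<longrightarrow> u x = (\<chi> i. w i x)"
    by eventually_elim (auto simp: v_def vec_eq_iff)
  moreover have "(\<lambda>x. \<chi> i. w i x) \<in> borel_measurable borel"
    using w(1) by (subst borel_measurable_euclidean_space) (auto simp: Basis_vec_def inner_axis)
  ultimately show ?thesis using that by blast
qed

text \<open>For \<open>\<tau> \<le> 1\<close> the inner balls stay inside the domain, so changing
  the field on a null set affects neither the inner integrals nor, up to a null set of
  \<open>x\<close>, the outer one. No measurability of \<open>f\<close> is required.\<close>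

lemma whitney_integral_cong:
  fixes \<Omega> :: "(real^'n) set" and f :: "real^'n \<Rightarrow> real^'n \<Rightarrow> real^'n \<Rightarrow> real^'n \<Rightarrow> ennreal"
  assumes \<tau>: "0 \<le> \<tau>" "\<tau> \<le> 1" and ae: "AE x in lborel. x \<in> \<Omega> \<longrightarrow> u x = u' x"
  shows "(\<integral>\<^sup>+x\<in>\<Omega>. (\<integral>\<^sup>+y\<in>ball x (\<tau> * bdist \<Omega> x). f (u x) (u y) x y \<partial>lebesgue) \<partial>lebesgue)
    = (\<integral>\<^sup>+x\<in>\<Omega>. (\<integral>\<^sup>+y\<in>ball x (\<tau> * bdist \<Omega> x). f (u' x) (u' y) x y \<partial>lborel) \<partial>lborel)"
  unfolding nn_integral_completion
proof (rule nn_integral_cong_AE, use ae in eventually_elim)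
  fix x assume x: "x \<in> \<Omega> \<longrightarrow> u x = u' x"
  show "(\<integral>\<^sup>+y\<in>ball x (\<tau> * bdist \<Omega> x). f (u x) (u y) x y \<partial>lborel) * indicator \<Omega> x
      = (\<integral>\<^sup>+y\<in>ball x (\<tau> * bdist \<Omega> x). f (u' x) (u' y) x y \<partial>lborel) * indicator \<Omega> x"
  proof (cases "x \<in> \<Omega>")
    case True
    have "\<tau> * bdist \<Omega> x \<le> 1 * bdist \<Omega> x"
      using \<tau> by (intro mult_right_mono) (auto simp: bdist_def infdist_nonneg)
    then have sub: "ball x (\<tau> * bdist \<Omega> x) \<subseteq> \<Omega>"
      using ball_bdist_subset[OF True] subset_ball[of "\<tau> * bdist \<Omega> x" "bdist \<Omega> x" x] by simp
    have "(\<integral>\<^sup>+y\<in>ball x (\<tau> * bdist \<Omega> x). f (u x) (u y) x y \<partial>lborel)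
        = (\<integral>\<^sup>+y\<in>ball x (\<tau> * bdist \<Omega> x). f (u' x) (u' y) x y \<partial>lborel)"
    proof (rule nn_integral_cong_AE, use ae in eventually_elim)
      fix y assume "y \<in> \<Omega> \<longrightarrow> u y = u' y"
      then show "f (u x) (u y) x y * indicator (ball x (\<tau> * bdist \<Omega> x)) y
          = f (u' x) (u' y) x y * indicator (ball x (\<tau> * bdist \<Omega> x)) y"
        using sub x True by (cases "y \<in> ball x (\<tau> * bdist \<Omega> x)") auto
    qed
    then show ?thesis by simp
  qed simp
qed

lemma strain_energy_eq:
  "(\<integral>\<^sup>+x\<in>\<Omega>. (\<integral>\<^sup>+y\<in>ball x (\<tau> * bdist \<Omega> x).
      ennreal (\<bar>(u y - u x) \<bullet> (y - x)\<bar> powr p / norm (y - x) powr k) \<partial>lborel) \<partial>lborel) = strain_energy p k \<Omega> \<tau> u"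
  unfolding strain_energy_def
proof (rule nn_integral_cong)
  fix x
  show "(\<integral>\<^sup>+y\<in>ball x (\<tau> * bdist \<Omega> x). ennreal (\<bar>(u y - u x) \<bullet> (y - x)\<bar> powr p / norm (y - x) powr k) \<partial>lborel) * indicator \<Omega> x
    = (\<integral>\<^sup>+y. ennreal (strain u x y powr p * dist x y powr (- k)) * indicator (whitney_pairs \<Omega> \<tau>) (x, y) \<partial>lborel)"
  proof (cases "x \<in> \<Omega>")
    case True
    have "ennreal (\<bar>(u y - u x) \<bullet> (y - x)\<bar> powr p / norm (y - x) powr k) * indicator (ball x (\<tau> * bdist \<Omega> x)) y
        = ennreal (strain u x y powr p * dist x y powr (- k)) * indicator (whitney_pairs \<Omega> \<tau>) (x, y)" for y
      using True strain_commute[of u x y]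
      by (simp add: whitney_pairs_def strain_def indicator_def dist_norm norm_minus_commute powr_minus divide_inverse)
    then show ?thesis using True by simp
  qed (simp add: whitney_pairs_def)
qed

lemma enn_root_le:
  assumes "0 < p" "0 < c" "I \<le> ennreal c * J"
  shows "enn_root p I \<le> ennreal (c powr (1 / p)) * enn_root p J"
proof (cases J)
  case (real j)
  then have "I \<le> ennreal (c * j)" using assms by (simp add: ennreal_mult)
  then obtain i where i: "I = ennreal i" "0 \<le> i" "i \<le> c * j"
    using real assms by (cases I) (auto simp: top_unique)
  have "i powr (1 / p) \<le> (c * j) powr (1 / p)"
    using i assms by (intro powr_mono2) auto
  also have "\<dots> = c powr (1 / p) * j powr (1 / p)" by (rule powr_mult)
  finally show ?thesis
    using i real by (simp add: enn_root_def flip: ennreal_mult)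
next
  case top
  then show ?thesis using assms by (simp add: enn_root_def ennreal_mult_top)
qed

theorem theorem5p2:
  fixes \<Omega> :: "(real^'n) set" and p s \<tau>1 \<tau>2 :: real
  assumes "john_domain \<Omega>"
    and "1 < p"
    and "0 < s" and "s < 1"
    and "0 < \<tau>1" and "\<tau>1 < 1 / (36 * sqrt (real CARD('n)))"
    and "3 / 5 \<le> \<tau>2" and "\<tau>2 < 1"
  shows "\<exists>C::real. \<forall>u \<in> W_space \<Omega> s p \<tau>2.
           (INF r \<in> RM. W_semi \<Omega> s p \<tau>1 (\<lambda>x. u x - r x)) \<le> ennreal C * X_semi \<Omega> s p \<tau>2 u"
proof -
  let ?n = "real CARD('n)"
  obtain c where c: "c > 0" "\<And>u. u \<in> borel_measurable borel \<Longrightarrow> \<exists>A0::real^'n^'n. transpose A0 = - A0 \<and>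
     (\<integral>\<^sup>+x\<in>\<Omega>. (\<integral>\<^sup>+y\<in>ball x (\<tau>1 * bdist \<Omega> x).
        ennreal (norm (u y - u x - A0 *v (y - x)) powr p / norm (y - x) powr (?n + s * p)) \<partial>lborel) \<partial>lborel)
      \<le> ennreal c * strain_energy p (?n + s * p + p) \<Omega> \<tau>2 u"
    using korn_lborel[OF assms(1-7)] by blast
  have "open \<Omega>" using assms(1) by (simp add: john_domain_def)
  have "1 \<le> sqrt ?n" by (simp add: Suc_leI)
  then have "1 \<le> 36 * sqrt ?n" by linarith
  then have "1 / (36 * sqrt ?n) \<le> 1" by (subst divide_le_eq_1) auto
  then have \<tau>1: "0 \<le> \<tau>1" "\<tau>1 \<le> 1" using assms(5,6) by linarith+
  have \<tau>2: "0 \<le> \<tau>2" "\<tau>2 \<le> 1" using assms(7,8) by linarith+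
  have "(INF r \<in> RM. W_semi \<Omega> s p \<tau>1 (\<lambda>x. u x - r x)) \<le> ennreal (c powr (1 / p)) * X_semi \<Omega> s p \<tau>2 u"
    if "u \<in> W_space \<Omega> s p \<tau>2" for u
  proof -
    have "u \<in> borel_measurable (lebesgue_on \<Omega>)"
      using that by (simp add: W_space_def Lp_vec_def)
    moreover have "\<Omega> \<in> sets lebesgue" using \<open>open \<Omega>\<close> by simp
    ultimately obtain u' where u': "u' \<in> borel_measurable borel" "AE x in lborel. x \<in> \<Omega> \<longrightarrow> u x = u' x"
      using AE_lborel_representative by blast
    obtain A :: "real^'n^'n" where A: "transpose A = - A" and le:
      "(\<integral>\<^sup>+x\<in>\<Omega>. (\<integral>\<^sup>+y\<in>ball x (\<tau>1 * bdist \<Omega> x).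
        ennreal (norm (u' y - u' x - A *v (y - x)) powr p / norm (y - x) powr (?n + s * p)) \<partial>lborel) \<partial>lborel)
      \<le> ennreal c * strain_energy p (?n + s * p + p) \<Omega> \<tau>2 u'"
      using c(2)[OF u'(1)] by blast
    \<comment> \<open>The seminorm sees only differences, so the translation of the competitor may
      be taken to be 0.\<close>
    have "(\<lambda>x. A *v x + 0) \<in> RM" using A unfolding RM_def by blast
    then have "(INF r \<in> RM. W_semi \<Omega> s p \<tau>1 (\<lambda>x. u x - r x)) \<le> W_semi \<Omega> s p \<tau>1 (\<lambda>x. u x - (A *v x + 0))"
      by (rule INF_lower)
    also have "\<dots> = enn_root p (\<integral>\<^sup>+x\<in>\<Omega>. (\<integral>\<^sup>+y\<in>ball x (\<tau>1 * bdist \<Omega> x).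
        ennreal (norm (u y - u x - A *v (y - x)) powr p / norm (y - x) powr (?n + s * p)) \<partial>lebesgue) \<partial>lebesgue)"
    proof -
      have "u y - (A *v y + 0) - (u x - (A *v x + 0)) = u y - u x - A *v (y - x)" for x y
        by (simp add: matrix_vector_mult_diff_distrib)
      then show ?thesis unfolding W_semi_def by (simp only:)
    qed
    also have "\<dots> \<le> ennreal (c powr (1 / p)) * enn_root p (strain_energy p (?n + s * p + p) \<Omega> \<tau>2 u')"
      unfolding whitney_integral_cong[OF \<tau>1 u'(2), of "\<lambda>ux uy x y. ennreal (norm (uy - ux - A *v (y - x)) powr p / norm (y - x) powr (?n + s * p))"]
      using assms(2) c(1) le by (intro enn_root_le) auto
    also have "enn_root p (strain_energy p (?n + s * p + p) \<Omega> \<tau>2 u') = X_semi \<Omega> s p \<tau>2 u"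
      unfolding X_semi_def strain_energy_eq[symmetric]
        whitney_integral_cong[OF \<tau>2 u'(2), of "\<lambda>ux uy x y. ennreal (\<bar>(uy - ux) \<bullet> (y - x)\<bar> powr p / norm (y - x) powr (?n + s * p + p))"] ..
    finally show ?thesis .
  qed
  then show ?thesis by blast
qed

end
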